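(* Let $n\in\mathbb{N}$. The Triebel-Lizorkin-Lorentz space $F^{s,r}_{p,q}$ on $\mathbb{R}^n$ has property $(\alpha)$ for all $s \in \mathbb{R}$ and $1 < p,q,r < \infty$.
   Context: Lorentz spaces: for a Banach space $X$ and a measurable $f:\mathbb{R}^n\to X$ put $d_f(\alpha)=|\{x:\|f(x)\|>\alpha\}|$, $f^*(t)=\inf\{\alpha\ge 0: d_f(\alpha)\le t\}$. $L_{p,r}(\mathbb{R}^n,X)$ consists of those $f$ for which $\big(\int_0^\infty [t^{1/p}f^*(t)]^r\frac{dt}{t}\big)^{1/r}$ (for $r<\infty$), resp. $\sup_{t>0}t^{1/p}f^*(t)$ (for $r=\infty$), is finite; it is normable for $p>1$. $l^s_q$ is the space of complex sequences $a=(a_k)_{k\in\mathbb{N}_0}$ with $\|a\|_{l^s_q}=\big(\sum_k [2^{ks}|a_k|]^q\big)^{1/q}<\infty$. Triebel-Lizorkin-Lorentz spaces (on $\mathbb{R}^n$): for $s\in\mathbb{R}$, $1<p,q<\infty$, $1\le r\le\infty$, $F^{s,r}_{p,q}=\{u\in\mathscr{S}'(\mathbb{R}^n): \|u\|_{F^{s,r}_{p,q}}:=\|(\varphi_k*u)_{k\in\mathbb{N}_0}\|_{L_{p,r}(\mathbb{R}^n,l^s_q)}<\infty\}$. Here $(\varphi_k)_{k\in\mathbb{N}_0}\subset\mathscr{S}(\mathbb{R}^n)$ is a fixed system such that, for some $N\in\mathbb{N}$: $\widehat\varphi_k\ge 0$; $\mathrm{supp}\,\widehat\varphi_k\subset\{2^{k-N}\le|x|\le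 2^{k+N}\}$ for $k\ge1$ and $\mathrm{supp}\,\widehat\varphi_0\subset\{|x|\le 2^N\}$; $D_1\le\sum_k\widehat\varphi_k\le D_2$ for some constants $D_1,D_2>0$; and for each $\alpha\in\mathbb{N}_0^n$ there is $C_\alpha$ with $|\xi|^{|\alpha|}|\partial^\alpha\widehat\varphi_k(\xi)|\le C_\alpha$ for all $k,\xi$. Different systems give the same space with equivalent norms. Property $(\alpha)$: for a probability space $P=(\Omega,\mathcal{A},\mu)$ let $\mathcal{E}_P$ be the set of families of independent, symmetrically distributed $\{\pm1\}$-valued random variables on $P$. A complex Banach space $X$ has property $(\alpha)$ if there exist $1\le p<\infty$, probability spaces $P,P'$ on $\Omega,\Omega'$ with $\mathcal{E}_P,\mathcal{E}_{P'}\neq\emptyset$, and a constant $\alpha>0$ such that for all $N\in\mathbb{N}$, $x_{ij}\in X$, $a_{ij}\in\mathbb{C}$ with $|a_{ij}|\le1$ ($i,j=1,\dots,N$), and all $(\epsilon_1,\dots,\epsilon_N)\in\mathcal{E}_P$, $(\epsilon_1',\dots,\epsilon_N')\in\mathcal{E}_{P'}$: $\big\|\sum_{i,j=1}^N\epsilon_i\epsilon_j'a_{ij}x_{ij}\big\|_{L_p(\Omega\times\Omega',X)}\le\alpha\big\|\sum_{i,j=1}^N\epsilon_i\epsilon_j'x_{ij}\big\|_{L_p(\Omega\times\Omega',X)}$. *)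

theory Defs
  imports "HOL-Probability.Probability" "HOL-Library.Function_Algebras"
begin

section \<open>Schwartz functions and tempered distributions\<close>

definition partial :: "'n \<Rightarrow> (real^'n \<Rightarrow> complex) \<Rightarrow> real^'n \<Rightarrow> complex" where
  "partial i f x = vector_derivative (\<lambda>t. f (x + t *\<^sub>R axis i 1)) (at 0)"

text \<open>A multi-index is encoded as the list of coordinates in which one differentiates, so its
  order is the length of the list. All functions below are smooth, hence the order of the list
  does not matter.\<close>

primrec partials :: "'n list \<Rightarrow> (real^'n \<Rightarrow> complex) \<Rightarrow> real^'n \<Rightarrow> complex" where
  "partials [] f = f"
| "partials (i # is) f = partial i (partials is f)"

definition smooth :: "(real^'n \<Rightarrow> complex) \<Rightarrow> bool" where
  "smooth f \<longleftrightarrow> (\<forall>is x. partials is f differentiable (at x))"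

definition schwartz :: "(real^'n \<Rightarrow> complex) set" where
  "schwartz = {f. smooth f \<and>
     (\<forall>is m. \<exists>C. \<forall>x. (1 + norm x) ^ m * norm (partials is f x) \<le> C)}"

definition schwartz_seminorm :: "nat \<Rightarrow> (real^'n \<Rightarrow> complex) \<Rightarrow> real" where
  "schwartz_seminorm m f =
     (SUP (is, x) \<in> {is. length is \<le> m} \<times> UNIV. (1 + norm x) ^ m * norm (partials is f x))"

text \<open>Functionals are total functions on the function type, normalised to be 0 outside
  the Schwartz space. Continuity means continuity for the topology generated by the (increasing)
  family of Schwartz seminorms.\<close>

definition tempered :: "((real^'n \<Rightarrow> complex) \<Rightarrow> complex) set" where
  "tempered = {u.
     (\<forall>f. f \<notin> schwartz \<longrightarrow> u f = 0) \<and>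
     (\<forall>f\<in>schwartz. \<forall>g\<in>schwartz. u (\<lambda>x. f x + g x) = u f + u g) \<and>
     (\<forall>c. \<forall>f\<in>schwartz. u (\<lambda>x. c * f x) = c * u f) \<and>
     (\<exists>m C. \<forall>f\<in>schwartz. norm (u f) \<le> C * schwartz_seminorm m f)}"

definition fun_scale :: "complex \<Rightarrow> ('a \<Rightarrow> complex) \<Rightarrow> 'a \<Rightarrow> complex" where
  "fun_scale c u = (\<lambda>f. c * u f)"

definition distr_conv ::
  "(real^'n \<Rightarrow> complex) \<Rightarrow> ((real^'n \<Rightarrow> complex) \<Rightarrow> complex) \<Rightarrow> real^'n \<Rightarrow> complex" where
  "distr_conv f u x = u (\<lambda>y. f (x - y))"

text \<open>The conditions on a Littlewood-Paley system below are invariant under the usual changes of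
  normalisation of the Fourier transform (multiplication by a positive constant, dilation by
  2 pi), so that the choice made here is immaterial.\<close>

definition fourier :: "(real^'n \<Rightarrow> complex) \<Rightarrow> real^'n \<Rightarrow> complex" where
  "fourier f \<xi> = (LINT x|lborel. exp (- \<i> * complex_of_real (x \<bullet> \<xi>)) * f x)"

definition fsupport :: "(real^'n \<Rightarrow> complex) \<Rightarrow> (real^'n) set" where
  "fsupport f = closure {x. f x \<noteq> 0}"

definition lp_system :: "(nat \<Rightarrow> real^'n \<Rightarrow> complex) \<Rightarrow> bool" where
  "lp_system \<phi> \<longleftrightarrow>
     (\<forall>k. \<phi> k \<in> schwartz) \<and>
     (\<forall>k \<xi>. fourier (\<phi> k) \<xi> \<in> \<real>\<^sub>\<ge>\<^sub>0) \<and>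
     (\<exists>N::nat.
        (\<forall>k\<ge>1. fsupport (fourier (\<phi> k)) \<subseteq>
           {\<xi>. 2 powr (real k - real N) \<le> norm \<xi> \<and> norm \<xi> \<le> 2 powr (real k + real N)}) \<and>
        fsupport (fourier (\<phi> 0)) \<subseteq> {\<xi>. norm \<xi> \<le> 2 powr real N}) \<and>
     (\<exists>D1>0. \<exists>D2>0. \<forall>\<xi>. D1 \<le> (\<Sum>k. Re (fourier (\<phi> k) \<xi>)) \<and> (\<Sum>k. Re (fourier (\<phi> k) \<xi>)) \<le> D2) \<and>
     (\<forall>is. \<exists>C. \<forall>k \<xi>. norm \<xi> ^ length is * norm (partials is (fourier (\<phi> k)) \<xi>) \<le> C)"

section \<open>Lorentz and Triebel-Lizorkin-Lorentz spaces\<close>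

text \<open>Power of an extended nonnegative number; only used for positive exponents.\<close>

definition epowr :: "ennreal \<Rightarrow> real \<Rightarrow> ennreal" where
  "epowr x a = (if x = \<infinity> then \<infinity> else ennreal (enn2real x powr a))"

text \<open>The norm of l(s,q), with the value infinity for sequences outside of l(s,q).\<close>

definition lq_norm :: "real \<Rightarrow> real \<Rightarrow> (nat \<Rightarrow> complex) \<Rightarrow> ennreal" where
  "lq_norm s q a = epowr (\<Sum>k. ennreal ((2 powr (real k * s) * norm (a k)) powr q)) (1 / q)"

text \<open>In the following three definitions \<open>nrm\<close> is the norm of the target space.\<close>

definition distribution_fun :: "('x \<Rightarrow> ennreal) \<Rightarrow> (real^'n \<Rightarrow> 'x) \<Rightarrow> real \<Rightarrow> ennreal" where
  "distribution_fun nrm f \<alpha> = emeasure lborel {x. nrm (f x) > ennreal \<alpha>}"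

definition rearrangement :: "('x \<Rightarrow> ennreal) \<Rightarrow> (real^'n \<Rightarrow> 'x) \<Rightarrow> real \<Rightarrow> ennreal" where
  "rearrangement nrm f t = (INF \<alpha>\<in>{\<alpha>. 0 \<le> \<alpha> \<and> distribution_fun nrm f \<alpha> \<le> ennreal t}. ennreal \<alpha>)"

definition lorentz_norm :: "('x \<Rightarrow> ennreal) \<Rightarrow> real \<Rightarrow> real \<Rightarrow> (real^'n \<Rightarrow> 'x) \<Rightarrow> ennreal" where
  "lorentz_norm nrm p r f =
     epowr (\<integral>\<^sup>+t\<in>{0<..}. epowr (ennreal (t powr (1 / p)) * rearrangement nrm f t) r * ennreal (1 / t) \<partial>lborel)
       (1 / r)"

text \<open>A finite Lorentz norm forces the values to lie in l(s,q) almost everywhere; since l(s,q)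
  is separable, measurability is measurability of the components.\<close>

definition lorentz_lq :: "real \<Rightarrow> real \<Rightarrow> real \<Rightarrow> real \<Rightarrow> (real^'n \<Rightarrow> nat \<Rightarrow> complex) set" where
  "lorentz_lq p r s q = {f. (\<forall>k. (\<lambda>x. f x k) \<in> borel_measurable lborel) \<and>
     lorentz_norm (lq_norm s q) p r f < \<infinity>}"

definition tll_space ::
  "(nat \<Rightarrow> real^'n \<Rightarrow> complex) \<Rightarrow> real \<Rightarrow> real \<Rightarrow> real \<Rightarrow> real \<Rightarrow> ((real^'n \<Rightarrow> complex) \<Rightarrow> complex) set" where
  "tll_space \<phi> s r p q = {u \<in> tempered. (\<lambda>x k. distr_conv (\<phi> k) u x) \<in> lorentz_lq p r s q}"

definition tll_norm ::
  "(nat \<Rightarrow> real^'n \<Rightarrow> complex) \<Rightarrow> real \<Rightarrow> real \<Rightarrow> real \<Rightarrow> real \<Rightarrow> ((real^'n \<Rightarrow> complex) \<Rightarrow> complex) \<Rightarrow> real" where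
  "tll_norm \<phi> s r p q u = enn2real (lorentz_norm (lq_norm s q) p r (\<lambda>x k. distr_conv (\<phi> k) u x))"

section \<open>Complex Banach spaces and property (\<open>\<alpha>\<close>)\<close>

text \<open>A complex space is given by a scalar multiplication, a carrier and a norm on the carrier.\<close>

definition complex_banach_on ::
  "(complex \<Rightarrow> 'v \<Rightarrow> 'v::ab_group_add) \<Rightarrow> 'v set \<Rightarrow> ('v \<Rightarrow> real) \<Rightarrow> bool" where
  "complex_banach_on scl V nrm \<longleftrightarrow>
     vector_space scl \<and> module.subspace scl V \<and>
     (\<forall>x\<in>V. 0 \<le> nrm x \<and> (nrm x = 0 \<longleftrightarrow> x = 0)) \<and>
     (\<forall>x\<in>V. \<forall>y\<in>V. nrm (x + y) \<le> nrm x + nrm y) \<and>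
     (\<forall>c. \<forall>x\<in>V. nrm (scl c x) = norm c * nrm x) \<and>
     (\<forall>X. (\<forall>m. X m \<in> V) \<and> (\<forall>e>0. \<exists>M. \<forall>m\<ge>M. \<forall>k\<ge>M. nrm (X m - X k) < e) \<longrightarrow>
        (\<exists>l\<in>V. (\<lambda>m. nrm (X m - l)) \<longlonglongrightarrow> 0))"

definition equivalent_norms_on :: "'v set \<Rightarrow> ('v \<Rightarrow> real) \<Rightarrow> ('v \<Rightarrow> real) \<Rightarrow> bool" where
  "equivalent_norms_on V nrm1 nrm2 \<longleftrightarrow>
     (\<exists>c>0. \<exists>C>0. \<forall>x\<in>V. c * nrm1 x \<le> nrm2 x \<and> nrm2 x \<le> C * nrm1 x)"

definition rademacher_family :: "'w measure \<Rightarrow> nat \<Rightarrow> (nat \<Rightarrow> 'w \<Rightarrow> real) \<Rightarrow> bool" where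
  "rademacher_family P N \<epsilon> \<longleftrightarrow>
     prob_space.indep_vars P (\<lambda>_. borel) \<epsilon> {1..N} \<and>
     (\<forall>i\<in>{1..N}. (\<forall>w\<in>space P. \<epsilon> i w \<in> {-1, 1}) \<and>
        measure P {w\<in>space P. \<epsilon> i w = 1} = measure P {w\<in>space P. \<epsilon> i w = -1})"

definition Lp_norm :: "'w measure \<Rightarrow> real \<Rightarrow> ('v \<Rightarrow> real) \<Rightarrow> ('w \<Rightarrow> 'v) \<Rightarrow> real" where
  "Lp_norm M p nrm f = (LINT w|M. nrm (f w) powr p) powr (1 / p)"

text \<open>The probability spaces are required to carry Rademacher families of every finite length:
  on a space carrying only short families (a single fair coin, say) the inequality would be void
  for large \<open>N\<close>. As the quantities compared depend only on the joint distribution of the signs, it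
  is no restriction that the sample spaces are sets of 0-1-sequences; some type has to be fixed
  because one cannot quantify existentially over types.

  Only algebraic operations and \<open>nrm\<close> enter the definition, so that it also makes sense for a
  (normable) quasi-norm. It is invariant under passing to an equivalent (quasi-)norm.\<close>

definition property_alpha ::
  "(complex \<Rightarrow> 'v \<Rightarrow> 'v::ab_group_add) \<Rightarrow> 'v set \<Rightarrow> ('v \<Rightarrow> real) \<Rightarrow> bool" where
  "property_alpha scl V nrm \<longleftrightarrow>
     (\<exists>p\<ge>1. \<exists>(P :: (nat \<Rightarrow> bool) measure) (P' :: (nat \<Rightarrow> bool) measure). \<exists>\<alpha>>0.
        prob_space P \<and> prob_space P' \<and>
        (\<forall>N. \<exists>\<epsilon>. rademacher_family P N \<epsilon>) \<and> (\<forall>N. \<exists>\<epsilon>. rademacher_family P' N \<epsilon>) \<and>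
        (\<forall>N x a \<epsilon> \<epsilon>'.
           (\<forall>i\<in>{1..N}. \<forall>j\<in>{1..N}. x i j \<in> V \<and> norm (a i j) \<le> 1) \<longrightarrow>
           rademacher_family P N \<epsilon> \<longrightarrow> rademacher_family P' N \<epsilon>' \<longrightarrow>
           Lp_norm (P \<Otimes>\<^sub>M P') p nrm
             (\<lambda>(w, w'). \<Sum>i=1..N. \<Sum>j=1..N. scl (complex_of_real (\<epsilon> i w * \<epsilon>' j w') * a i j) (x i j))
           \<le> \<alpha> * Lp_norm (P \<Otimes>\<^sub>M P') p nrm
             (\<lambda>(w, w'). \<Sum>i=1..N. \<Sum>j=1..N. scl (complex_of_real (\<epsilon> i w * \<epsilon>' j w')) (x i j))))"

end

theory Submission
  imports Defs
begin

text \<open>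
  By linearity of \<open>u \<mapsto> \<phi>\<^sub>k * u\<close> and measurability of the components, the claim concerns double
  Rademacher sums with coefficients in the function lattice \<open>L\<^sub>p\<^sub>,\<^sub>r(l\<^sup>s\<^sub>q)\<close>. The guiding idea is that in such
  a lattice a random sum \<open>\<Sum> \<epsilon>\<^sub>i \<epsilon>'\<^sub>j x\<^sub>i\<^sub>j\<close> has on average the size of its square function
  \<open>S = (\<Sum> |x\<^sub>i\<^sub>j|\<^sup>2)\<^sup>1\<^sup>/\<^sup>2\<close>, taken pointwise, and multiplying the \<open>x\<^sub>i\<^sub>j\<close> by numbers of modulus at most 1
  cannot increase \<open>S\<close>.

  Both comparisons are first made at a fixed point \<open>x\<close>, where \<open>g\<^sub>w(x)\<close> denotes the \<open>l\<^sup>s\<^sub>q\<close> norm of the random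
  sum for the choice of signs \<open>w\<close>, and \<open>S(x)\<close> the \<open>l\<^sup>s\<^sub>q\<close> norm of the square function. Khintchine's
  inequality and Jensen's inequality give moment bounds for \<open>g\<^sub>w(x)\<close> of every order by \<open>S(x)\<close>, hence tails
  of arbitrarily fast polynomial decay (lemma \<open>lq_norm_chaos_tail\<close>); with the exact second moment and the
  Paley-Zygmund argument they show that \<open>g\<^sub>w(x)\<close> exceeds a fixed multiple of \<open>S(x)\<close> for a fixed
  proportion of all signs (lemma \<open>lq_norm_chaos_large\<close>).

  To pass to the Lorentz norm, the outer exponent in property \<open>(\<alpha>)\<close> is chosen as \<open>r\<close>, and the
  Lorentz norm is rewritten in terms of the distribution function: up to a constant, its \<open>r\<close>-th power is
  \<open>\<integral> \<alpha>\<^sup>r\<^sup>-\<^sup>1 d(\<alpha>)\<^sup>r\<^sup>/\<^sup>p d\<alpha>\<close> (lemma \<open>lorentz_norm_eq_modulus\<close>). Averages over the signs then commute with the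
  integral, and one has to compare averages of \<open>d\<^sub>g(\<alpha>)\<^sup>r\<^sup>/\<^sup>p\<close> with \<open>d\<^sub>S(\<alpha>)\<^sup>r\<^sup>/\<^sup>p\<close> only. This is done by
  lemma \<open>lorentz_modulus_le_of_large\<close> on the set where \<open>S > \<alpha>\<close>, and by lemma
  \<open>lorentz_modulus_le_of_tail\<close>, which decomposes space into the dyadic layers of \<open>S\<close> and sums
  the tail bounds. Both lemmas count exceptional signs rather than apply a convexity inequality to the
  power \<open>r / p\<close>, and therefore treat \<open>r \<le> p\<close> and \<open>r > p\<close> in the same way.

  All expectations are finite averages over sets of signs, since the joint law of a Rademacher
  family of length \<open>N\<close> is uniform on the \<open>2\<^sup>N\<close> sign vectors (lemma \<open>Lp_norm_rademacher\<close>). An equivalent norm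
  only changes the constant.
\<close>

section \<open>Powers of extended nonnegative numbers\<close>

lemma epowr_ennreal: "0 \<le> x \<Longrightarrow> epowr (ennreal x) a = ennreal (x powr a)"
  by (simp add: epowr_def)

lemma epowr_top [simp]: "epowr top a = top"
  by (simp add: epowr_def)

lemma epowr_0 [simp]: "epowr 0 a = 0"
  by (simp add: epowr_def)

lemma epowr_eq_top_iff: "epowr x a = top \<longleftrightarrow> x = top"
  by (simp add: epowr_def)

lemma epowr_mono: "x \<le> y \<Longrightarrow> 0 \<le> a \<Longrightarrow> epowr x a \<le> epowr y a"
  by (cases x; cases y) (auto simp: epowr_ennreal top_unique intro!: ennreal_leI powr_mono2)

lemma epowr_mult: "epowr (x * y) a = epowr x a * epowr y a" if "0 < a"
proof (cases "x = top \<or> y = top")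
  case True
  then show ?thesis
    using that by (auto simp: ennreal_top_mult ennreal_mult_top epowr_eq_top_iff epowr_def enn2real_eq_0_iff)
next
  case False
  then show ?thesis
    by (cases x; cases y) (auto simp: epowr_ennreal ennreal_mult[symmetric] powr_mult)
qed

lemma epowr_epowr: "epowr (epowr x a) b = epowr x (a * b)"
  by (cases x) (auto simp: epowr_ennreal powr_powr)

lemma epowr_1 [simp]: "epowr x 1 = x"
  by (cases x) (auto simp: epowr_ennreal)

lemma measurable_epowr [measurable]: "(\<lambda>x. epowr x a) \<in> borel_measurable borel"
  unfolding epowr_def by measurable

text \<open>Superlevel sets of an antitone function are intervals.\<close>

lemma borel_measurable_antimono_ennreal:
  fixes h :: "real \<Rightarrow> ennreal"
  assumes "antimono h"
  shows "h \<in> borel_measurable borel"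
proof (rule borel_measurableI_greater)
  fix y
  have "is_interval {x. y < h x}"
    unfolding is_interval_1 using assms by (auto dest: antimonoD intro: less_le_trans)
  then have "{x. y < h x} \<in> sets borel"
    by (rule real_interval_borel_measurable)
  then show "{x \<in> space borel. y < h x} \<in> sets borel" by simp
qed

section \<open>The Lorentz norm through the distribution function\<close>

text \<open>Up to a factor \<open>p\<close> this is the \<open>r\<close>-th power of the Lorentz norm of \<open>g\<close> when \<open>\<theta> = r / p\<close>.
  Unlike the formula with the rearrangement it involves the measures of superlevel sets directly, so that
  averages over families of functions can be estimated level by level.\<close>

definition lorentz_modulus :: "real \<Rightarrow> real \<Rightarrow> (real^'n \<Rightarrow> ennreal) \<Rightarrow> ennreal" where
  "lorentz_modulus r \<theta> g =
     (\<integral>\<^sup>+\<alpha>\<in>{0<..}. ennreal (\<alpha> powr (r - 1)) * epowr (emeasure lborel {x. g x > ennreal \<alpha>}) \<theta> \<partial>lborel)"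

lemma nn_integral_powr_Icc:
  assumes "0 < a" "0 \<le> c"
  shows "(\<integral>\<^sup>+t\<in>{0..c}. ennreal (t powr (a - 1)) \<partial>lborel) = ennreal (c powr a / a)"
proof -
  have "((\<lambda>x. x powr (a - 1)) has_integral (c powr (a - 1 + 1) / (a - 1 + 1))) {0..c}"
    using assms by (intro has_integral_powr_from_0) auto
  then have "((\<lambda>x. x powr (a - 1)) has_integral (c powr a / a)) {0..c}"
    by simp
  from nn_integral_has_integral_lebesgue[OF _ this] show ?thesis
    by (simp add: ennreal_mult' ennreal_indicator mult.commute)
qed

lemma nn_integral_powr_less:
  assumes "0 < a"
  shows "(\<integral>\<^sup>+t\<in>{t. 0 < t \<and> ennreal t < c}. ennreal (t powr (a - 1)) \<partial>lborel)
     = ennreal (1 / a) * epowr c a" (is "?I = _")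
    and "(\<integral>\<^sup>+t\<in>{t. 0 < t \<and> ennreal t \<le> c}. ennreal (t powr (a - 1)) \<partial>lborel)
     = ennreal (1 / a) * epowr c a" (is "?J = _")
proof -
  have null: "AE t in lborel. t \<noteq> x" for x :: real
    by (rule AE_lborel_singleton)
  have "?I = ennreal (1 / a) * epowr c a \<and> ?J = ennreal (1 / a) * epowr c a"
  proof (cases c)
    case (real b)
    have "?I = (\<integral>\<^sup>+t\<in>{0..b}. ennreal (t powr (a - 1)) \<partial>lborel)"
      using null[of 0] null[of b]
      by (intro nn_integral_cong_AE, eventually_elim) (auto simp: real indicator_def ennreal_less_iff)
    moreover have "?J = (\<integral>\<^sup>+t\<in>{0..b}. ennreal (t powr (a - 1)) \<partial>lborel)"
      using null[of 0] null[of b]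
      by (intro nn_integral_cong_AE, eventually_elim) (auto simp: real indicator_def)
    ultimately show ?thesis
      using real assms nn_integral_powr_Icc[OF assms, of b]
      by (simp add: epowr_ennreal ennreal_mult[symmetric])
  next
    case top
    \<comment> \<open>The integral over an initial segment already takes the prescribed value \<open>y\<close>.\<close>
    have "ennreal y \<le> ?I" if "0 \<le> y" for y
    proof -
      define b where "b = (a * y) powr (1 / a)"
      have "ennreal y = ennreal (b powr a / a)"
        using assms that by (simp add: b_def powr_powr)
      also have "\<dots> = (\<integral>\<^sup>+t\<in>{0..b}. ennreal (t powr (a - 1)) \<partial>lborel)"
        using nn_integral_powr_Icc[OF assms, of b] by (simp add: b_def)
      also have "\<dots> \<le> ?I"
        using null[of 0] by (intro nn_integral_mono_AE, eventually_elim) (auto simp: top indicator_def)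
      finally show ?thesis .
    qed
    note bound = this
    have "?I = top"
    proof (rule ccontr)
      assume "?I \<noteq> top"
      then obtain b where "0 \<le> b" "?I = ennreal b" by (cases ?I) auto
      with bound[of "b + 1"] show False by simp
    qed
    moreover have "?J = ?I" by (simp add: top)
    ultimately show ?thesis using assms by (simp add: top ennreal_mult_top)
  qed
  then show "?I = ennreal (1 / a) * epowr c a" "?J = ennreal (1 / a) * epowr c a" by auto
qed

lemma measurable_distribution:
  fixes g :: "real^'n \<Rightarrow> ennreal"
  assumes [measurable]: "g \<in> borel_measurable lborel"
  shows "(\<lambda>\<alpha>. emeasure lborel {x. g x > ennreal \<alpha>}) \<in> borel_measurable borel"
proof (rule borel_measurable_antimono_ennreal, rule antimonoI)
  fix a b :: real assume "a \<le> b"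
  then show "emeasure lborel {x. g x > ennreal b} \<le> emeasure lborel {x. g x > ennreal a}"
    by (intro emeasure_mono) (auto intro: le_less_trans ennreal_leI)
qed

text \<open>Layer cake for \<open>f\<^sup>*(t)\<^sup>r\<close> followed by Tonelli, since rearrangement and distribution function are
  generalised inverses of each other: the set of \<open>(t, \<alpha>)\<close> with \<open>\<alpha> < f\<^sup>*(t)\<close> agrees with the set
  where \<open>t < d(\<alpha>)\<close>, up to boundary points that contribute nothing.\<close>

lemma lorentz_norm_eq_modulus:
  fixes f :: "real^'n \<Rightarrow> 'x"
  assumes [measurable]: "(\<lambda>x. nrm (f x)) \<in> borel_measurable lborel" and "0 < p" "0 < r"
  shows "lorentz_norm nrm p r f = epowr (ennreal p * lorentz_modulus r (r / p) (\<lambda>x. nrm (f x))) (1 / r)"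
proof -
  define D where "D \<alpha> = distribution_fun nrm f \<alpha>" for \<alpha>
  define R where "R t = rearrangement nrm f t" for t
  have D_meas [measurable]: "D \<in> borel_measurable borel"
    using measurable_distribution[of "\<lambda>x. nrm (f x)"] unfolding D_def distribution_fun_def by simp
  have "antimono R"
    unfolding R_def rearrangement_def
    by (intro antimonoI INF_superset_mono) (auto intro: order_trans ennreal_leI)
  then have R_meas [measurable]: "R \<in> borel_measurable borel"
    by (rule borel_measurable_antimono_ennreal)
  have R_imp_D: "ennreal t < D \<alpha>" if "ennreal \<alpha> < R t" "0 < \<alpha>" for t \<alpha>
  proof (rule ccontr)
    assume "\<not> ennreal t < D \<alpha>"
    then have "R t \<le> ennreal \<alpha>"
      unfolding R_def rearrangement_def D_def using that by (intro INF_lower) auto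
    with that show False by simp
  qed
  have D_imp_R: "ennreal \<alpha> \<le> R t" if "ennreal t < D \<alpha>" "0 < \<alpha>" for t \<alpha>
    unfolding R_def rearrangement_def
  proof (intro INF_greatest ennreal_leI, rule ccontr)
    fix \<beta> assume \<beta>: "\<beta> \<in> {\<alpha>. 0 \<le> \<alpha> \<and> distribution_fun nrm f \<alpha> \<le> ennreal t}" "\<not> \<alpha> \<le> \<beta>"
    then have "ennreal \<beta> \<le> ennreal \<alpha>"
      by (intro ennreal_leI) simp
    then have "D \<alpha> \<le> D \<beta>"
      unfolding D_def distribution_fun_def
      by (intro emeasure_mono) (auto intro: le_less_trans)
    with \<beta> that show False by (auto simp: D_def)
  qed
  define \<theta> where "\<theta> = r / p"
  have \<theta>: "0 < \<theta>" using assms by (simp add: \<theta>_def)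
  define w :: "real \<Rightarrow> real \<Rightarrow> ennreal" where "w t \<alpha> = ennreal (t powr (\<theta> - 1)) * ennreal (\<alpha> powr (r - 1))" for t \<alpha>
  have [measurable]: "case_prod w \<in> borel_measurable (borel \<Otimes>\<^sub>M borel)"
    unfolding w_def by measurable
  define I where "I = (\<integral>\<^sup>+t\<in>{0<..}. epowr (ennreal (t powr (1 / p)) * R t) r * ennreal (1 / t) \<partial>lborel)"
  define J where "J = (\<integral>\<^sup>+\<alpha>. (\<integral>\<^sup>+t. (if 0 < t \<and> 0 < \<alpha> \<and> ennreal t < D \<alpha> then w t \<alpha> else 0) \<partial>lborel) \<partial>lborel)"
  have I_eq: "epowr (ennreal (t powr (1 / p)) * R t) r * ennreal (1 / t)
      = ennreal (t powr (\<theta> - 1)) * epowr (R t) r" if "0 < t" for t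
  proof -
    have "(t powr (1 / p)) powr r * (1 / t) = t powr (\<theta> - 1)"
      using that by (simp add: powr_powr \<theta>_def powr_diff)
    moreover have "epowr (ennreal (t powr (1 / p)) * R t) r * ennreal (1 / t)
      = ennreal ((t powr (1 / p)) powr r * (1 / t)) * epowr (R t) r"
      using that assms by (simp add: epowr_mult epowr_ennreal ennreal_mult' divide_inverse mult_ac)
    ultimately show ?thesis by simp
  qed
  \<comment> \<open>The superlevel set of the power integral may be taken open or closed; the two readings give
    the two inequalities between \<open>I\<close> and \<open>J\<close>, because \<open>\<alpha> < R t\<close> implies \<open>t < D \<alpha>\<close>, which in turn
    only implies \<open>\<alpha> \<le> R t\<close>.\<close>
  have I_alt: "I = (\<integral>\<^sup>+t. (\<integral>\<^sup>+\<alpha>. ennreal r * (if 0 < t \<and> 0 < \<alpha> \<and> Q (ennreal \<alpha>) (R t) then w t \<alpha> else 0) \<partial>lborel) \<partial>lborel)"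
    if Q: "Q = (<) \<or> Q = (\<le>)" for Q :: "ennreal \<Rightarrow> ennreal \<Rightarrow> bool"
    unfolding I_def
  proof (intro nn_integral_cong)
    fix t :: real
    let ?A = "{\<alpha>. 0 < \<alpha> \<and> Q (ennreal \<alpha>) (R t)}"
    have A: "?A \<in> sets lborel"
      using Q by (elim disjE) simp_all
    have "(\<integral>\<^sup>+\<alpha>. ennreal r * (if 0 < t \<and> 0 < \<alpha> \<and> Q (ennreal \<alpha>) (R t) then w t \<alpha> else 0) \<partial>lborel)
      = (\<integral>\<^sup>+\<alpha>. (ennreal r * ennreal (t powr (\<theta> - 1)) * indicator {0<..} t) * (ennreal (\<alpha> powr (r - 1)) * indicator ?A \<alpha>) \<partial>lborel)"
      by (intro nn_integral_cong) (auto simp: w_def indicator_def mult_ac)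
    also have "\<dots> = (ennreal r * ennreal (t powr (\<theta> - 1)) * indicator {0<..} t) * (\<integral>\<^sup>+\<alpha>\<in>?A. ennreal (\<alpha> powr (r - 1)) \<partial>lborel)"
      using A by (intro nn_integral_cmult) simp
    also have "(\<integral>\<^sup>+\<alpha>\<in>?A. ennreal (\<alpha> powr (r - 1)) \<partial>lborel) = ennreal (1 / r) * epowr (R t) r"
      using Q nn_integral_powr_less[OF \<open>0 < r\<close>, of "R t"] by (elim disjE) simp_all
    also have "(ennreal r * ennreal (t powr (\<theta> - 1)) * indicator {0<..} t) * (ennreal (1 / r) * epowr (R t) r)
      = (ennreal r * ennreal (1 / r)) * (ennreal (t powr (\<theta> - 1)) * epowr (R t) r * indicator {0<..} t)"
      by (simp add: mult_ac)
    also have "ennreal r * ennreal (1 / r) = 1"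
      using assms by (simp add: ennreal_mult[symmetric])
    finally show "epowr (ennreal (t powr (1 / p)) * R t) r * ennreal (1 / t) * indicator {0<..} t
      = (\<integral>\<^sup>+\<alpha>. ennreal r * (if 0 < t \<and> 0 < \<alpha> \<and> Q (ennreal \<alpha>) (R t) then w t \<alpha> else 0) \<partial>lborel)"
      using I_eq[of t] by (auto simp: indicator_def)
  qed
  have I1: "I = (\<integral>\<^sup>+t. (\<integral>\<^sup>+\<alpha>. ennreal r * (if 0 < t \<and> 0 < \<alpha> \<and> ennreal \<alpha> < R t then w t \<alpha> else 0) \<partial>lborel) \<partial>lborel)"
    by (rule I_alt) simp
  have I2: "I = (\<integral>\<^sup>+t. (\<integral>\<^sup>+\<alpha>. ennreal r * (if 0 < t \<and> 0 < \<alpha> \<and> ennreal \<alpha> \<le> R t then w t \<alpha> else 0) \<partial>lborel) \<partial>lborel)"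
    by (rule I_alt) simp
  have J1: "ennreal r * J = (\<integral>\<^sup>+t. (\<integral>\<^sup>+\<alpha>. ennreal r * (if 0 < t \<and> 0 < \<alpha> \<and> ennreal t < D \<alpha> then w t \<alpha> else 0) \<partial>lborel) \<partial>lborel)"
  proof -
    have "ennreal r * J = (\<integral>\<^sup>+\<alpha>. (\<integral>\<^sup>+t. ennreal r * (if 0 < t \<and> 0 < \<alpha> \<and> ennreal t < D \<alpha> then w t \<alpha> else 0) \<partial>lborel) \<partial>lborel)"
    proof -
      have "ennreal r * J = (\<integral>\<^sup>+\<alpha>. ennreal r * (\<integral>\<^sup>+t. (if 0 < t \<and> 0 < \<alpha> \<and> ennreal t < D \<alpha> then w t \<alpha> else 0) \<partial>lborel) \<partial>lborel)"
        unfolding J_def by (rule nn_integral_cmult[symmetric]) measurable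
      also have "\<dots> = (\<integral>\<^sup>+\<alpha>. (\<integral>\<^sup>+t. ennreal r * (if 0 < t \<and> 0 < \<alpha> \<and> ennreal t < D \<alpha> then w t \<alpha> else 0) \<partial>lborel) \<partial>lborel)"
        by (intro nn_integral_cong nn_integral_cmult[symmetric]) measurable
      finally show ?thesis .
    qed
    also have "\<dots> = (\<integral>\<^sup>+t. (\<integral>\<^sup>+\<alpha>. ennreal r * (if 0 < t \<and> 0 < \<alpha> \<and> ennreal t < D \<alpha> then w t \<alpha> else 0) \<partial>lborel) \<partial>lborel)"
      by (rule lborel_pair.Fubini') measurable
    finally show ?thesis .
  qed
  have "I \<le> ennreal r * J"
    unfolding I1 J1
    by (intro nn_integral_mono mult_left_mono) (auto simp: indicator_def R_imp_D)
  moreover have "ennreal r * J \<le> I"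
    unfolding I2 J1
    by (intro nn_integral_mono mult_left_mono) (auto simp: indicator_def D_imp_R)
  ultimately have "I = ennreal r * J" by (rule antisym)
  also have "J = ennreal (1 / \<theta>) * lorentz_modulus r \<theta> (\<lambda>x. nrm (f x))"
  proof -
    have "J = (\<integral>\<^sup>+\<alpha>. ennreal (1 / \<theta>) * (ennreal (\<alpha> powr (r - 1)) * epowr (D \<alpha>) \<theta> * indicator {0<..} \<alpha>) \<partial>lborel)"
      unfolding J_def
    proof (intro nn_integral_cong)
      fix \<alpha> :: real
      have "(\<integral>\<^sup>+t. (if 0 < t \<and> 0 < \<alpha> \<and> ennreal t < D \<alpha> then w t \<alpha> else 0) \<partial>lborel)
        = (\<integral>\<^sup>+t. (ennreal (\<alpha> powr (r - 1)) * indicator {0<..} \<alpha>) * (ennreal (t powr (\<theta> - 1)) * indicator {t. 0 < t \<and> ennreal t < D \<alpha>} t) \<partial>lborel)"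
        by (intro nn_integral_cong) (auto simp: w_def indicator_def mult_ac)
      also have "\<dots> = (ennreal (\<alpha> powr (r - 1)) * indicator {0<..} \<alpha>) * (ennreal (1 / \<theta>) * epowr (D \<alpha>) \<theta>)"
        by (subst nn_integral_cmult) (use \<theta> in \<open>auto simp: nn_integral_powr_less\<close>)
      finally show "(\<integral>\<^sup>+t. (if 0 < t \<and> 0 < \<alpha> \<and> ennreal t < D \<alpha> then w t \<alpha> else 0) \<partial>lborel)
        = ennreal (1 / \<theta>) * (ennreal (\<alpha> powr (r - 1)) * epowr (D \<alpha>) \<theta> * indicator {0<..} \<alpha>)"
        by (simp add: mult_ac)
    qed
    also have "\<dots> = ennreal (1 / \<theta>) * lorentz_modulus r \<theta> (\<lambda>x. nrm (f x))"
      by (subst nn_integral_cmult) (auto simp: lorentz_modulus_def D_def distribution_fun_def)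
    finally show ?thesis .
  qed
  also have "ennreal r * (ennreal (1 / \<theta>) * lorentz_modulus r \<theta> (\<lambda>x. nrm (f x)))
      = ennreal p * lorentz_modulus r \<theta> (\<lambda>x. nrm (f x))"
    using assms by (simp add: mult.assoc[symmetric] ennreal_mult[symmetric] \<theta>_def)
  finally show ?thesis
    unfolding lorentz_norm_def I_def R_def \<theta>_def by simp
qed

section \<open>Khintchine's inequality for finite averages over signs\<close>

text \<open>A vector of signs indexed by \<open>I\<close> is encoded by the set of positions carrying the sign \<open>+1\<close>, so that
  averages over signs are sums over power sets.\<close>

definition sign_in :: "'i set \<Rightarrow> 'i \<Rightarrow> real" where
  "sign_in A i = (if i \<in> A then 1 else -1)"

text \<open>The moment generating function of a sign sum factorises by independence; here this is the
  expansion of a product of sums over subsets.\<close>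

lemma sum_exp_signs:
  assumes "finite I"
  shows "(\<Sum>A\<in>Pow I. exp (\<Sum>i\<in>I. sign_in A i * x i)) = (\<Prod>i\<in>I. exp (x i) + exp (- x i))"
proof -
  have "exp (\<Sum>i\<in>I. sign_in A i * x i) = (\<Prod>i\<in>A. exp (x i)) * (\<Prod>i\<in>I - A. exp (- x i))"
    if "A \<in> Pow I" for A
  proof -
    have "(\<Prod>i\<in>I. exp (sign_in A i * x i)) = (\<Prod>i\<in>I - A. exp (sign_in A i * x i)) * (\<Prod>i\<in>A. exp (sign_in A i * x i))"
      using assms that by (intro prod.subset_diff) auto
    then show ?thesis
      using assms by (simp add: exp_sum sign_in_def mult.commute)
  qed
  then show ?thesis
    using assms by (simp add: prod_add)
qed

lemma exp_sums_real: "(\<lambda>n. x ^ n / fact n) sums exp x" for x :: real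
proof -
  have "x ^ n /\<^sub>R fact n = x ^ n / fact n" for n
    by (simp add: divide_inverse mult.commute)
  with exp_converges[of x] show ?thesis by simp
qed

text \<open>Comparison of the power series, as \<open>2\<^sup>n n! \<le> (2n)!\<close>.\<close>

lemma cosh_le_exp_half_square: "cosh x \<le> exp (x\<^sup>2 / 2)" for x :: real
proof -
  have fact_double: "2 ^ n * fact n \<le> (fact (2 * n) :: real)" for n
  proof (induction n)
    case (Suc n)
    have "2 ^ Suc n * fact (Suc n) = 2 * real (Suc n) * (2 ^ n * fact n)"
      by simp
    also have "\<dots> \<le> 2 * real (Suc n) * fact (2 * n)"
      using Suc by (intro mult_left_mono) auto
    also have "\<dots> \<le> (2 * real (Suc n) * (2 * real n + 1)) * fact (2 * n)"
      by (intro mult_right_mono) auto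
    also have "\<dots> = fact (2 * Suc n)"
      by (simp add: algebra_simps)
    finally show ?case .
  qed simp
  have "(\<lambda>n. if even n then x ^ n /\<^sub>R fact n else 0) sums cosh x"
    by (rule cosh_converges)
  moreover have "strict_mono (\<lambda>n::nat. 2 * n)"
    by (simp add: strict_mono_def)
  ultimately have "(\<lambda>n. (if even (2 * n) then x ^ (2 * n) /\<^sub>R fact (2 * n) else 0)) sums cosh x"
    by (subst sums_mono_reindex[where g = "\<lambda>n. 2 * n"]) (auto elim!: evenE)
  then have c: "(\<lambda>n. x ^ (2 * n) / fact (2 * n)) sums cosh x"
    by (simp add: divide_inverse mult.commute)
  have e: "(\<lambda>n. (x\<^sup>2 / 2) ^ n / fact n) sums exp (x\<^sup>2 / 2)"
    by (rule exp_sums_real)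
  show ?thesis
  proof (rule sums_le[OF _ c e])
    fix n
    have "x ^ (2 * n) / fact (2 * n) \<le> x ^ (2 * n) / (2 ^ n * fact n)"
      using fact_double[of n] by (intro divide_left_mono) (auto simp: power_mult)
    then show "x ^ (2 * n) / fact (2 * n) \<le> (x\<^sup>2 / 2) ^ n / fact n"
      by (simp add: power_divide power_mult)
  qed
qed

lemma power_div_fact_le_exp: "\<bar>x\<bar> ^ n / fact n \<le> exp x + exp (- x)" for x :: real
proof -
  have "(\<Sum>k\<in>{n}. \<bar>x\<bar> ^ k / fact k) \<le> (\<Sum>k. \<bar>x\<bar> ^ k / fact k)"
    using exp_sums_real[of "\<bar>x\<bar>"] by (intro sum_le_suminf) (auto simp: sums_iff)
  also have "\<dots> = exp \<bar>x\<bar>"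
    using exp_sums_real[of "\<bar>x\<bar>"] by (simp add: sums_iff)
  also have "\<dots> \<le> exp x + exp (- x)"
    by (cases "0 \<le> x") (auto simp: add_increasing add_increasing2)
  finally show ?thesis by simp
qed

definition khintchine_const :: "nat \<Rightarrow> real" where
  "khintchine_const k = 2 * exp (1 / 2) * fact (2 * k)"

lemma khintchine_const_ge_1: "1 \<le> khintchine_const k"
proof -
  have "(1::real) * 1 \<le> (2 * exp (1 / 2)) * fact (2 * k)"
  proof (rule mult_mono)
    have "(1::real) \<le> exp (1 / 2)" by simp
    then show "(1::real) \<le> 2 * exp (1 / 2)" by linarith
  qed auto
  then show ?thesis by (simp add: khintchine_const_def)
qed

text \<open>After normalising \<open>\<Sum> x\<^sub>i\<^sup>2 = 1\<close>, the moment generating function at \<open>\<plusminus>1\<close> is at most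
  \<open>e\<^sup>1\<^sup>/\<^sup>2\<close>, and it dominates every even moment up to a factorial.\<close>

lemma khintchine_real:
  fixes x :: "'i \<Rightarrow> real"
  assumes "finite I"
  shows "(\<Sum>A\<in>Pow I. (\<Sum>i\<in>I. sign_in A i * x i) ^ (2 * k))
    \<le> 2 ^ card I * khintchine_const k * (\<Sum>i\<in>I. (x i)\<^sup>2) ^ k"
proof -
  define V where "V = (\<Sum>i\<in>I. (x i)\<^sup>2)"
  have "0 \<le> V" unfolding V_def by (intro sum_nonneg) auto
  have normalized: "(\<Sum>A\<in>Pow I. (\<Sum>i\<in>I. sign_in A i * y i) ^ (2 * k)) \<le> 2 ^ card I * khintchine_const k"
    if y: "(\<Sum>i\<in>I. (y i)\<^sup>2) \<le> 1" for y :: "'i \<Rightarrow> real"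
  proof -
    have mgf: "(\<Sum>A\<in>Pow I. exp (\<Sum>i\<in>I. sign_in A i * z i)) \<le> 2 ^ card I * exp (1 / 2)"
      if "(\<Sum>i\<in>I. (z i)\<^sup>2) \<le> 1" for z :: "'i \<Rightarrow> real"
    proof -
      have "(\<Sum>A\<in>Pow I. exp (\<Sum>i\<in>I. sign_in A i * z i)) = (\<Prod>i\<in>I. exp (z i) + exp (- z i))"
        using assms by (rule sum_exp_signs)
      also have "\<dots> \<le> (\<Prod>i\<in>I. 2 * exp ((z i)\<^sup>2 / 2))"
      proof (intro prod_mono conjI)
        fix i
        show "exp (z i) + exp (- z i) \<le> 2 * exp ((z i)\<^sup>2 / 2)"
          using cosh_le_exp_half_square[of "z i"] by (simp add: cosh_def)
      qed auto
      also have "\<dots> = 2 ^ card I * exp ((\<Sum>i\<in>I. (z i)\<^sup>2) / 2)"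
        using assms by (simp add: prod.distrib exp_sum sum_divide_distrib)
      also have "\<dots> \<le> 2 ^ card I * exp (1 / 2)"
        using that by simp
      finally show ?thesis .
    qed
    have "(\<Sum>A\<in>Pow I. (\<Sum>i\<in>I. sign_in A i * y i) ^ (2 * k))
       \<le> (\<Sum>A\<in>Pow I. fact (2 * k) * (exp (\<Sum>i\<in>I. sign_in A i * y i) + exp (\<Sum>i\<in>I. sign_in A i * (- y i))))"
    proof (rule sum_mono)
      fix A
      let ?s = "\<Sum>i\<in>I. sign_in A i * y i"
      have "\<bar>?s\<bar> ^ (2 * k) \<le> fact (2 * k) * (exp ?s + exp (- ?s))"
        using power_div_fact_le_exp[of ?s "2 * k"] by (simp add: divide_simps mult.commute)
      then show "?s ^ (2 * k) \<le> fact (2 * k) * (exp ?s + exp (\<Sum>i\<in>I. sign_in A i * (- y i)))"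
        by (simp add: sum_negf power_even_abs)
    qed
    also have "\<dots> = fact (2 * k) * ((\<Sum>A\<in>Pow I. exp (\<Sum>i\<in>I. sign_in A i * y i)) + (\<Sum>A\<in>Pow I. exp (\<Sum>i\<in>I. sign_in A i * (- y i))))"
      by (simp only: sum.distrib sum_distrib_left[symmetric])
    also have "\<dots> \<le> fact (2 * k) * (2 ^ card I * exp (1 / 2) + 2 ^ card I * exp (1 / 2))"
      using y by (intro mult_left_mono add_mono mgf) auto
    also have "\<dots> = 2 ^ card I * khintchine_const k"
      by (simp add: khintchine_const_def)
    finally show ?thesis .
  qed
  show ?thesis
  proof (cases "V = 0")
    case True
    then have zero: "x i = 0" if "i \<in> I" for i
      using assms that unfolding V_def by (subst (asm) sum_nonneg_eq_0_iff) auto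
    then have "(\<Sum>A\<in>Pow I. (\<Sum>i\<in>I. sign_in A i * x i) ^ (2 * k)) = 2 ^ card I * 0 ^ k"
      using assms by (simp add: card_Pow power_0_left)
    also have "\<dots> \<le> 2 ^ card I * khintchine_const k * 0 ^ k"
      using mult_left_mono[OF khintchine_const_ge_1[of k], of "2 ^ card I"]
      by (intro mult_right_mono) simp_all
    finally show ?thesis using True by (simp add: V_def)
  next
    case False
    with \<open>0 \<le> V\<close> have "0 < V" by simp
    define y where "y i = x i / sqrt V" for i
    have "(\<Sum>i\<in>I. (y i)\<^sup>2) = 1"
      using \<open>0 < V\<close> by (simp add: y_def power_divide V_def[symmetric] sum_divide_distrib[symmetric])
    then have "(\<Sum>A\<in>Pow I. (\<Sum>i\<in>I. sign_in A i * y i) ^ (2 * k)) \<le> 2 ^ card I * khintchine_const k"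
      by (intro normalized) simp
    moreover have "(\<Sum>i\<in>I. sign_in A i * y i) ^ (2 * k) = (\<Sum>i\<in>I. sign_in A i * x i) ^ (2 * k) / V ^ k" for A
    proof -
      have "(\<Sum>i\<in>I. sign_in A i * y i) = (\<Sum>i\<in>I. sign_in A i * x i) / sqrt V"
        by (simp add: y_def sum_divide_distrib)
      then show ?thesis
        using \<open>0 < V\<close> by (simp add: power_divide power_mult)
    qed
    ultimately show ?thesis
      using \<open>0 < V\<close> by (simp add: sum_divide_distrib[symmetric] divide_simps V_def[symmetric])
  qed
qed

text \<open>Minkowski's inequality in \<open>L\<^sup>k\<close>, in the form in which it is used three times below: for the two parts
  of a complex number, for iterating a one-parameter inequality, and for the coordinates of a sequence
  space. It follows from convexity of the \<open>k\<close>-th power with weights proportional to \<open>t\<close>.\<close>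

lemma power_moment_sum_le:
  fixes y :: "'v \<Rightarrow> 'w \<Rightarrow> real" and t :: "'v \<Rightarrow> real"
  assumes "finite V" "finite W" "1 \<le> k" "0 \<le> K"
    and y: "\<And>v w. v \<in> V \<Longrightarrow> w \<in> W \<Longrightarrow> 0 \<le> y v w" and t: "\<And>v. v \<in> V \<Longrightarrow> 0 \<le> t v"
    and moment: "\<And>v. v \<in> V \<Longrightarrow> (\<Sum>w\<in>W. y v w ^ k) \<le> K * t v ^ k"
  shows "(\<Sum>w\<in>W. (\<Sum>v\<in>V. y v w) ^ k) \<le> K * (\<Sum>v\<in>V. t v) ^ k"
proof -
  \<comment> \<open>Indices with \<open>t v = 0\<close> are dropped, since the convexity argument divides by \<open>t v\<close>; their terms vanish.\<close>
  define V' where "V' = {v\<in>V. t v \<noteq> 0}"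
  have "finite V'" using \<open>finite V\<close> by (simp add: V'_def)
  have t': "0 < t v" "v \<in> V" if "v \<in> V'" for v
    using that t[of v] by (auto simp: V'_def intro: order.not_eq_order_implies_strict)
  have zero: "y v w = 0" if "v \<in> V" "v \<notin> V'" "w \<in> W" for v w
  proof -
    have "t v = 0" using that by (simp add: V'_def)
    then have "(\<Sum>w\<in>W. y v w ^ k) \<le> 0"
      using moment[OF that(1)] \<open>1 \<le> k\<close> by (simp add: power_0_left)
    moreover have "y v w ^ k \<le> (\<Sum>w\<in>W. y v w ^ k)"
      using y[OF that(1)] that(3) \<open>finite W\<close> by (intro member_le_sum) auto
    ultimately have "y v w ^ k \<le> 0" by linarith
    then show ?thesis
      using y[OF that(1,3)] \<open>1 \<le> k\<close> by (auto simp: power_le_zero_eq)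
  qed
  define T where "T = (\<Sum>v\<in>V'. t v)"
  have sum_t: "(\<Sum>v\<in>V. t v) = T"
    unfolding T_def using \<open>finite V\<close> by (intro sum.mono_neutral_right) (auto simp: V'_def)
  have sum_y: "(\<Sum>v\<in>V. y v w) = (\<Sum>v\<in>V'. y v w)" if "w \<in> W" for w
    using \<open>finite V\<close> zero that by (intro sum.mono_neutral_right) (auto simp: V'_def)
  show ?thesis
  proof (cases "V' = {}")
    case True
    then show ?thesis using sum_y sum_t \<open>1 \<le> k\<close> by (simp add: T_def power_0_left)
  next
    case False
    then have "0 < T" unfolding T_def using \<open>finite V'\<close> t'(1) by (intro sum_pos)
    have jensen: "(\<Sum>v\<in>V'. y v w) ^ k \<le> (\<Sum>v\<in>V'. (t v / T) * (y v w * T / t v) ^ k)" if "w \<in> W" for w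
    proof -
      have "convex_on {0..} (\<lambda>x::real. x ^ k)"
      proof (rule convex_on_realI)
        show "connected {0::real..}" by simp
        show "((\<lambda>x. x ^ k) has_real_derivative (real k * x ^ (k - 1))) (at x)" for x :: real
          by (auto intro!: derivative_eq_intros)
        show "real k * x ^ (k - 1) \<le> real k * y ^ (k - 1)" if "x \<in> {0..}" "y \<in> {0..}" "x \<le> y" for x y
          using that by (intro mult_left_mono power_mono) auto
      qed
      then have "(\<Sum>v\<in>V'. (t v / T) *\<^sub>R (y v w * T / t v)) ^ k \<le> (\<Sum>v\<in>V'. (t v / T) * (y v w * T / t v) ^ k)"
      proof (rule convex_on_sum[OF \<open>finite V'\<close> False])
        show "sum (\<lambda>v. t v / T) V' = 1"
          using \<open>0 < T\<close> by (simp add: sum_divide_distrib[symmetric] T_def[symmetric])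
        show "0 \<le> t v / T" "y v w * T / t v \<in> {0..}" if "v \<in> V'" for v
          using t'[OF that] \<open>0 < T\<close> y[OF t'(2)[OF that] \<open>w \<in> W\<close>] by auto
      qed
      moreover have "(\<Sum>v\<in>V'. (t v / T) *\<^sub>R (y v w * T / t v)) = (\<Sum>v\<in>V'. y v w)"
      proof (intro sum.cong refl)
        fix v assume "v \<in> V'"
        then have "t v \<noteq> 0" "T \<noteq> 0" using t'(1)[of v] \<open>0 < T\<close> by auto
        then show "(t v / T) *\<^sub>R (y v w * T / t v) = y v w" by simp
      qed
      ultimately show ?thesis by simp
    qed
    have "(\<Sum>w\<in>W. (\<Sum>v\<in>V. y v w) ^ k) \<le> (\<Sum>w\<in>W. \<Sum>v\<in>V'. (t v / T) * (y v w * T / t v) ^ k)"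
      using jensen by (intro sum_mono) (simp add: sum_y)
    also have "\<dots> = (\<Sum>v\<in>V'. (t v / T) * ((T / t v) ^ k * (\<Sum>w\<in>W. y v w ^ k)))"
    proof (subst sum.swap, intro sum.cong refl)
      fix v
      show "(\<Sum>w\<in>W. (t v / T) * (y v w * T / t v) ^ k) = (t v / T) * ((T / t v) ^ k * (\<Sum>w\<in>W. y v w ^ k))"
        unfolding sum_distrib_left by (intro sum.cong refl) (simp add: power_mult_distrib power_divide)
    qed
    also have "\<dots> \<le> (\<Sum>v\<in>V'. (t v / T) * ((T / t v) ^ k * (K * t v ^ k)))"
    proof (rule sum_mono)
      fix v assume "v \<in> V'"
      from t'[OF this] \<open>0 < T\<close> show "(t v / T) * ((T / t v) ^ k * (\<Sum>w\<in>W. y v w ^ k))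
          \<le> (t v / T) * ((T / t v) ^ k * (K * t v ^ k))"
        by (intro mult_left_mono moment) simp_all
    qed
    also have "\<dots> = (\<Sum>v\<in>V'. t v * (K * T ^ k / T))"
    proof (intro sum.cong refl)
      fix v assume "v \<in> V'"
      then have "t v \<noteq> 0" "T \<noteq> 0" using t'(1)[of v] \<open>0 < T\<close> by auto
      then show "(t v / T) * ((T / t v) ^ k * (K * t v ^ k)) = t v * (K * T ^ k / T)"
        by (simp add: power_divide)
    qed
    also have "\<dots> = K * T ^ k"
      unfolding sum_distrib_right[symmetric] T_def[symmetric] using \<open>0 < T\<close> by simp
    finally show ?thesis by (simp add: sum_t)
  qed
qed

lemma khintchine_complex:
  fixes z :: "'i \<Rightarrow> complex"
  assumes "finite I" "1 \<le> k"
  shows "(\<Sum>A\<in>Pow I. norm (\<Sum>i\<in>I. of_real (sign_in A i) * z i) ^ (2 * k))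
    \<le> 2 ^ card I * khintchine_const k * (\<Sum>i\<in>I. (norm (z i))\<^sup>2) ^ k"
proof -
  define part where "part b w = (if b then Re w else Im w)" for b w
  have norm_sq: "(norm w)\<^sup>2 = (\<Sum>b\<in>UNIV. (part b w)\<^sup>2)" for w
    by (simp add: UNIV_bool part_def cmod_power2 add.commute)
  have part_sum: "part b (\<Sum>i\<in>I. of_real (sign_in A i) * z i) = (\<Sum>i\<in>I. sign_in A i * part b (z i))" for b A
    by (simp add: part_def)
  have "(\<Sum>A\<in>Pow I. (\<Sum>b\<in>UNIV. (\<Sum>i\<in>I. sign_in A i * part b (z i))\<^sup>2) ^ k)
    \<le> 2 ^ card I * khintchine_const k * (\<Sum>b\<in>UNIV. \<Sum>i\<in>I. (part b (z i))\<^sup>2) ^ k"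
  proof (rule power_moment_sum_le)
    fix b
    show "(\<Sum>A\<in>Pow I. ((\<Sum>i\<in>I. sign_in A i * part b (z i))\<^sup>2) ^ k)
      \<le> 2 ^ card I * khintchine_const k * (\<Sum>i\<in>I. (part b (z i))\<^sup>2) ^ k"
      using khintchine_real[OF assms(1), of "\<lambda>i. part b (z i)" k] by (simp add: power_mult)
  qed (use assms khintchine_const_ge_1[of k] in \<open>auto intro!: sum_nonneg\<close>)
  then show ?thesis
    by (simp add: power_mult norm_sq part_sum sum.swap[of _ UNIV])
qed

lemma sum_Pow_insert:
  assumes "finite I" "i \<notin> I"
  shows "(\<Sum>A\<in>Pow (insert i I). h A) = (\<Sum>A\<in>Pow I. h A + h (insert i A))"
proof -
  have "inj_on (insert i) (Pow I)"
    using assms by (auto simp: inj_on_def)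
  moreover have "Pow I \<inter> insert i ` Pow I = {}"
    using assms by auto
  ultimately show ?thesis
    using assms by (simp add: Pow_insert sum.union_disjoint sum.reindex sum.distrib)
qed

text \<open>Orthogonality of the signs; inductively, this is the parallelogram law.\<close>

lemma sign_sum_second_moment:
  fixes z :: "'i \<Rightarrow> complex"
  assumes "finite I"
  shows "(\<Sum>A\<in>Pow I. (norm (\<Sum>i\<in>I. of_real (sign_in A i) * z i))\<^sup>2)
    = 2 ^ card I * (\<Sum>i\<in>I. (norm (z i))\<^sup>2)"
  using assms
proof (induction I)
  case (insert i I)
  have step: "(norm (\<Sum>j\<in>insert i I. of_real (sign_in A j) * z j))\<^sup>2
      + (norm (\<Sum>j\<in>insert i I. of_real (sign_in (insert i A) j) * z j))\<^sup>2
      = 2 * (norm (z i))\<^sup>2 + 2 * (norm (\<Sum>j\<in>I. of_real (sign_in A j) * z j))\<^sup>2"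
    if "A \<in> Pow I" for A
  proof -
    define S where "S = (\<Sum>j\<in>I. of_real (sign_in A j) * z j)"
    have minus: "(\<Sum>j\<in>insert i I. of_real (sign_in A j) * z j) = S - z i"
      using insert.hyps that by (auto simp: S_def sign_in_def)
    have "(\<Sum>j\<in>I. of_real (sign_in (insert i A) j) * z j) = S"
      unfolding S_def using insert.hyps by (intro sum.cong) (auto simp: sign_in_def)
    then have plus: "(\<Sum>j\<in>insert i I. of_real (sign_in (insert i A) j) * z j) = S + z i"
      using insert.hyps by (simp add: sign_in_def)
    show ?thesis
      unfolding plus minus S_def[symmetric] cmod_power2
      by (simp add: power2_eq_square algebra_simps)
  qed
  have "(\<Sum>A\<in>Pow (insert i I). (norm (\<Sum>j\<in>insert i I. of_real (sign_in A j) * z j))\<^sup>2)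
      = (\<Sum>A\<in>Pow I. 2 * (norm (z i))\<^sup>2 + 2 * (norm (\<Sum>j\<in>I. of_real (sign_in A j) * z j))\<^sup>2)"
    unfolding sum_Pow_insert[OF insert.hyps] using step by (rule sum.cong[OF refl])
  also have "\<dots> = 2 ^ card (insert i I) * (\<Sum>j\<in>insert i I. (norm (z j))\<^sup>2)"
    using insert by (simp add: sum.distrib sum_distrib_left[symmetric] card_Pow algebra_simps)
  finally show ?case .
qed simp

text \<open>A decoupled Rademacher chaos of order two.\<close>

definition chaos :: "'i set \<Rightarrow> 'j set \<Rightarrow> ('i \<Rightarrow> 'j \<Rightarrow> complex) \<Rightarrow> 'i set \<times> 'j set \<Rightarrow> complex" where
  "chaos I J c = (\<lambda>(A, B). \<Sum>i\<in>I. \<Sum>j\<in>J. of_real (sign_in A i * sign_in B j) * c i j)"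

definition square_fun :: "'i set \<Rightarrow> 'j set \<Rightarrow> ('i \<Rightarrow> 'j \<Rightarrow> complex) \<Rightarrow> real" where
  "square_fun I J c = sqrt (\<Sum>i\<in>I. \<Sum>j\<in>J. (norm (c i j))\<^sup>2)"

abbreviation signs :: "'i set \<Rightarrow> 'j set \<Rightarrow> ('i set \<times> 'j set) set" where
  "signs I J \<equiv> Pow I \<times> Pow J"

lemma square_fun_nonneg [simp]: "0 \<le> square_fun I J c"
  by (auto simp: square_fun_def intro!: sum_nonneg)

lemma square_fun_power2: "(square_fun I J c)\<^sup>2 = (\<Sum>i\<in>I. \<Sum>j\<in>J. (norm (c i j))\<^sup>2)"
  unfolding square_fun_def by (intro real_sqrt_pow2 sum_nonneg) auto

lemma square_fun_mono:
  assumes "\<And>i j. i \<in> I \<Longrightarrow> j \<in> J \<Longrightarrow> norm (d i j) \<le> norm (c i j)"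
  shows "square_fun I J d \<le> square_fun I J c"
  unfolding square_fun_def using assms by (auto intro!: sum_mono power_mono)

lemma chaos_iterate:
  "chaos I J c (A, B) = (\<Sum>i\<in>I. of_real (sign_in A i) * (\<Sum>j\<in>J. of_real (sign_in B j) * c i j))"
  by (simp add: chaos_def sum_distrib_left mult.assoc)

lemma card_signs: "finite I \<Longrightarrow> finite J \<Longrightarrow> real (card (signs I J)) = 2 ^ card I * 2 ^ card J"
  by (simp add: card_cartesian_product card_Pow)

text \<open>For fixed second signs this is a one-parameter sign sum. Its coefficients are again sign sums, and
  the second application of Khintchine's inequality is combined over these coefficients by
  \<open>power_moment_sum_le\<close>.\<close>

lemma chaos_even_moment:
  assumes "finite I" "finite J" "1 \<le> k"
  shows "(\<Sum>w\<in>signs I J. norm (chaos I J c w) ^ (2 * k))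
    \<le> card (signs I J) * (khintchine_const k)\<^sup>2 * square_fun I J c ^ (2 * k)"
proof -
  let ?K = "khintchine_const k"
  have K: "0 \<le> ?K" using khintchine_const_ge_1[of k] by simp
  have "(\<Sum>w\<in>signs I J. norm (chaos I J c w) ^ (2 * k))
    = (\<Sum>B\<in>Pow J. \<Sum>A\<in>Pow I. norm (\<Sum>i\<in>I. of_real (sign_in A i) * (\<Sum>j\<in>J. of_real (sign_in B j) * c i j)) ^ (2 * k))"
    by (simp add: sum.cartesian_product' chaos_iterate sum.swap[of _ "Pow J"])
  also have "\<dots> \<le> (\<Sum>B\<in>Pow J. 2 ^ card I * ?K * (\<Sum>i\<in>I. (norm (\<Sum>j\<in>J. of_real (sign_in B j) * c i j))\<^sup>2) ^ k)"
    using assms by (intro sum_mono khintchine_complex)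
  also have "\<dots> = 2 ^ card I * ?K * (\<Sum>B\<in>Pow J. (\<Sum>i\<in>I. (norm (\<Sum>j\<in>J. of_real (sign_in B j) * c i j))\<^sup>2) ^ k)"
    by (simp add: sum_distrib_left)
  also have "\<dots> \<le> 2 ^ card I * ?K * (2 ^ card J * ?K * (\<Sum>i\<in>I. \<Sum>j\<in>J. (norm (c i j))\<^sup>2) ^ k)"
  proof (intro mult_left_mono power_moment_sum_le)
    fix i
    show "(\<Sum>B\<in>Pow J. ((norm (\<Sum>j\<in>J. of_real (sign_in B j) * c i j))\<^sup>2) ^ k)
      \<le> 2 ^ card J * ?K * (\<Sum>j\<in>J. (norm (c i j))\<^sup>2) ^ k"
      using khintchine_complex[OF assms(2,3), of "c i"] by (simp add: power_mult)
  qed (use assms K in \<open>auto intro!: sum_nonneg\<close>)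
  also have "\<dots> = card (signs I J) * ?K\<^sup>2 * square_fun I J c ^ (2 * k)"
    using assms by (simp only: card_signs power_mult square_fun_power2) (simp add: power2_eq_square mult_ac)
  finally show ?thesis .
qed

lemma chaos_second_moment:
  assumes "finite I" "finite J"
  shows "(\<Sum>w\<in>signs I J. (norm (chaos I J c w))\<^sup>2) = card (signs I J) * (square_fun I J c)\<^sup>2"
proof -
  have "(\<Sum>w\<in>signs I J. (norm (chaos I J c w))\<^sup>2)
    = (\<Sum>B\<in>Pow J. \<Sum>A\<in>Pow I. (norm (\<Sum>i\<in>I. of_real (sign_in A i) * (\<Sum>j\<in>J. of_real (sign_in B j) * c i j)))\<^sup>2)"
    by (simp add: sum.cartesian_product' chaos_iterate sum.swap[of _ "Pow J"])
  also have "\<dots> = 2 ^ card I * (\<Sum>i\<in>I. \<Sum>B\<in>Pow J. (norm (\<Sum>j\<in>J. of_real (sign_in B j) * c i j))\<^sup>2)"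
    using assms by (simp add: sign_sum_second_moment sum_distrib_left[symmetric] sum.swap[of _ I])
  also have "\<dots> = card (signs I J) * (square_fun I J c)\<^sup>2"
    using assms by (simp only: card_signs square_fun_power2 sign_sum_second_moment) (simp add: sum_distrib_left mult_ac)
  finally show ?thesis .
qed

text \<open>If few values of \<open>Y\<close> were large, Cauchy-Schwarz on the set of large values would make the second moment
  too big for the given mean.\<close>

lemma paley_zygmund_finite:
  fixes Y :: "'w \<Rightarrow> real" and T c K :: real
  assumes "finite W" and Y: "\<And>w. w \<in> W \<Longrightarrow> 0 \<le> Y w" and "0 < T" "0 < c" "0 < K"
    and first: "real (card W) * (c * T) \<le> (\<Sum>w\<in>W. Y w)"
    and second: "(\<Sum>w\<in>W. (Y w)\<^sup>2) \<le> real (card W) * (K * T\<^sup>2)"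
  shows "c\<^sup>2 / (4 * K) * card W \<le> card {w\<in>W. c / 2 * T \<le> Y w}"
proof (cases "W = {}")
  case False
  define n where "n = real (card W)"
  have n: "0 < n" using False assms by (simp add: n_def card_gt_0_iff)
  define G where "G = {w\<in>W. c / 2 * T \<le> Y w}"
  have "(\<Sum>w\<in>W. Y w) = (\<Sum>w\<in>W - G. Y w) + (\<Sum>w\<in>G. Y w)"
    using assms by (intro sum.subset_diff) (auto simp: G_def)
  moreover have "(\<Sum>w\<in>W - G. Y w) \<le> n * (c / 2 * T)"
  proof -
    have "(\<Sum>w\<in>W - G. Y w) \<le> card (W - G) * (c / 2 * T)"
      by (rule sum_bounded_above) (auto simp: G_def)
    also have "\<dots> \<le> n * (c / 2 * T)"
      using assms by (intro mult_right_mono) (auto simp: n_def intro!: card_mono)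
    finally show ?thesis .
  qed
  ultimately have "n * (c / 2 * T) \<le> (\<Sum>w\<in>G. Y w)"
    using first by (simp add: n_def)
  then have "(n * (c / 2 * T))\<^sup>2 \<le> (\<Sum>w\<in>G. 1 * Y w)\<^sup>2"
    using n assms by (intro power_mono) auto
  also have "\<dots> \<le> (\<Sum>w\<in>G. 1\<^sup>2) * (\<Sum>w\<in>G. (Y w)\<^sup>2)"
    by (rule Cauchy_Schwarz_ineq_sum)
  also have "\<dots> \<le> card G * (n * (K * T\<^sup>2))"
  proof -
    have "(\<Sum>w\<in>G. (Y w)\<^sup>2) \<le> (\<Sum>w\<in>W. (Y w)\<^sup>2)"
      using assms by (intro sum_mono2) (auto simp: G_def)
    with second show ?thesis by (intro mult_mono) (auto simp: n_def intro!: sum_nonneg)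
  qed
  finally have "(n * T\<^sup>2) * (c\<^sup>2 / 4 * n) \<le> (n * T\<^sup>2) * (card G * K)"
    by (simp add: power2_eq_square algebra_simps)
  then have "c\<^sup>2 / 4 * n \<le> card G * K"
    using n assms by (subst (asm) mult_le_cancel_left_pos) auto
  then show ?thesis
    using assms by (simp add: G_def n_def field_simps)
qed simp

section \<open>Sign sums in a weighted sequence space\<close>

lemma chaos_powr_moment_le:
  assumes "finite I" "finite J" "1 \<le> k" "0 < u" "u \<le> 2 * real k"
  shows "(\<Sum>w\<in>signs I J. norm (chaos I J c w) powr u)
    \<le> real (card (signs I J)) * (1 + (khintchine_const k)\<^sup>2) * square_fun I J c powr u"
proof -
  define S where "S = square_fun I J c"
  define n where "n = real (card (signs I J))"
  have n: "0 \<le> n" by (simp add: n_def)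
  have even: "(\<Sum>w\<in>signs I J. norm (chaos I J c w) ^ (2 * k)) \<le> n * (khintchine_const k)\<^sup>2 * S ^ (2 * k)"
    using chaos_even_moment[OF assms(1-3)] by (simp add: S_def n_def)
  have "0 \<le> S" by (simp add: S_def)
  show ?thesis
  proof (cases "S = 0")
    case True
    then have sq: "(\<Sum>w\<in>signs I J. norm (chaos I J c w) ^ (2 * k)) \<le> 0"
      using even assms by (simp add: power_0_left)
    have "chaos I J c w = 0" if "w \<in> signs I J" for w
    proof -
      have "norm (chaos I J c w) ^ (2 * k) \<le> (\<Sum>w\<in>signs I J. norm (chaos I J c w) ^ (2 * k))"
        using that assms by (intro member_le_sum) auto
      with sq have "norm (chaos I J c w) ^ (2 * k) \<le> 0" by linarith
      then show ?thesis using assms by (auto simp: power_le_zero_eq)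
    qed
    then show ?thesis using True assms by (simp add: S_def)
  next
    case False
    with \<open>0 \<le> S\<close> have S: "0 < S" by simp
    \<comment> \<open>Below the threshold \<open>S\<close> the first term dominates, above it the second, as \<open>u \<le> 2 k\<close>.\<close>
    have "norm z powr u \<le> S powr u + S powr u / S ^ (2 * k) * norm z ^ (2 * k)" for z :: complex
    proof (cases "norm z \<le> S")
      case True
      then have "norm z powr u \<le> S powr u" using assms by (intro powr_mono2) auto
      then show ?thesis using S by (intro add_increasing2) auto
    next
      case False
      with S have z: "S < norm z" by simp
      have "(norm z / S) powr u \<le> (norm z / S) powr (2 * real k)"
        using z S assms by (intro powr_mono) auto
      also have "\<dots> = norm z ^ (2 * k) / S ^ (2 * k)"
      proof -
        have "0 < norm z / S" using z S by (intro divide_pos_pos) linarith+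
        then show ?thesis using powr_realpow[of "norm z / S" "2 * k"] by (simp add: power_divide)
      qed
      finally have "S powr u * (norm z / S) powr u \<le> S powr u * (norm z ^ (2 * k) / S ^ (2 * k))"
        by (intro mult_left_mono) auto
      moreover have "S powr u * (norm z / S) powr u = norm z powr u"
        using S by (simp add: powr_divide)
      ultimately have "norm z powr u \<le> S powr u / S ^ (2 * k) * norm z ^ (2 * k)"
        by simp
      then show ?thesis by (intro add_increasing) auto
    qed
    then have "(\<Sum>w\<in>signs I J. norm (chaos I J c w) powr u)
        \<le> (\<Sum>w\<in>signs I J. S powr u + S powr u / S ^ (2 * k) * norm (chaos I J c w) ^ (2 * k))"
      by (intro sum_mono)
    also have "\<dots> = n * S powr u + S powr u / S ^ (2 * k) * (\<Sum>w\<in>signs I J. norm (chaos I J c w) ^ (2 * k))"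
      by (simp only: sum.distrib sum_distrib_left sum_constant n_def)
    also have "\<dots> \<le> n * S powr u + S powr u / S ^ (2 * k) * (n * (khintchine_const k)\<^sup>2 * S ^ (2 * k))"
      using S by (intro add_left_mono mult_left_mono even) auto
    also have "\<dots> = n * (1 + (khintchine_const k)\<^sup>2) * S powr u"
      using S by (simp add: field_simps)
    finally show ?thesis by (simp add: S_def n_def)
  qed
qed

definition chaos_lower_const :: "real \<Rightarrow> real" where
  "chaos_lower_const u = 1 / (4 * (khintchine_const 2)\<^sup>2) * (1 / 2) powr (u / 2)"

lemma chaos_lower_const_pos: "0 < chaos_lower_const u"
  using khintchine_const_ge_1[of 2] by (simp add: chaos_lower_const_def)

text \<open>Paley-Zygmund for the squared modulus: second and fourth moment are comparable, so the modulus is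
  of the order of the square function for a fixed proportion of the signs. This bounds all moments from
  below, including orders less than 2.\<close>

lemma chaos_powr_moment_ge:
  assumes "finite I" "finite J" "0 < u"
  shows "real (card (signs I J)) * chaos_lower_const u * square_fun I J c powr u
    \<le> (\<Sum>w\<in>signs I J. norm (chaos I J c w) powr u)"
proof (cases "square_fun I J c = 0")
  case True
  then show ?thesis by (simp add: sum_nonneg)
next
  case False
  define S where "S = square_fun I J c"
  have S: "0 < S" using False by (simp add: S_def less_le)
  define G where "G = {w\<in>signs I J. 1 / 2 * S\<^sup>2 \<le> (norm (chaos I J c w))\<^sup>2}"
  have "finite G" using assms by (simp add: G_def)
  have "1\<^sup>2 / (4 * (khintchine_const 2)\<^sup>2) * card (signs I J) \<le> card {w\<in>signs I J. 1 / 2 * S\<^sup>2 \<le> (norm (chaos I J c w))\<^sup>2}"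
  proof (rule paley_zygmund_finite)
    show "real (card (signs I J)) * (1 * S\<^sup>2) \<le> (\<Sum>w\<in>signs I J. (norm (chaos I J c w))\<^sup>2)"
      using chaos_second_moment[OF assms(1,2), of c] by (simp add: S_def)
    show "(\<Sum>w\<in>signs I J. ((norm (chaos I J c w))\<^sup>2)\<^sup>2) \<le> real (card (signs I J)) * ((khintchine_const 2)\<^sup>2 * (S\<^sup>2)\<^sup>2)"
      using chaos_even_moment[OF assms(1,2), of 2 c] by (simp add: S_def mult.assoc)
  qed (use assms S khintchine_const_ge_1[of 2] in auto)
  then have card_G: "1 / (4 * (khintchine_const 2)\<^sup>2) * card (signs I J) \<le> card G"
    by (simp add: G_def)
  have "real (card (signs I J)) * chaos_lower_const u * S powr u
      = (1 / (4 * (khintchine_const 2)\<^sup>2) * card (signs I J)) * ((1 / 2 * S\<^sup>2) powr (u / 2))"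
  proof -
    have "(1 / 2 * S\<^sup>2) powr (u / 2) = (1 / 2) powr (u / 2) * (S powr 2) powr (u / 2)"
      using S by (subst powr_mult) auto
    also have "(S powr 2) powr (u / 2) = S powr u"
      unfolding powr_powr by simp
    finally show ?thesis by (simp add: chaos_lower_const_def)
  qed
  also have "\<dots> \<le> real (card G) * ((1 / 2 * S\<^sup>2) powr (u / 2))"
    by (intro mult_right_mono card_G) auto
  also have "\<dots> = (\<Sum>w\<in>G. (1 / 2 * S\<^sup>2) powr (u / 2))"
    by simp
  also have "\<dots> \<le> (\<Sum>w\<in>G. norm (chaos I J c w) powr u)"
  proof (rule sum_mono)
    fix w assume w: "w \<in> G"
    have "(1 / 2 * S\<^sup>2) powr (u / 2) \<le> ((norm (chaos I J c w))\<^sup>2) powr (u / 2)"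
      using w assms by (intro powr_mono2) (auto simp: G_def)
    also have "\<dots> = norm (chaos I J c w) powr u"
    proof -
      have "(norm (chaos I J c w))\<^sup>2 = norm (chaos I J c w) powr 2" by simp
      then show ?thesis by (simp only: powr_powr) simp
    qed
    finally show "(1 / 2 * S\<^sup>2) powr (u / 2) \<le> norm (chaos I J c w) powr u" .
  qed
  also have "\<dots> \<le> (\<Sum>w\<in>signs I J. norm (chaos I J c w) powr u)"
    using assms by (intro sum_mono2) (auto simp: G_def)
  finally show ?thesis by (simp add: S_def)
qed

lemma power_of_powr: "1 \<le> k \<Longrightarrow> (x powr q) ^ k = x powr (q * real k)" for x q :: real
  by (cases "x = 0") (auto simp: powr_power mult.commute power_0_left)

lemma lq_chaos_moment_le:
  assumes "finite I" "finite J" "finite V" "1 \<le> k" "0 < q" "1 \<le> l" "q * real k \<le> 2 * real l"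
    and b: "\<And>v. 0 \<le> b v"
  shows "(\<Sum>w\<in>signs I J. (\<Sum>v\<in>V. (b v * norm (chaos I J (c v) w)) powr q) ^ k)
    \<le> real (card (signs I J)) * (1 + (khintchine_const l)\<^sup>2) * (\<Sum>v\<in>V. (b v * square_fun I J (c v)) powr q) ^ k"
proof (rule power_moment_sum_le)
  fix v
  have pow: "((b v * x) powr q) ^ k = b v powr (q * k) * x powr (q * k)" if "0 \<le> x" for x
  proof -
    have "((b v * x) powr q) ^ k = (b v * x) powr (q * k)"
      using \<open>1 \<le> k\<close> by (rule power_of_powr)
    then show ?thesis using that b[of v] by (simp add: powr_mult)
  qed
  have "(\<Sum>w\<in>signs I J. ((b v * norm (chaos I J (c v) w)) powr q) ^ k)
      = b v powr (q * k) * (\<Sum>w\<in>signs I J. norm (chaos I J (c v) w) powr (q * k))"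
    by (simp add: pow sum_distrib_left)
  also have "\<dots> \<le> b v powr (q * k) * (real (card (signs I J)) * (1 + (khintchine_const l)\<^sup>2) * square_fun I J (c v) powr (q * k))"
    using assms by (intro mult_left_mono chaos_powr_moment_le) auto
  also have "\<dots> = real (card (signs I J)) * (1 + (khintchine_const l)\<^sup>2) * ((b v * square_fun I J (c v)) powr q) ^ k"
    by (simp add: pow)
  finally show "(\<Sum>w\<in>signs I J. ((b v * norm (chaos I J (c v) w)) powr q) ^ k)
    \<le> real (card (signs I J)) * (1 + (khintchine_const l)\<^sup>2) * ((b v * square_fun I J (c v)) powr q) ^ k" .
qed (use assms in auto)

lemma lq_chaos_moment_ge:
  assumes "finite I" "finite J" "0 < q" and b: "\<And>v. 0 \<le> b v"
  shows "real (card (signs I J)) * (chaos_lower_const q * (\<Sum>v\<in>V. (b v * square_fun I J (c v)) powr q))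
    \<le> (\<Sum>w\<in>signs I J. \<Sum>v\<in>V. (b v * norm (chaos I J (c v) w)) powr q)"
proof -
  have "real (card (signs I J)) * (chaos_lower_const q * (\<Sum>v\<in>V. (b v * square_fun I J (c v)) powr q))
     = (\<Sum>v\<in>V. b v powr q * (real (card (signs I J)) * chaos_lower_const q * square_fun I J (c v) powr q))"
    using b by (simp add: sum_distrib_left powr_mult mult_ac)
  also have "\<dots> \<le> (\<Sum>v\<in>V. b v powr q * (\<Sum>w\<in>signs I J. norm (chaos I J (c v) w) powr q))"
    using assms by (intro sum_mono mult_left_mono chaos_powr_moment_ge) auto
  also have "\<dots> = (\<Sum>w\<in>signs I J. \<Sum>v\<in>V. (b v * norm (chaos I J (c v) w)) powr q)"
    using b by (subst sum.swap) (simp add: sum_distrib_left powr_mult)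
  finally show ?thesis .
qed

text \<open>This reduces statements on the extended norm to finite sums of real numbers, also when the norm is infinite.\<close>

lemma lq_norm_gt_iff:
  assumes "0 < q" "0 \<le> \<alpha>"
  shows "ennreal \<alpha> < lq_norm s q a
    \<longleftrightarrow> (\<exists>n. \<alpha> powr q < (\<Sum>k<n. (2 powr (real k * s) * norm (a k)) powr q))"
proof -
  define X where "X = (\<Sum>k. ennreal ((2 powr (real k * s) * norm (a k)) powr q))"
  have "ennreal \<alpha> < epowr X (1 / q) \<longleftrightarrow> ennreal (\<alpha> powr q) < X"
  proof (cases X)
    case (real x)
    have "\<alpha> < x powr (1 / q) \<longleftrightarrow> \<alpha> powr q < x"
    proof
      assume "\<alpha> < x powr (1 / q)"
      then have "\<alpha> powr q < (x powr (1 / q)) powr q" using assms by (intro powr_less_mono2) auto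
      then show "\<alpha> powr q < x" using assms real by (simp add: powr_powr)
    next
      assume "\<alpha> powr q < x"
      then have "(\<alpha> powr q) powr (1 / q) < x powr (1 / q)" using assms by (intro powr_less_mono2) auto
      then show "\<alpha> < x powr (1 / q)" using assms by (simp add: powr_powr)
    qed
    then show ?thesis using real assms by (simp add: epowr_ennreal ennreal_less_iff)
  qed simp
  also have "ennreal (\<alpha> powr q) < X \<longleftrightarrow> (\<exists>n. \<alpha> powr q < (\<Sum>k<n. (2 powr (real k * s) * norm (a k)) powr q))"
  proof -
    have "X = (SUP n. ennreal (\<Sum>k<n. (2 powr (real k * s) * norm (a k)) powr q))"
      unfolding X_def by (subst suminf_eq_SUP) simp
    then show ?thesis by (simp add: less_SUP_iff ennreal_less_iff)
  qed
  finally show ?thesis by (simp add: lq_norm_def X_def)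
qed

text \<open>Paley-Zygmund for the \<open>q\<close>-th power of the norm, truncated to finitely many coordinates.\<close>

lemma lq_norm_chaos_large:
  assumes "0 < q"
  obtains \<delta> \<kappa> where "0 < \<delta>" "0 < \<kappa>"
    "\<And>(I :: 'i set) (J :: 'j set) c \<alpha> s. finite I \<Longrightarrow> finite J \<Longrightarrow> 0 \<le> \<alpha> \<Longrightarrow>
       ennreal \<alpha> < lq_norm s q (\<lambda>v. of_real (square_fun I J (c v))) \<Longrightarrow>
       \<delta> * real (card (signs I J))
         \<le> real (card {w\<in>signs I J. ennreal (\<kappa> * \<alpha>) < lq_norm s q (\<lambda>v. chaos I J (c v) w)})"
proof -
  define l where "l = Suc (nat \<lceil>q\<rceil>)"
  have l: "1 \<le> l" "q * real 2 \<le> 2 * real l"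
    using real_nat_ceiling_ge[of q] by (auto simp: l_def)
  define K where "K = 1 + (khintchine_const l)\<^sup>2"
  have K: "0 < K" unfolding K_def by (simp add: add_pos_nonneg)
  define C where "C = chaos_lower_const q"
  have C: "0 < C" by (simp add: C_def chaos_lower_const_pos)
  show thesis
  proof (rule that[of "C\<^sup>2 / (4 * K)" "(C / 2) powr (1 / q)"])
    fix I :: "'i set" and J :: "'j set" and c and \<alpha> s :: real
    assume fin: "finite I" "finite J" and \<alpha>: "0 \<le> \<alpha>"
      "ennreal \<alpha> < lq_norm s q (\<lambda>v. of_real (square_fun I J (c v)))"
    define b where "b v = 2 powr (real v * s)" for v
    have b: "0 \<le> b v" for v by (simp add: b_def)
    obtain n where n: "\<alpha> powr q < (\<Sum>v<n. (b v * square_fun I J (c v)) powr q)"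
      using \<alpha> \<open>0 < q\<close> by (auto simp: lq_norm_gt_iff b_def)
    define T where "T = (\<Sum>v<n. (b v * square_fun I J (c v)) powr q)"
    define Y where "Y w = (\<Sum>v<n. (b v * norm (chaos I J (c v) w)) powr q)" for w
    have T: "\<alpha> powr q < T" "0 < T" using n by (auto simp: T_def intro: le_less_trans[OF powr_ge_zero])
    have "C\<^sup>2 / (4 * K) * real (card (signs I J)) \<le> card {w\<in>signs I J. C / 2 * T \<le> Y w}"
    proof (rule paley_zygmund_finite)
      show "real (card (signs I J)) * (C * T) \<le> (\<Sum>w\<in>signs I J. Y w)"
        unfolding C_def T_def Y_def using fin \<open>0 < q\<close> b by (intro lq_chaos_moment_ge)
      show "(\<Sum>w\<in>signs I J. (Y w)\<^sup>2) \<le> real (card (signs I J)) * (K * T\<^sup>2)"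
        unfolding K_def T_def Y_def mult.assoc[symmetric] using fin \<open>0 < q\<close> b l
        by (intro lq_chaos_moment_le) auto
    qed (use fin T C K in \<open>auto simp: Y_def intro!: sum_nonneg\<close>)
    also have "card {w\<in>signs I J. C / 2 * T \<le> Y w}
      \<le> card {w\<in>signs I J. ennreal ((C / 2) powr (1 / q) * \<alpha>) < lq_norm s q (\<lambda>v. chaos I J (c v) w)}"
    proof (intro card_mono subsetI)
      fix w assume w: "w \<in> {w\<in>signs I J. C / 2 * T \<le> Y w}"
      have "((C / 2) powr (1 / q) * \<alpha>) powr q = C / 2 * \<alpha> powr q"
        using \<alpha> C \<open>0 < q\<close> by (simp add: powr_mult powr_powr)
      also have "\<dots> < C / 2 * T"
        using T C by (intro mult_strict_left_mono) auto
      also have "\<dots> \<le> Y w" using w by simp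
      finally have "((C / 2) powr (1 / q) * \<alpha>) powr q < Y w" .
      then show "w \<in> {w\<in>signs I J. ennreal ((C / 2) powr (1 / q) * \<alpha>) < lq_norm s q (\<lambda>v. chaos I J (c v) w)}"
        using w \<alpha> \<open>0 < q\<close> unfolding Y_def b_def by (auto simp: lq_norm_gt_iff)
    qed (use fin in auto)
    finally show "C\<^sup>2 / (4 * K) * real (card (signs I J))
      \<le> real (card {w\<in>signs I J. ennreal ((C / 2) powr (1 / q) * \<alpha>) < lq_norm s q (\<lambda>v. chaos I J (c v) w)})"
      by simp
  qed (use C K in auto)
qed

text \<open>Markov's inequality for the \<open>qk\<close>-th moment. The random sum is formed with coefficients \<open>d\<close> dominated by those
  defining the square function; this is where the multipliers \<open>a\<^sub>i\<^sub>j\<close> disappear.\<close>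

lemma lq_norm_chaos_tail:
  assumes "0 < q" "1 \<le> k"
  obtains K where "0 < K"
    "\<And>(I :: 'i set) (J :: 'j set) (c :: nat \<Rightarrow> 'i \<Rightarrow> 'j \<Rightarrow> complex) (d :: nat \<Rightarrow> 'i \<Rightarrow> 'j \<Rightarrow> complex) \<alpha> \<tau> s. finite I \<Longrightarrow> finite J \<Longrightarrow> 0 < \<alpha> \<Longrightarrow> 0 \<le> \<tau> \<Longrightarrow>
       (\<And>v i j. i \<in> I \<Longrightarrow> j \<in> J \<Longrightarrow> norm (d v i j) \<le> norm (c v i j)) \<Longrightarrow>
       lq_norm s q (\<lambda>v. of_real (square_fun I J (c v))) \<le> ennreal \<tau> \<Longrightarrow>
       real (card {w\<in>signs I J. ennreal \<alpha> < lq_norm s q (\<lambda>v. chaos I J (d v) w)})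
         \<le> K * (\<tau> / \<alpha>) powr (q * real k) * real (card (signs I J))"
proof -
  define l where "l = Suc (nat \<lceil>q * real k\<rceil>)"
  have l: "1 \<le> l" "q * real k \<le> 2 * real l"
    using real_nat_ceiling_ge[of "q * real k"] by (auto simp: l_def)
  define K where "K = 1 + (khintchine_const l)\<^sup>2"
  have K: "0 < K" unfolding K_def by (simp add: add_pos_nonneg)
  show thesis
  proof (rule that[of K])
    fix I :: "'i set" and J :: "'j set" and c d :: "nat \<Rightarrow> 'i \<Rightarrow> 'j \<Rightarrow> complex" and \<alpha> \<tau> s :: real
    assume fin: "finite I" "finite J" and \<alpha>: "0 < \<alpha>" and \<tau>: "0 \<le> \<tau>"
      and d: "\<And>v i j. i \<in> I \<Longrightarrow> j \<in> J \<Longrightarrow> norm (d v i j) \<le> norm (c v i j)"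
      and S: "lq_norm s q (\<lambda>v. of_real (square_fun I J (c v))) \<le> ennreal \<tau>"
    define b where "b v = 2 powr (real v * s)" for v
    have b: "0 \<le> b v" for v by (simp add: b_def)
    define Y where "Y n w = (\<Sum>v<n. (b v * norm (chaos I J (d v) w)) powr q)" for n w
    have Y_nonneg: "0 \<le> Y n w" for n w by (auto simp: Y_def intro!: sum_nonneg)
    have Y_mono: "Y m w \<le> Y n w" if "m \<le> n" for m n w
      unfolding Y_def using that by (intro sum_mono2) auto
    define E where "E = {w\<in>signs I J. ennreal \<alpha> < lq_norm s q (\<lambda>v. chaos I J (d v) w)}"
    have "finite E" using fin by (simp add: E_def)
    have "\<forall>w\<in>E. \<exists>n. \<alpha> powr q < Y n w"
      using \<alpha> \<open>0 < q\<close> by (auto simp: E_def lq_norm_gt_iff Y_def b_def)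
    then obtain N where N: "\<And>w. w \<in> E \<Longrightarrow> \<alpha> powr q < Y (N w) w"
      by metis
    \<comment> \<open>One truncation that serves all of the finitely many signs in \<open>E\<close>; any upper bound of \<open>N\<close> on \<open>E\<close> would do.\<close>
    define n where "n = (\<Sum>w\<in>E. N w)"
    have n: "\<alpha> powr q < Y n w" if "w \<in> E" for w
    proof -
      have "N w \<le> n" unfolding n_def using \<open>finite E\<close> that by (intro member_le_sum) auto
      then show ?thesis using N[OF that] Y_mono[of "N w" n w] by linarith
    qed
    define T where "T = (\<Sum>v<n. (b v * square_fun I J (d v)) powr q)"
    have "T \<le> \<tau> powr q"
    proof -
      have "T \<le> (\<Sum>v<n. (b v * square_fun I J (c v)) powr q)"
        unfolding T_def using d b \<open>0 < q\<close>
        by (intro sum_mono powr_mono2 mult_left_mono square_fun_mono mult_nonneg_nonneg) auto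
      also have "\<dots> \<le> \<tau> powr q"
        using S[unfolded not_less[symmetric] lq_norm_gt_iff[OF \<open>0 < q\<close> \<tau>]]
        by (simp add: b_def not_less)
      finally show ?thesis .
    qed
    have "0 \<le> T" by (auto simp: T_def intro!: sum_nonneg)
    have "real (card E) * (\<alpha> powr q) ^ k \<le> (\<Sum>w\<in>E. Y n w ^ k)"
      using n by (intro sum_bounded_below power_mono) (auto simp: less_imp_le)
    also have "\<dots> \<le> (\<Sum>w\<in>signs I J. Y n w ^ k)"
      using fin Y_nonneg by (intro sum_mono2) (auto simp: E_def)
    also have "\<dots> \<le> real (card (signs I J)) * K * T ^ k"
      unfolding K_def T_def Y_def using fin assms b l by (intro lq_chaos_moment_le) auto
    also have "\<dots> \<le> real (card (signs I J)) * K * (\<tau> powr q) ^ k"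
      using \<open>T \<le> \<tau> powr q\<close> \<open>0 \<le> T\<close> K by (intro mult_left_mono power_mono) auto
    finally have "real (card E) * (\<alpha> powr q) ^ k \<le> real (card (signs I J)) * K * (\<tau> powr q) ^ k" .
    moreover have "(x powr q) ^ k = x powr (q * real k)" for x
      using \<open>1 \<le> k\<close> by (rule power_of_powr)
    ultimately have "real (card E) * \<alpha> powr (q * real k) \<le> real (card (signs I J)) * K * \<tau> powr (q * real k)"
      by simp
    then show "real (card {w\<in>signs I J. ennreal \<alpha> < lq_norm s q (\<lambda>v. chaos I J (d v) w)})
         \<le> K * (\<tau> / \<alpha>) powr (q * real k) * real (card (signs I J))"
      using \<alpha> \<tau> by (simp add: E_def[symmetric] powr_divide field_simps)
  qed (rule K)
qed

section \<open>Averages of powers of measures\<close>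

text \<open>If the \<open>m w\<close> are bounded by \<open>M\<close> and their mean is at least \<open>\<delta> M\<close>, then a proportion \<open>\<delta> / 2\<close> of them is at least
  \<open>\<delta> M / 2\<close>. Counting, instead of Jensen's inequality, covers all exponents \<open>\<theta>\<close> at once.\<close>

lemma sum_epowr_ge:
  fixes m :: "'w \<Rightarrow> ennreal"
  assumes "finite W" "0 < \<theta>" "0 < \<delta>" and m: "\<And>w. w \<in> W \<Longrightarrow> m w \<le> M"
    and avg: "ennreal \<delta> * of_nat (card W) * M \<le> (\<Sum>w\<in>W. m w)"
  shows "ennreal (\<delta> / 2 * (\<delta> / 2) powr \<theta>) * of_nat (card W) * epowr M \<theta> \<le> (\<Sum>w\<in>W. epowr (m w) \<theta>)"
proof (cases "W = {} \<or> M = 0")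
  case True
  then show ?thesis by auto
next
  case False
  then have "card W \<noteq> 0" "M \<noteq> 0" using \<open>finite W\<close> by auto
  show ?thesis
  proof (cases M)
    case (real b)
    then have b: "0 < b" using \<open>M \<noteq> 0\<close> by (auto simp: less_le)
    define u where "u w = enn2real (m w)" for w
    have u: "m w = ennreal (u w)" "u w \<le> b" "0 \<le> u w" if "w \<in> W" for w
      using m[OF that] real by (cases "m w"; auto simp: u_def top_unique)+
    define n where "n = real (card W)"
    have avg': "\<delta> * n * b \<le> (\<Sum>w\<in>W. u w)"
      using avg u b \<open>0 < \<delta>\<close> real
      by (simp add: ennreal_of_nat_eq_real_of_nat ennreal_mult[symmetric] n_def sum_nonneg)
    define G where "G = {w\<in>W. \<delta> / 2 * b \<le> u w}"
    have "(\<Sum>w\<in>W. u w) = (\<Sum>w\<in>W - G. u w) + (\<Sum>w\<in>G. u w)"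
      using \<open>finite W\<close> by (intro sum.subset_diff) (auto simp: G_def)
    moreover have "(\<Sum>w\<in>W - G. u w) \<le> n * (\<delta> / 2 * b)"
    proof -
      have "(\<Sum>w\<in>W - G. u w) \<le> card (W - G) * (\<delta> / 2 * b)"
        by (rule sum_bounded_above) (auto simp: G_def)
      also have "\<dots> \<le> n * (\<delta> / 2 * b)"
        using assms b by (intro mult_right_mono) (auto simp: n_def intro!: card_mono)
      finally show ?thesis .
    qed
    moreover have "(\<Sum>w\<in>G. u w) \<le> card G * b"
      using u by (intro sum_bounded_above) (auto simp: G_def)
    ultimately have "(\<delta> / 2 * n) * b \<le> card G * b"
      using avg' by (simp add: algebra_simps)
    then have card_G: "\<delta> / 2 * n \<le> card G" using b by simp
    have "\<delta> / 2 * (\<delta> / 2) powr \<theta> * n * b powr \<theta> = \<delta> / 2 * n * (\<delta> / 2 * b) powr \<theta>"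
      using b \<open>0 < \<delta>\<close> by (subst powr_mult) auto
    also have "\<dots> \<le> card G * (\<delta> / 2 * b) powr \<theta>"
      by (intro mult_right_mono card_G) auto
    also have "\<dots> \<le> (\<Sum>w\<in>G. u w powr \<theta>)"
      using b assms by (intro sum_bounded_below powr_mono2) (auto simp: G_def)
    also have "\<dots> \<le> (\<Sum>w\<in>W. u w powr \<theta>)"
      using \<open>finite W\<close> by (intro sum_mono2) (auto simp: G_def)
    finally have "ennreal (\<delta> / 2 * (\<delta> / 2) powr \<theta> * n * b powr \<theta>) \<le> ennreal (\<Sum>w\<in>W. u w powr \<theta>)"
      by (rule ennreal_leI)
    moreover have "(\<Sum>w\<in>W. epowr (m w) \<theta>) = ennreal (\<Sum>w\<in>W. u w powr \<theta>)"
      using u by (simp add: epowr_ennreal)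
    moreover have "ennreal (\<delta> / 2 * (\<delta> / 2) powr \<theta>) * of_nat (card W) * epowr M \<theta> = ennreal (\<delta> / 2 * (\<delta> / 2) powr \<theta> * n * b powr \<theta>)"
      using b \<open>0 < \<delta>\<close> real by (simp add: epowr_ennreal n_def ennreal_of_nat_eq_real_of_nat ennreal_mult[symmetric])
    ultimately show ?thesis by simp
  next
    case top
    then have "(\<Sum>w\<in>W. m w) = top"
      using avg \<open>card W \<noteq> 0\<close> \<open>0 < \<delta>\<close> by (simp add: ennreal_mult_top top_unique)
    then obtain w where "w \<in> W" "m w = top"
      using \<open>finite W\<close> by (auto simp: ennreal_sum_eq_top)
    then have "(\<Sum>w\<in>W. epowr (m w) \<theta>) = top"
      using \<open>finite W\<close> by (auto simp: ennreal_sum_eq_top epowr_eq_top_iff)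
    then show ?thesis by simp
  qed
qed

text \<open>Dually, if the mean is at most \<open>\<eta>\<^sup>2 M\<close>, then at most a proportion \<open>\<eta>\<close> of the \<open>m w\<close> exceeds \<open>\<eta> M\<close>. The loss of
  half of the exponent of \<open>\<eta>\<close> is harmless, because the tails available later decay as fast as desired.\<close>

lemma sum_epowr_le:
  fixes m :: "'w \<Rightarrow> ennreal"
  assumes "finite W" "0 < \<theta>" "0 < \<eta>" and m: "\<And>w. w \<in> W \<Longrightarrow> m w \<le> M"
    and avg: "(\<Sum>w\<in>W. m w) \<le> ennreal (\<eta>\<^sup>2) * of_nat (card W) * M"
  shows "(\<Sum>w\<in>W. epowr (m w) \<theta>) \<le> ennreal (\<eta> + \<eta> powr \<theta>) * of_nat (card W) * epowr M \<theta>"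
proof (cases "W = {} \<or> M = 0")
  case True
  then show ?thesis using m by auto
next
  case False
  then have "card W \<noteq> 0" "M \<noteq> 0" using \<open>finite W\<close> by auto
  show ?thesis
  proof (cases M)
    case (real b)
    then have b: "0 < b" using \<open>M \<noteq> 0\<close> by (auto simp: less_le)
    define u where "u w = enn2real (m w)" for w
    have u: "m w = ennreal (u w)" "u w \<le> b" "0 \<le> u w" if "w \<in> W" for w
      using m[OF that] real by (cases "m w"; auto simp: u_def top_unique)+
    define n where "n = real (card W)"
    have n: "0 \<le> n" by (simp add: n_def)
    have avg': "(\<Sum>w\<in>W. u w) \<le> \<eta>\<^sup>2 * n * b"
      using avg u b real n
      by (simp add: ennreal_of_nat_eq_real_of_nat ennreal_mult[symmetric] n_def sum_nonneg)
    define G where "G = {w\<in>W. \<eta> * b \<le> u w}"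
    have "card G * (\<eta> * b) \<le> (\<Sum>w\<in>G. u w)"
      by (rule sum_bounded_below) (auto simp: G_def)
    also have "\<dots> \<le> (\<Sum>w\<in>W. u w)"
      using \<open>finite W\<close> u by (intro sum_mono2) (auto simp: G_def)
    finally have "card G * (\<eta> * b) \<le> (\<eta> * n) * (\<eta> * b)"
      using avg' by (simp add: power2_eq_square algebra_simps)
    then have card_G: "card G \<le> \<eta> * n" using b \<open>0 < \<eta>\<close> by (simp add: mult.commute)
    have "(\<Sum>w\<in>W. u w powr \<theta>) = (\<Sum>w\<in>W - G. u w powr \<theta>) + (\<Sum>w\<in>G. u w powr \<theta>)"
      using \<open>finite W\<close> by (intro sum.subset_diff) (auto simp: G_def)
    also have "\<dots> \<le> n * (\<eta> * b) powr \<theta> + \<eta> * n * b powr \<theta>"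
    proof (rule add_mono)
      have "(\<Sum>w\<in>W - G. u w powr \<theta>) \<le> card (W - G) * (\<eta> * b) powr \<theta>"
        using u \<open>0 < \<theta>\<close> by (intro sum_bounded_above powr_mono2) (auto simp: G_def)
      also have "\<dots> \<le> n * (\<eta> * b) powr \<theta>"
        using \<open>finite W\<close> by (intro mult_right_mono) (auto simp: n_def intro!: card_mono)
      finally show "(\<Sum>w\<in>W - G. u w powr \<theta>) \<le> n * (\<eta> * b) powr \<theta>" .
      have "(\<Sum>w\<in>G. u w powr \<theta>) \<le> card G * b powr \<theta>"
        using u \<open>0 < \<theta>\<close> by (intro sum_bounded_above powr_mono2) (auto simp: G_def)
      also have "\<dots> \<le> \<eta> * n * b powr \<theta>"
        by (intro mult_right_mono card_G) auto
      finally show "(\<Sum>w\<in>G. u w powr \<theta>) \<le> \<eta> * n * b powr \<theta>" .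
    qed
    also have "\<dots> = (\<eta> + \<eta> powr \<theta>) * n * b powr \<theta>"
      using b \<open>0 < \<eta>\<close> by (simp add: powr_mult algebra_simps)
    finally have "ennreal (\<Sum>w\<in>W. u w powr \<theta>) \<le> ennreal ((\<eta> + \<eta> powr \<theta>) * n * b powr \<theta>)"
      by (rule ennreal_leI)
    moreover have "(\<Sum>w\<in>W. epowr (m w) \<theta>) = ennreal (\<Sum>w\<in>W. u w powr \<theta>)"
      using u by (simp add: epowr_ennreal)
    moreover have "ennreal (\<eta> + \<eta> powr \<theta>) * of_nat (card W) * epowr M \<theta> = ennreal ((\<eta> + \<eta> powr \<theta>) * n * b powr \<theta>)"
      using b \<open>0 < \<eta>\<close> n real by (simp add: epowr_ennreal n_def ennreal_of_nat_eq_real_of_nat ennreal_mult)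
    ultimately show ?thesis by simp
  next
    case top
    have "0 < \<eta> + \<eta> powr \<theta>" using \<open>0 < \<eta>\<close> by (intro add_pos_nonneg) auto
    then show ?thesis
      using top \<open>card W \<noteq> 0\<close> by (simp add: ennreal_mult_top)
  qed
qed

text \<open>A substitute for the triangle inequality that is valid for every \<open>\<theta> > 0\<close>: each summand is at most
  \<open>(2\<^sup>-\<^sup>j T)\<^sup>1\<^sup>/\<^sup>\<theta>\<close>, where \<open>T\<close> is the sum on the right, and these bounds form a geometric series.\<close>

lemma epowr_suminf_le:
  fixes b :: "nat \<Rightarrow> ennreal"
  assumes "0 < \<theta>"
  shows "epowr (\<Sum>j. b j) \<theta>
    \<le> ennreal ((1 / (1 - 2 powr (- 1 / \<theta>))) powr \<theta>) * (\<Sum>j. ennreal (2 ^ j) * epowr (b j) \<theta>)"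
proof -
  define x where "x = 2 powr (- 1 / \<theta>)"
  have x: "0 < x" "x < 1" using assms powr_less_mono[of "- 1 / \<theta>" 0 2] by (auto simp: x_def)
  define T where "T = (\<Sum>j. ennreal (2 ^ j) * epowr (b j) \<theta>)"
  have "b j \<le> epowr T (1 / \<theta>) * ennreal (x ^ j)" for j
  proof -
    have "ennreal (2 ^ j) * epowr (b j) \<theta> \<le> T"
      unfolding T_def using sum_le_suminf[of "\<lambda>j. ennreal (2 ^ j) * epowr (b j) \<theta>" "{j}"] by simp
    then have "epowr (ennreal (2 ^ j) * epowr (b j) \<theta>) (1 / \<theta>) \<le> epowr T (1 / \<theta>)"
      using assms by (intro epowr_mono) auto
    then have "ennreal ((2 ^ j) powr (1 / \<theta>)) * b j \<le> epowr T (1 / \<theta>)"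
      using assms by (simp add: epowr_mult epowr_epowr epowr_ennreal del: ennreal_power)
    then have "(ennreal ((2 ^ j) powr (1 / \<theta>)) * b j) * ennreal (x ^ j) \<le> epowr T (1 / \<theta>) * ennreal (x ^ j)"
      by (intro mult_right_mono) auto
    moreover have "(2 ^ j) powr (1 / \<theta>) * x ^ j = 1"
    proof -
      have "(2 ^ j) powr (1 / \<theta>) = 2 powr (j / \<theta>)"
        by (simp add: powr_realpow[symmetric] powr_powr)
      moreover have "x ^ j = 2 powr (- (j / \<theta>))"
        by (simp add: x_def powr_power)
      ultimately show ?thesis by (simp add: powr_add[symmetric])
    qed
    then have "ennreal ((2 ^ j) powr (1 / \<theta>)) * ennreal (x ^ j) = 1"
      using x by (simp add: ennreal_mult[symmetric] del: ennreal_power)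
    then have "(ennreal ((2 ^ j) powr (1 / \<theta>)) * b j) * ennreal (x ^ j) = b j"
      by (metis mult.assoc mult.commute mult_1)
    ultimately show ?thesis by simp
  qed
  then have "(\<Sum>j. b j) \<le> (\<Sum>j. epowr T (1 / \<theta>) * ennreal (x ^ j))"
    by (intro suminf_le) auto
  also have "\<dots> = epowr T (1 / \<theta>) * ennreal (1 / (1 - x))"
    using x by (simp add: suminf_ennreal2 summable_geometric suminf_geometric del: ennreal_power)
  finally have "epowr (\<Sum>j. b j) \<theta> \<le> epowr (epowr T (1 / \<theta>) * ennreal (1 / (1 - x))) \<theta>"
    using assms by (intro epowr_mono) auto
  also have "\<dots> = T * ennreal ((1 / (1 - x)) powr \<theta>)"
    using assms x by (simp add: epowr_mult epowr_epowr epowr_ennreal)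
  finally show ?thesis by (simp add: T_def x_def mult.commute)
qed

lemma nn_integral_powr_scale:
  fixes H :: "real \<Rightarrow> ennreal"
  assumes [measurable]: "H \<in> borel_measurable borel" and "0 < \<kappa>"
  shows "(\<integral>\<^sup>+\<alpha>\<in>{0<..}. ennreal (\<alpha> powr (r - 1)) * H (\<kappa> * \<alpha>) \<partial>lborel)
    = ennreal (\<kappa> powr (- r)) * (\<integral>\<^sup>+\<alpha>\<in>{0<..}. ennreal (\<alpha> powr (r - 1)) * H \<alpha> \<partial>lborel)"
proof -
  have "(\<integral>\<^sup>+\<alpha>\<in>{0<..}. ennreal (\<alpha> powr (r - 1)) * H \<alpha> \<partial>lborel)
    = ennreal \<kappa> * (\<integral>\<^sup>+\<alpha>. ennreal ((0 + \<kappa> * \<alpha>) powr (r - 1)) * H (0 + \<kappa> * \<alpha>) * indicator {0<..} (0 + \<kappa> * \<alpha>) \<partial>lborel)"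
    using assms by (subst nn_integral_real_affine[where c = \<kappa> and t = 0]) auto
  also have "\<dots> = ennreal \<kappa> * (\<integral>\<^sup>+\<alpha>. ennreal (\<kappa> powr (r - 1)) * (ennreal (\<alpha> powr (r - 1)) * H (\<kappa> * \<alpha>) * indicator {0<..} \<alpha>) \<partial>lborel)"
  proof (rule arg_cong[where f = "\<lambda>I. ennreal \<kappa> * I"], rule nn_integral_cong)
    fix \<alpha> :: real
    show "ennreal ((0 + \<kappa> * \<alpha>) powr (r - 1)) * H (0 + \<kappa> * \<alpha>) * indicator {0<..} (0 + \<kappa> * \<alpha>)
        = ennreal (\<kappa> powr (r - 1)) * (ennreal (\<alpha> powr (r - 1)) * H (\<kappa> * \<alpha>) * indicator {0<..} \<alpha>)"
    proof (cases "0 < \<alpha>")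
      case True
      with \<open>0 < \<kappa>\<close> have "ennreal ((\<kappa> * \<alpha>) powr (r - 1)) = ennreal (\<kappa> powr (r - 1)) * ennreal (\<alpha> powr (r - 1))"
        by (simp add: powr_mult ennreal_mult)
      with True \<open>0 < \<kappa>\<close> show ?thesis by (simp add: mult.assoc)
    next
      case False
      with \<open>0 < \<kappa>\<close> show ?thesis by (simp add: zero_less_mult_iff)
    qed
  qed
  also have "\<dots> = ennreal (\<kappa> * \<kappa> powr (r - 1)) * (\<integral>\<^sup>+\<alpha>\<in>{0<..}. ennreal (\<alpha> powr (r - 1)) * H (\<kappa> * \<alpha>) \<partial>lborel)"
    using \<open>0 < \<kappa>\<close> by (subst nn_integral_cmult) (auto simp: ennreal_mult mult.assoc)
  also have "\<kappa> * \<kappa> powr (r - 1) = \<kappa> powr r"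
    using \<open>0 < \<kappa>\<close> by (simp add: powr_diff)
  finally have "ennreal (\<kappa> powr (- r)) * (\<integral>\<^sup>+\<alpha>\<in>{0<..}. ennreal (\<alpha> powr (r - 1)) * H \<alpha> \<partial>lborel)
    = (ennreal (\<kappa> powr (- r)) * ennreal (\<kappa> powr r)) * (\<integral>\<^sup>+\<alpha>\<in>{0<..}. ennreal (\<alpha> powr (r - 1)) * H (\<kappa> * \<alpha>) \<partial>lborel)"
    by (simp add: mult.assoc)
  also have "ennreal (\<kappa> powr (- r)) * ennreal (\<kappa> powr r) = 1"
    using \<open>0 < \<kappa>\<close> by (simp add: ennreal_mult[symmetric] powr_add[symmetric])
  finally show ?thesis by simp
qed

lemma sum_emeasure_Int_eq_nn_integral_card:
  fixes m :: "'a measure"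
  assumes "finite W" and [measurable]: "A \<in> sets m" "\<And>w. w \<in> W \<Longrightarrow> E w \<in> sets m"
  shows "(\<Sum>w\<in>W. emeasure m (A \<inter> E w)) = (\<integral>\<^sup>+x\<in>A. of_nat (card {w\<in>W. x \<in> E w}) \<partial>m)"
proof -
  have "(\<Sum>w\<in>W. emeasure m (A \<inter> E w)) = (\<Sum>w\<in>W. \<integral>\<^sup>+x. indicator (A \<inter> E w) x \<partial>m)"
    by (intro sum.cong) auto
  also have "\<dots> = (\<integral>\<^sup>+x. (\<Sum>w\<in>W. indicator (A \<inter> E w) x) \<partial>m)"
    by (intro nn_integral_sum[symmetric]) auto
  also have "\<dots> = (\<integral>\<^sup>+x\<in>A. of_nat (card {w\<in>W. x \<in> E w}) \<partial>m)"
  proof (intro nn_integral_cong)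
    fix x
    have "(\<Sum>w\<in>W. indicator (A \<inter> E w) x :: ennreal) = (\<Sum>w\<in>W. if x \<in> E w then indicator A x else 0)"
      by (intro sum.cong) (auto simp: indicator_def)
    also have "\<dots> = (\<Sum>w\<in>{w\<in>W. x \<in> E w}. indicator A x)"
      using \<open>finite W\<close> by (intro sum.inter_filter[symmetric])
    finally show "(\<Sum>w\<in>W. indicator (A \<inter> E w) x) = of_nat (card {w\<in>W. x \<in> E w}) * (indicator A x :: ennreal)"
      by simp
  qed
  finally show ?thesis .
qed

section \<open>Comparison of averaged Lorentz norms\<close>

lemma measurable_modulus_integrand:
  fixes g :: "real^'n \<Rightarrow> ennreal"
  assumes "g \<in> borel_measurable lborel"
  shows "(\<lambda>\<alpha>. epowr (emeasure lborel {x. ennreal \<alpha> < g x}) \<theta>) \<in> borel_measurable borel"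
  using measurable_distribution[OF assms] by measurable

text \<open>On the set where \<open>S > \<alpha>\<close>, the sets where \<open>g w > \<kappa> \<alpha>\<close> have on average at least the proportion \<open>\<delta>\<close> of the
  measure. Taking powers costs a constant by \<open>sum_epowr_ge\<close>.\<close>

lemma lorentz_modulus_le_of_large:
  fixes g :: "'w \<Rightarrow> real^'n \<Rightarrow> ennreal" and S :: "real^'n \<Rightarrow> ennreal"
  assumes "finite W" "0 < \<theta>" "0 < \<delta>" "0 < \<kappa>"
    and [measurable]: "S \<in> borel_measurable lborel" "\<And>w. w \<in> W \<Longrightarrow> g w \<in> borel_measurable lborel"
    and large: "\<And>x \<alpha>. 0 < \<alpha> \<Longrightarrow> ennreal \<alpha> < S x \<Longrightarrow>
      \<delta> * real (card W) \<le> real (card {w\<in>W. ennreal (\<kappa> * \<alpha>) < g w x})"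
  shows "ennreal (\<delta> / 2 * (\<delta> / 2) powr \<theta>) * of_nat (card W) * lorentz_modulus r \<theta> S
    \<le> ennreal (\<kappa> powr (- r)) * (\<Sum>w\<in>W. lorentz_modulus r \<theta> (g w))"
proof -
  note [measurable] = measurable_modulus_integrand
  define c where "c = ennreal (\<delta> / 2 * (\<delta> / 2) powr \<theta>) * of_nat (card W)"
  have level: "c * epowr (emeasure lborel {x. ennreal \<alpha> < S x}) \<theta>
      \<le> (\<Sum>w\<in>W. epowr (emeasure lborel {x. ennreal (\<kappa> * \<alpha>) < g w x}) \<theta>)" if "0 < \<alpha>" for \<alpha>
  proof -
    define A where "A = {x. ennreal \<alpha> < S x}"
    define E where "E w = {x. ennreal (\<kappa> * \<alpha>) < g w x}" for w
    have A [measurable]: "A \<in> sets lborel" unfolding A_def by measurable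
    have E [measurable]: "E w \<in> sets lborel" if "w \<in> W" for w unfolding E_def using that by measurable
    have "ennreal \<delta> * of_nat (card W) * emeasure lborel A = (\<integral>\<^sup>+x\<in>A. ennreal (\<delta> * real (card W)) \<partial>lborel)"
      unfolding nn_integral_cmult_indicator[OF A]
      using \<open>0 < \<delta>\<close> by (simp add: ennreal_mult ennreal_of_nat_eq_real_of_nat)
    also have "\<dots> \<le> (\<integral>\<^sup>+x\<in>A. of_nat (card {w\<in>W. x \<in> E w}) \<partial>lborel)"
      using large[OF \<open>0 < \<alpha>\<close>]
      by (intro nn_integral_mono) (auto simp: A_def E_def indicator_def ennreal_of_nat_eq_real_of_nat intro!: ennreal_leI)
    also have "\<dots> = (\<Sum>w\<in>W. emeasure lborel (A \<inter> E w))"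
      using \<open>finite W\<close> A E by (rule sum_emeasure_Int_eq_nn_integral_card[symmetric])
    finally have "c * epowr (emeasure lborel A) \<theta> \<le> (\<Sum>w\<in>W. epowr (emeasure lborel (A \<inter> E w)) \<theta>)"
      unfolding c_def using assms(1-3) A by (intro sum_epowr_ge) (auto intro: emeasure_mono)
    also have "\<dots> \<le> (\<Sum>w\<in>W. epowr (emeasure lborel (E w)) \<theta>)"
      using \<open>0 < \<theta>\<close> E by (intro sum_mono epowr_mono emeasure_mono) auto
    finally show ?thesis by (simp add: A_def E_def)
  qed
  have "c * lorentz_modulus r \<theta> S
      = (\<integral>\<^sup>+\<alpha>. c * (ennreal (\<alpha> powr (r - 1)) * epowr (emeasure lborel {x. ennreal \<alpha> < S x}) \<theta> * indicator {0<..} \<alpha>) \<partial>lborel)"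
    unfolding lorentz_modulus_def by (intro nn_integral_cmult[symmetric]) measurable
  also have "\<dots> \<le> (\<integral>\<^sup>+\<alpha>. (\<Sum>w\<in>W. ennreal (\<alpha> powr (r - 1)) * epowr (emeasure lborel {x. ennreal (\<kappa> * \<alpha>) < g w x}) \<theta> * indicator {0<..} \<alpha>) \<partial>lborel)"
  proof (intro nn_integral_mono)
    fix \<alpha> :: real
    show "c * (ennreal (\<alpha> powr (r - 1)) * epowr (emeasure lborel {x. ennreal \<alpha> < S x}) \<theta> * indicator {0<..} \<alpha>)
      \<le> (\<Sum>w\<in>W. ennreal (\<alpha> powr (r - 1)) * epowr (emeasure lborel {x. ennreal (\<kappa> * \<alpha>) < g w x}) \<theta> * indicator {0<..} \<alpha>)"
      using mult_left_mono[OF level[of \<alpha>], of "ennreal (\<alpha> powr (r - 1))"]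
      by (auto simp: indicator_def sum_distrib_left mult.left_commute)
  qed
  also have "\<dots> = (\<Sum>w\<in>W. \<integral>\<^sup>+\<alpha>\<in>{0<..}. ennreal (\<alpha> powr (r - 1)) * epowr (emeasure lborel {x. ennreal (\<kappa> * \<alpha>) < g w x}) \<theta> \<partial>lborel)"
  proof (rule nn_integral_sum)
    fix w assume "w \<in> W"
    have "(\<lambda>\<alpha>. epowr (emeasure lborel {x. ennreal (\<kappa> * \<alpha>) < g w x}) \<theta>) \<in> borel_measurable borel"
      by (rule measurable_compose[OF _ measurable_modulus_integrand]) (use assms \<open>w \<in> W\<close> in auto)
    then show "(\<lambda>\<alpha>. ennreal (\<alpha> powr (r - 1)) * epowr (emeasure lborel {x. ennreal (\<kappa> * \<alpha>) < g w x}) \<theta> * indicator {0<..} \<alpha>) \<in> borel_measurable lborel"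
      by measurable
  qed
  also have "\<dots> = (\<Sum>w\<in>W. ennreal (\<kappa> powr (- r)) * lorentz_modulus r \<theta> (g w))"
    unfolding lorentz_modulus_def
    using assms by (intro sum.cong refl nn_integral_powr_scale measurable_modulus_integrand) auto
  finally show ?thesis by (simp add: c_def sum_distrib_left)
qed

text \<open>Fix a level \<open>\<alpha>\<close> and split space into the layers where \<open>S\<close> is about \<open>2\<^sup>-\<^sup>j \<alpha>\<close>. On the \<open>j\<close>-th layer the
  tail bound leaves on average only a proportion of order \<open>2\<^sup>-\<^sup>j\<^sup>m\<close> for the set where \<open>g w > \<alpha>\<close>, while
  replacing \<open>d\<^sub>S(2\<^sup>-\<^sup>j \<alpha>)\<close> by \<open>d\<^sub>S(\<alpha>)\<close> in the integral costs a factor \<open>2\<^sup>j\<^sup>r\<close> and summing over the layers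
  another \<open>2\<^sup>j\<close>. The conditions on \<open>m\<close> make the resulting series converge.\<close>

lemma lorentz_modulus_le_of_tail:
  fixes r \<theta> m K :: real
  assumes "0 < \<theta>" "0 < r" "2 * r + 2 < m" "2 * r + 2 < m * \<theta>" "1 \<le> K"
  obtains C where "0 < C"
    "\<And>(W :: 'w set) (g :: 'w \<Rightarrow> real^'n \<Rightarrow> ennreal) (S :: real^'n \<Rightarrow> ennreal).
      finite W \<Longrightarrow> S \<in> borel_measurable lborel \<Longrightarrow> (\<And>w. w \<in> W \<Longrightarrow> g w \<in> borel_measurable lborel) \<Longrightarrow>
      (\<And>x \<alpha> \<tau>. 0 < \<alpha> \<Longrightarrow> 0 \<le> \<tau> \<Longrightarrow> S x \<le> ennreal \<tau> \<Longrightarrow>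
        real (card {w\<in>W. ennreal \<alpha> < g w x}) \<le> K * (\<tau> / \<alpha>) powr m * real (card W)) \<Longrightarrow>
      (\<Sum>w\<in>W. lorentz_modulus r \<theta> (g w)) \<le> ennreal C * of_nat (card W) * lorentz_modulus r \<theta> S"
proof -
  note [measurable] = measurable_modulus_integrand
  have "0 < m" using assms(2,3) by linarith
  \<comment> \<open>\<open>\<eta> j\<close> is the square root of the tail bound on the \<open>j\<close>-th layer, whose upper end is \<open>2\<^sup>1\<^sup>-\<^sup>j \<alpha>\<close>; this end
    is responsible for the factor \<open>2\<^sup>m\<^sup>/\<^sup>2\<close>.\<close>
  define H where "H = sqrt K * 2 powr (m / 2)"
  have H: "1 \<le> H"
  proof -
    have "1 * 1 \<le> sqrt K * 2 powr (m / 2)"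
      using assms \<open>0 < m\<close> by (intro mult_mono) (auto simp: ge_one_powr_ge_zero)
    then show ?thesis by (simp add: H_def)
  qed
  define \<eta> where "\<eta> j = H * (2 powr (- m / 2)) ^ j" for j :: nat
  have \<eta>: "0 < \<eta> j" for j using H by (simp add: \<eta>_def)
  have \<eta>_sq: "K * (2 * 2 powr (- real j)) powr m = (\<eta> j)\<^sup>2" for j
  proof -
    have "(\<eta> j)\<^sup>2 = K * ((2 powr (m / 2))\<^sup>2 * ((2 powr (- m / 2))\<^sup>2) ^ j)"
      using assms by (simp add: \<eta>_def H_def power_mult_distrib power_mult[symmetric] mult.commute)
    also have "(2 powr (m / 2))\<^sup>2 = 2 powr m" by (simp add: powr_power)
    also have "(2 powr (- m / 2))\<^sup>2 = 2 powr (- m)" by (simp add: powr_power)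
    also have "(2 powr (- m)) ^ j = (2 powr (- real j)) powr m"
      by (simp add: powr_power powr_powr mult.commute)
    finally show ?thesis by (simp add: powr_mult)
  qed
  define a where "a j = 2 ^ j * (\<eta> j + \<eta> j powr \<theta>) * 2 powr (real j * r)" for j
  have a_nonneg: "0 \<le> a j" for j using \<eta>[of j] by (simp add: a_def)
  have "summable a"
  proof -
    have a_eq: "a j = H * (2 powr (1 + r - m / 2)) ^ j + H powr \<theta> * (2 powr (1 + r - m * \<theta> / 2)) ^ j" for j
    proof -
      have p: "(2 powr t) ^ j = 2 powr (real j * t)" for t :: real by (simp add: powr_power mult.commute)
      have two: "(2::real) ^ j = 2 powr real j" by (simp add: powr_realpow)
      have "\<eta> j powr \<theta> = H powr \<theta> * 2 powr (real j * (- m / 2) * \<theta>)"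
        using H by (simp add: \<eta>_def p powr_mult powr_powr)
      then have "a j = H * (2 powr real j * 2 powr (real j * (- m / 2)) * 2 powr (real j * r))
          + H powr \<theta> * (2 powr real j * 2 powr (real j * (- m / 2) * \<theta>) * 2 powr (real j * r))"
        unfolding a_def two by (simp add: \<eta>_def p algebra_simps)
      then show ?thesis
        unfolding p powr_add[symmetric] by (simp add: algebra_simps)
    qed
    have small: "norm (2 powr t) < 1" if "t < 0" for t :: real
      using powr_less_mono[of t 0 2] that by simp
    have "summable (\<lambda>j. H * (2 powr (1 + r - m / 2)) ^ j + H powr \<theta> * (2 powr (1 + r - m * \<theta> / 2)) ^ j)"
      using assms by (intro summable_add summable_mult summable_geometric small) auto
    then show ?thesis by (simp add: a_eq[abs_def])
  qed
  define C\<^sub>0 where "C\<^sub>0 = (1 / (1 - 2 powr (- 1 / \<theta>))) powr \<theta>"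
  define C where "C = C\<^sub>0 * (\<Sum>j. a j) + 1"
  have "0 \<le> C\<^sub>0" by (simp add: C\<^sub>0_def)
  have "0 \<le> (\<Sum>j. a j)" using \<open>summable a\<close> a_nonneg by (intro suminf_nonneg)
  have "0 < C" using \<open>0 \<le> C\<^sub>0\<close> \<open>0 \<le> (\<Sum>j. a j)\<close> by (simp add: C_def add_nonneg_pos)
  show thesis
  proof (rule that[OF \<open>0 < C\<close>])
    fix W :: "'w set" and g :: "'w \<Rightarrow> real^'n \<Rightarrow> ennreal" and S :: "real^'n \<Rightarrow> ennreal"
    assume "finite W" and S [measurable]: "S \<in> borel_measurable lborel"
      and g [measurable]: "\<And>w. w \<in> W \<Longrightarrow> g w \<in> borel_measurable lborel"
      and tail: "\<And>x \<alpha> \<tau>. 0 < \<alpha> \<Longrightarrow> 0 \<le> \<tau> \<Longrightarrow> S x \<le> ennreal \<tau> \<Longrightarrow>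
        real (card {w\<in>W. ennreal \<alpha> < g w x}) \<le> K * (\<tau> / \<alpha>) powr m * real (card W)"
    define n where "n = (of_nat (card W) :: ennreal)"
    define D where "D \<alpha> = epowr (emeasure lborel {x. ennreal \<alpha> < S x}) \<theta>" for \<alpha>
    have [measurable]: "D \<in> borel_measurable borel" unfolding D_def by measurable
    have level: "(\<Sum>w\<in>W. epowr (emeasure lborel {x. ennreal \<alpha> < g w x}) \<theta>)
        \<le> ennreal C\<^sub>0 * (\<Sum>j. ennreal (2 ^ j) * (ennreal (\<eta> j + \<eta> j powr \<theta>) * n * D (2 powr (- real j) * \<alpha>)))"
      if "0 < \<alpha>" for \<alpha>
    proof -
      define \<beta> where "\<beta> j = 2 powr (- real j) * \<alpha>" for j
      have \<beta>: "0 < \<beta> j" for j using that by (simp add: \<beta>_def)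
      have \<beta>_Suc: "\<beta> j = 2 * \<beta> (Suc j)" for j
      proof -
        have "2 powr (- real (Suc j)) = 2 powr (- real j - 1)"
          by (rule arg_cong[where f = "\<lambda>t. 2 powr t"]) simp
        also have "\<dots> = 2 powr (- real j) / 2"
          by (subst powr_diff) simp
        finally show ?thesis by (simp only: \<beta>_def)
      qed
      \<comment> \<open>The layer with index 0 has no upper end; there the trivial bound by the number of all signs is used.\<close>
      define A where "A j = {x. ennreal (\<beta> j) < S x \<and> (j = 0 \<or> S x \<le> ennreal (2 * \<beta> j))}" for j :: nat
      define E where "E w = {x. ennreal \<alpha> < g w x}" for w
      have A [measurable]: "A j \<in> sets lborel" for j unfolding A_def by measurable
      have E [measurable]: "E w \<in> sets lborel" if "w \<in> W" for w unfolding E_def using that by measurable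
      have cover: "E w \<subseteq> (\<Union>j. A j \<inter> E w)" if "w \<in> W" for w
      proof
        fix x assume x: "x \<in> E w"
        \<comment> \<open>The layers miss the zeros of \<open>S\<close>, but there the tail bound with \<open>\<tau> = 0\<close> excludes large values.\<close>
        have "S x \<noteq> 0"
        proof
          assume "S x = 0"
          then have "real (card {w\<in>W. ennreal \<alpha> < g w x}) \<le> 0"
            using tail[OF \<open>0 < \<alpha>\<close>, of 0 x] \<open>0 < m\<close> by simp
          then show False using x that \<open>finite W\<close> by (auto simp: E_def)
        qed
        have "\<exists>j. ennreal (\<beta> j) < S x"
        proof -
          obtain y where y: "0 < y" "ennreal y \<le> S x"
          proof (cases "S x")
            case (real b)
            with \<open>S x \<noteq> 0\<close> have "b \<noteq> 0" by auto
            with real that[of b] show ?thesis by simp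
          next
            case top
            with that[of 1] show ?thesis by simp
          qed
          have "(\<lambda>j. (1 / 2) ^ j * \<alpha>) \<longlonglongrightarrow> 0 * \<alpha>"
            by (intro tendsto_mult LIMSEQ_realpow_zero tendsto_const) auto
          then have "eventually (\<lambda>j. (1 / 2) ^ j * \<alpha> < y) sequentially"
            using y by (intro order_tendstoD(2)) auto
          then obtain j where "(1 / 2) ^ j * \<alpha> < y" by (auto simp: eventually_sequentially)
          moreover have "(1 / 2) ^ j = (2::real) powr (- real j)"
            unfolding powr_minus by (simp add: powr_realpow power_one_over inverse_eq_divide)
          ultimately have "\<beta> j < y"
            by (simp add: \<beta>_def)
          then have "ennreal (\<beta> j) < ennreal y"
            using \<beta>[of j] by (simp add: ennreal_less_iff)
          then show ?thesis using y(2) by (blast intro: less_le_trans)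
        qed
        then obtain j where j: "ennreal (\<beta> j) < S x" "\<And>i. i < j \<Longrightarrow> \<not> ennreal (\<beta> i) < S x"
          using exists_least_iff[of "\<lambda>j. ennreal (\<beta> j) < S x"] by auto
        have "x \<in> A j"
        proof (cases j)
          case 0
          then show ?thesis using j by (simp add: A_def)
        next
          case (Suc i)
          then have "S x \<le> ennreal (\<beta> i)" using j(2)[of i] by simp
          then show ?thesis using j Suc \<beta>_Suc[of i] by (simp add: A_def)
        qed
        then show "x \<in> (\<Union>j. A j \<inter> E w)" using x by auto
      qed
      have layer: "(\<Sum>w\<in>W. epowr (emeasure lborel (A j \<inter> E w)) \<theta>) \<le> ennreal (\<eta> j + \<eta> j powr \<theta>) * n * D (\<beta> j)" for j
      proof -
        have "(\<Sum>w\<in>W. emeasure lborel (A j \<inter> E w)) = (\<integral>\<^sup>+x\<in>A j. of_nat (card {w\<in>W. x \<in> E w}) \<partial>lborel)"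
          using \<open>finite W\<close> A E by (rule sum_emeasure_Int_eq_nn_integral_card)
        also have "\<dots> \<le> (\<integral>\<^sup>+x\<in>A j. ennreal ((\<eta> j)\<^sup>2) * n \<partial>lborel)"
        proof (intro nn_integral_mono)
          fix x
          have "real (card {w\<in>W. x \<in> E w}) \<le> (\<eta> j)\<^sup>2 * real (card W)" if "x \<in> A j"
          proof (cases "j = 0")
            case True
            have "real (card {w\<in>W. x \<in> E w}) \<le> 1 * real (card W)"
              using \<open>finite W\<close> by (auto intro!: card_mono)
            also have "\<dots> \<le> (\<eta> j)\<^sup>2 * real (card W)"
              using H True by (intro mult_right_mono) (auto simp: \<eta>_def)
            finally show ?thesis .
          next
            case False
            then have "real (card {w\<in>W. x \<in> E w}) \<le> K * (2 * \<beta> j / \<alpha>) powr m * real (card W)"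
              using tail[OF \<open>0 < \<alpha>\<close>, of "2 * \<beta> j" x] that \<beta>[of j] by (simp add: A_def E_def)
            also have "2 * \<beta> j / \<alpha> = 2 * 2 powr (- real j)"
              using \<open>0 < \<alpha>\<close> by (simp add: \<beta>_def)
            finally show ?thesis by (simp add: \<eta>_sq)
          qed
          then show "of_nat (card {w\<in>W. x \<in> E w}) * indicator (A j) x \<le> ennreal ((\<eta> j)\<^sup>2) * n * indicator (A j) x"
            by (auto simp: indicator_def n_def ennreal_of_nat_eq_real_of_nat ennreal_mult[symmetric] intro!: ennreal_leI)
        qed
        also have "\<dots> = ennreal ((\<eta> j)\<^sup>2) * n * emeasure lborel (A j)"
          by (rule nn_integral_cmult_indicator[OF A])
        also have "\<dots> \<le> ennreal ((\<eta> j)\<^sup>2) * n * emeasure lborel {x. ennreal (\<beta> j) < S x}"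
          by (intro mult_left_mono emeasure_mono) (auto simp: A_def)
        finally show ?thesis
          unfolding D_def n_def using \<open>finite W\<close> assms(1) \<eta>
          by (intro sum_epowr_le emeasure_mono) (auto simp: A_def)
      qed
      have "(\<Sum>w\<in>W. epowr (emeasure lborel (E w)) \<theta>)
          \<le> (\<Sum>w\<in>W. ennreal C\<^sub>0 * (\<Sum>j. ennreal (2 ^ j) * epowr (emeasure lborel (A j \<inter> E w)) \<theta>))"
      proof (rule sum_mono)
        fix w assume w: "w \<in> W"
        have "emeasure lborel (E w) \<le> emeasure lborel (\<Union>j. A j \<inter> E w)"
          using cover[OF w] E[OF w] by (intro emeasure_mono) auto
        also have "\<dots> \<le> (\<Sum>j. emeasure lborel (A j \<inter> E w))"
          using E[OF w] by (intro emeasure_subadditive_countably) auto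
        finally have "epowr (emeasure lborel (E w)) \<theta> \<le> epowr (\<Sum>j. emeasure lborel (A j \<inter> E w)) \<theta>"
          using assms(1) by (intro epowr_mono) auto
        also have "\<dots> \<le> ennreal C\<^sub>0 * (\<Sum>j. ennreal (2 ^ j) * epowr (emeasure lborel (A j \<inter> E w)) \<theta>)"
          unfolding C\<^sub>0_def by (rule epowr_suminf_le[OF assms(1)])
        finally show "epowr (emeasure lborel (E w)) \<theta> \<le> ennreal C\<^sub>0 * (\<Sum>j. ennreal (2 ^ j) * epowr (emeasure lborel (A j \<inter> E w)) \<theta>)" .
      qed
      also have "\<dots> = ennreal C\<^sub>0 * (\<Sum>j. ennreal (2 ^ j) * (\<Sum>w\<in>W. epowr (emeasure lborel (A j \<inter> E w)) \<theta>))"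
        unfolding sum_distrib_left[symmetric] by (subst suminf_sum[symmetric]) (auto simp: sum_distrib_left)
      also have "\<dots> \<le> ennreal C\<^sub>0 * (\<Sum>j. ennreal (2 ^ j) * (ennreal (\<eta> j + \<eta> j powr \<theta>) * n * D (\<beta> j)))"
        by (intro mult_left_mono suminf_le layer) auto
      finally show ?thesis by (simp add: E_def \<beta>_def)
    qed
    have "(\<Sum>w\<in>W. lorentz_modulus r \<theta> (g w))
        = (\<integral>\<^sup>+\<alpha>. (\<Sum>w\<in>W. ennreal (\<alpha> powr (r - 1)) * epowr (emeasure lborel {x. ennreal \<alpha> < g w x}) \<theta> * indicator {0<..} \<alpha>) \<partial>lborel)"
      unfolding lorentz_modulus_def by (rule nn_integral_sum[symmetric]) measurable
    also have "\<dots> \<le> (\<integral>\<^sup>+\<alpha>. (\<Sum>j. ennreal C\<^sub>0 * (ennreal (2 ^ j) * (ennreal (\<eta> j + \<eta> j powr \<theta>) * n))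
        * (ennreal (\<alpha> powr (r - 1)) * D (2 powr (- real j) * \<alpha>) * indicator {0<..} \<alpha>)) \<partial>lborel)"
    proof (intro nn_integral_mono)
      fix \<alpha> :: real
      show "(\<Sum>w\<in>W. ennreal (\<alpha> powr (r - 1)) * epowr (emeasure lborel {x. ennreal \<alpha> < g w x}) \<theta> * indicator {0<..} \<alpha>)
        \<le> (\<Sum>j. ennreal C\<^sub>0 * (ennreal (2 ^ j) * (ennreal (\<eta> j + \<eta> j powr \<theta>) * n))
          * (ennreal (\<alpha> powr (r - 1)) * D (2 powr (- real j) * \<alpha>) * indicator {0<..} \<alpha>))"
      proof (cases "0 < \<alpha>")
        case True
        have "(\<Sum>w\<in>W. ennreal (\<alpha> powr (r - 1)) * epowr (emeasure lborel {x. ennreal \<alpha> < g w x}) \<theta> * indicator {0<..} \<alpha>)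
          = ennreal (\<alpha> powr (r - 1)) * (\<Sum>w\<in>W. epowr (emeasure lborel {x. ennreal \<alpha> < g w x}) \<theta>)"
          using True by (simp add: sum_distrib_left)
        also have "\<dots> \<le> ennreal (\<alpha> powr (r - 1)) * (ennreal C\<^sub>0 * (\<Sum>j. ennreal (2 ^ j) * (ennreal (\<eta> j + \<eta> j powr \<theta>) * n * D (2 powr (- real j) * \<alpha>))))"
          by (intro mult_left_mono level True) auto
        also have "\<dots> = (\<Sum>j. ennreal C\<^sub>0 * (ennreal (2 ^ j) * (ennreal (\<eta> j + \<eta> j powr \<theta>) * n))
          * (ennreal (\<alpha> powr (r - 1)) * D (2 powr (- real j) * \<alpha>) * indicator {0<..} \<alpha>))"
          unfolding ennreal_suminf_cmult[symmetric] using True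
          by (intro suminf_cong) (simp add: mult.assoc mult.left_commute)
        finally show ?thesis .
      qed simp
    qed
    also have "\<dots> = (\<Sum>j. \<integral>\<^sup>+\<alpha>. ennreal C\<^sub>0 * (ennreal (2 ^ j) * (ennreal (\<eta> j + \<eta> j powr \<theta>) * n))
        * (ennreal (\<alpha> powr (r - 1)) * D (2 powr (- real j) * \<alpha>) * indicator {0<..} \<alpha>) \<partial>lborel)"
      by (rule nn_integral_suminf) measurable
    also have "\<dots> = (\<Sum>j. ennreal (a j) * (ennreal C\<^sub>0 * n * lorentz_modulus r \<theta> S))"
    proof (rule suminf_cong)
      fix j
      have "(\<integral>\<^sup>+\<alpha>. ennreal C\<^sub>0 * (ennreal (2 ^ j) * (ennreal (\<eta> j + \<eta> j powr \<theta>) * n))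
          * (ennreal (\<alpha> powr (r - 1)) * D (2 powr (- real j) * \<alpha>) * indicator {0<..} \<alpha>) \<partial>lborel)
        = ennreal C\<^sub>0 * (ennreal (2 ^ j) * (ennreal (\<eta> j + \<eta> j powr \<theta>) * n))
          * (\<integral>\<^sup>+\<alpha>\<in>{0<..}. ennreal (\<alpha> powr (r - 1)) * D (2 powr (- real j) * \<alpha>) \<partial>lborel)"
        by (rule nn_integral_cmult) measurable
      also have "\<dots> = ennreal C\<^sub>0 * (ennreal (2 ^ j) * (ennreal (\<eta> j + \<eta> j powr \<theta>) * n))
          * (ennreal ((2 powr (- real j)) powr (- r)) * lorentz_modulus r \<theta> S)"
        by (subst nn_integral_powr_scale) (auto simp: lorentz_modulus_def D_def)
      also have "(2 powr (- real j)) powr (- r) = 2 powr (real j * r)"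
        by (simp add: powr_powr)
      also have "ennreal C\<^sub>0 * (ennreal (2 ^ j) * (ennreal (\<eta> j + \<eta> j powr \<theta>) * n)) * (ennreal (2 powr (real j * r)) * lorentz_modulus r \<theta> S)
        = (ennreal (2 ^ j) * ennreal (\<eta> j + \<eta> j powr \<theta>) * ennreal (2 powr (real j * r))) * (ennreal C\<^sub>0 * n * lorentz_modulus r \<theta> S)"
        by (simp only: mult_ac)
      also have "ennreal (2 ^ j) * ennreal (\<eta> j + \<eta> j powr \<theta>) * ennreal (2 powr (real j * r)) = ennreal (a j)"
        using \<eta>[of j] by (simp add: a_def ennreal_mult[symmetric] del: ennreal_power ennreal_plus)
      finally show "(\<integral>\<^sup>+\<alpha>. ennreal C\<^sub>0 * (ennreal (2 ^ j) * (ennreal (\<eta> j + \<eta> j powr \<theta>) * n))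
          * (ennreal (\<alpha> powr (r - 1)) * D (2 powr (- real j) * \<alpha>) * indicator {0<..} \<alpha>) \<partial>lborel)
        = ennreal (a j) * (ennreal C\<^sub>0 * n * lorentz_modulus r \<theta> S)" .
    qed
    also have "\<dots> = ennreal (\<Sum>j. a j) * (ennreal C\<^sub>0 * n * lorentz_modulus r \<theta> S)"
      using \<open>summable a\<close> a_nonneg by (simp add: suminf_ennreal2)
    also have "\<dots> = ennreal (C\<^sub>0 * (\<Sum>j. a j)) * n * lorentz_modulus r \<theta> S"
      using \<open>0 \<le> C\<^sub>0\<close> \<open>0 \<le> (\<Sum>j. a j)\<close> by (simp add: ennreal_mult mult_ac)
    also have "\<dots> \<le> ennreal C * n * lorentz_modulus r \<theta> S"
      by (intro mult_right_mono ennreal_leI) (auto simp: C_def)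
    finally show "(\<Sum>w\<in>W. lorentz_modulus r \<theta> (g w)) \<le> ennreal C * of_nat (card W) * lorentz_modulus r \<theta> S"
      by (simp add: n_def)
  qed
qed

section \<open>The joint law of Rademacher families\<close>

definition positive_signs :: "nat \<Rightarrow> (nat \<Rightarrow> 'w \<Rightarrow> real) \<Rightarrow> 'w \<Rightarrow> nat set" where
  "positive_signs N \<epsilon> w = {i\<in>{1..N}. \<epsilon> i w = 1}"

lemma positive_signs_Pow: "positive_signs N \<epsilon> w \<in> Pow {1..N}"
  by (auto simp: positive_signs_def)

lemma rademacher_eq_sign_in:
  assumes "rademacher_family P N \<epsilon>" "w \<in> space P" "i \<in> {1..N}"
  shows "\<epsilon> i w = sign_in (positive_signs N \<epsilon> w) i"
  using assms by (auto simp: rademacher_family_def positive_signs_def sign_in_def)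

text \<open>Prescribing all signs amounts to an intersection of independent events of probability 1/2.\<close>

lemma measure_positive_signs:
  assumes "prob_space P" "rademacher_family P N \<epsilon>" "A \<in> Pow {1..N}"
  shows "{w\<in>space P. positive_signs N \<epsilon> w = A} \<in> sets P"
    and "measure P {w\<in>space P. positive_signs N \<epsilon> w = A} = 1 / 2 ^ N"
proof -
  interpret prob_space P by fact
  have indep: "indep_vars (\<lambda>_. borel) \<epsilon> {1..N}"
    and range: "\<And>i w. i \<in> {1..N} \<Longrightarrow> w \<in> space P \<Longrightarrow> \<epsilon> i w \<in> {-1, 1}"
    and symmetric: "\<And>i. i \<in> {1..N} \<Longrightarrow> prob {w\<in>space P. \<epsilon> i w = 1} = prob {w\<in>space P. \<epsilon> i w = -1}"
    using assms(2) by (auto simp: rademacher_family_def)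
  have meas [measurable]: "\<epsilon> i \<in> borel_measurable P" if "i \<in> {1..N}" for i
    using indep that by (auto simp: indep_vars_def)
  have half: "prob (\<epsilon> i -` {sign_in A i} \<inter> space P) = 1 / 2" if i: "i \<in> {1..N}" for i
  proof -
    have ev: "{w\<in>space P. \<epsilon> i w = c} \<in> events" for c
      using meas[OF i] by measurable
    have "1 = prob ({w\<in>space P. \<epsilon> i w = 1} \<union> {w\<in>space P. \<epsilon> i w = -1})"
      using range[OF i] prob_space by (subst prob_space[symmetric], intro arg_cong[where f = prob]) auto
    also have "\<dots> = prob {w\<in>space P. \<epsilon> i w = 1} + prob {w\<in>space P. \<epsilon> i w = -1}"
      using ev by (intro finite_measure_Union) auto
    finally have "prob {w\<in>space P. \<epsilon> i w = c} = 1 / 2" if "c \<in> {1, -1}" for c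
      using symmetric[OF i] that by auto
    moreover have "\<epsilon> i -` {sign_in A i} \<inter> space P = {w\<in>space P. \<epsilon> i w = sign_in A i}"
      by auto
    ultimately show ?thesis by (simp add: sign_in_def)
  qed
  have eq: "{w\<in>space P. positive_signs N \<epsilon> w = A} = (\<Inter>i\<in>{1..N}. \<epsilon> i -` {sign_in A i} \<inter> space P)" if "N \<noteq> 0"
  proof -
    have "positive_signs N \<epsilon> w = A \<longleftrightarrow> (\<forall>i\<in>{1..N}. \<epsilon> i w = sign_in A i)" if "w \<in> space P" for w
    proof -
      have "positive_signs N \<epsilon> w = A \<longleftrightarrow> (\<forall>i\<in>{1..N}. \<epsilon> i w = 1 \<longleftrightarrow> i \<in> A)"
        unfolding positive_signs_def using assms(3) by blast
      moreover have "(\<epsilon> i w = 1 \<longleftrightarrow> i \<in> A) \<longleftrightarrow> \<epsilon> i w = sign_in A i" if "i \<in> {1..N}" for i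
        using range[OF that \<open>w \<in> space P\<close>] by (auto simp: sign_in_def)
      ultimately show ?thesis by simp
    qed
    then show ?thesis using \<open>N \<noteq> 0\<close> by auto
  qed
  show "{w\<in>space P. positive_signs N \<epsilon> w = A} \<in> sets P"
  proof (cases "N = 0")
    case True
    then have "{w\<in>space P. positive_signs N \<epsilon> w = A} = space P"
      using assms(3) by (auto simp: positive_signs_def)
    then show ?thesis by simp
  next
    case False
    then show ?thesis unfolding eq[OF False] by (intro sets.finite_INT measurable_sets[OF meas]) auto
  qed
  show "measure P {w\<in>space P. positive_signs N \<epsilon> w = A} = 1 / 2 ^ N"
  proof (cases "N = 0")
    case True
    then have "{w\<in>space P. positive_signs N \<epsilon> w = A} = space P"
      using assms(3) by (auto simp: positive_signs_def)
    then show ?thesis using True prob_space by simp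
  next
    case False
    then have "prob (\<Inter>i\<in>{1..N}. \<epsilon> i -` {sign_in A i} \<inter> space P) = (\<Prod>i\<in>{1..N}. prob (\<epsilon> i -` {sign_in A i} \<inter> space P))"
      by (intro indep_varsD_finite[OF indep]) auto
    also have "\<dots> = (\<Prod>i\<in>{1..N}. 1 / 2)" using half by (intro prod.cong refl)
    also have "\<dots> = 1 / 2 ^ N" by (simp add: power_divide)
    finally show ?thesis using eq[OF False] by simp
  qed
qed

lemma integral_rademacher_pair:
  fixes H :: "nat set \<times> nat set \<Rightarrow> real"
  assumes "prob_space P" "prob_space P'" "rademacher_family P N \<epsilon>" "rademacher_family P' N \<epsilon>'"
  shows "(LINT w|(P \<Otimes>\<^sub>M P'). H (positive_signs N \<epsilon> (fst w), positive_signs N \<epsilon>' (snd w)))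
    = (\<Sum>v\<in>signs {1..N} {1..N}. H v) / 4 ^ N"
proof -
  interpret Q: prob_space P by fact
  interpret Q': prob_space P' by fact
  interpret pair_prob_space P P' ..
  define E where "E A = {w\<in>space P. positive_signs N \<epsilon> w = A}" for A
  define E' where "E' B = {w\<in>space P'. positive_signs N \<epsilon>' w = B}" for B
  note E = measure_positive_signs[OF assms(1,3), folded E_def]
  note E' = measure_positive_signs[OF assms(2,4), folded E'_def]
  let ?\<Omega> = "signs {1..N} {1..N}"
  have box: "E (fst v) \<times> E' (snd v) \<in> sets (P \<Otimes>\<^sub>M P')"
    and measure_box: "measure (P \<Otimes>\<^sub>M P') (E (fst v) \<times> E' (snd v)) = 1 / 4 ^ N" if "v \<in> ?\<Omega>" for v
  proof -
    have v: "fst v \<in> Pow {1..N}" "snd v \<in> Pow {1..N}" using that by auto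
    then show "E (fst v) \<times> E' (snd v) \<in> sets (P \<Otimes>\<^sub>M P')"
      using E(1) E'(1) by (intro pair_measureI)
    have "measure (P \<Otimes>\<^sub>M P') (E (fst v) \<times> E' (snd v)) = measure P (E (fst v)) * measure P' (E' (snd v))"
      using E(1)[OF v(1)] E'(1)[OF v(2)]
      by (simp add: measure_def Q'.emeasure_pair_measure_Times enn2real_mult)
    also have "\<dots> = 1 / 4 ^ N"
      unfolding E(2)[OF v(1)] E'(2)[OF v(2)] by (simp add: power_mult_distrib[symmetric])
    finally show "measure (P \<Otimes>\<^sub>M P') (E (fst v) \<times> E' (snd v)) = 1 / 4 ^ N" .
  qed
  have "(LINT w|(P \<Otimes>\<^sub>M P'). H (positive_signs N \<epsilon> (fst w), positive_signs N \<epsilon>' (snd w)))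
    = (LINT w|(P \<Otimes>\<^sub>M P'). (\<Sum>v\<in>?\<Omega>. H v * indicator (E (fst v) \<times> E' (snd v)) w))"
  proof (rule Bochner_Integration.integral_cong[OF refl])
    fix w assume "w \<in> space (P \<Otimes>\<^sub>M P')"
    then have w: "fst w \<in> space P" "snd w \<in> space P'" by (auto simp: space_pair_measure)
    define u where "u = (positive_signs N \<epsilon> (fst w), positive_signs N \<epsilon>' (snd w))"
    have "u \<in> ?\<Omega>" unfolding u_def by (intro SigmaI) (rule positive_signs_Pow)+
    have "(\<Sum>v\<in>?\<Omega>. H v * indicator (E (fst v) \<times> E' (snd v)) w) = (\<Sum>v\<in>?\<Omega>. if v = u then H v else 0)"
      using w by (intro sum.cong refl) (auto simp: indicator_def E_def E'_def u_def mem_Times_iff)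
    also have "\<dots> = H u" using \<open>u \<in> ?\<Omega>\<close> by simp
    finally show "H (positive_signs N \<epsilon> (fst w), positive_signs N \<epsilon>' (snd w))
      = (\<Sum>v\<in>?\<Omega>. H v * indicator (E (fst v) \<times> E' (snd v)) w)" by (simp add: u_def)
  qed
  also have "\<dots> = (\<Sum>v\<in>?\<Omega>. LINT w|(P \<Otimes>\<^sub>M P'). H v * indicator (E (fst v) \<times> E' (snd v)) w)"
    using box by (intro Bochner_Integration.integral_sum integrable_mult_right integrable_real_indicator)
      (auto simp: emeasure_eq_measure)
  also have "\<dots> = (\<Sum>v\<in>?\<Omega>. H v * (1 / 4 ^ N))"
    using measure_box sets.Int_space_eq2[OF box] by (intro sum.cong refl) simp
  finally show ?thesis by (simp add: sum_divide_distrib)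
qed

text \<open>Infinitely many fair coins, so that one space carries families of every length.\<close>

lemma ex_rademacher_families:
  obtains P :: "(nat \<Rightarrow> bool) measure"
  where "prob_space P" "\<And>N. \<exists>\<epsilon>. rademacher_family P N \<epsilon>"
proof -
  define M where "M = measure_pmf (bernoulli_pmf (1 / 2))"
  define P where "P = (\<Pi>\<^sub>M i\<in>(UNIV :: nat set). M)"
  interpret M: prob_space M unfolding M_def by (rule measure_pmf.prob_space_axioms)
  interpret product_prob_space "\<lambda>_ :: nat. M" UNIV by standard
  have "prob_space P" unfolding P_def by (rule prob_space_axioms)
  then interpret Coins: prob_space P .
  define \<epsilon> where "\<epsilon> i w = (if w i then 1 else -1 :: real)" for i :: nat and w :: "nat \<Rightarrow> bool"
  have coord: "(\<lambda>w. w i) \<in> measurable P (count_space UNIV)" for i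
  proof -
    have "(\<lambda>w. w i) \<in> measurable P M" unfolding P_def by (rule measurable_component_singleton) simp
    then show ?thesis by (simp add: M_def)
  qed
  have "rademacher_family P N \<epsilon>" for N
    unfolding rademacher_family_def
  proof (intro conjI ballI)
    show "Coins.indep_vars (\<lambda>_. borel) \<epsilon> {1..N}"
    proof -
      have "distr P (\<Pi>\<^sub>M i\<in>UNIV. M) (\<lambda>x. \<lambda>i\<in>UNIV. x i) = distr P P (\<lambda>x. x)"
        unfolding P_def by (simp add: restrict_UNIV)
      also have "\<dots> = P" by (rule distr_id)
      also have "P = (\<Pi>\<^sub>M i\<in>UNIV. distr P M (\<lambda>x. x i))"
        using PiM_component by (simp add: P_def)
      finally have "Coins.indep_vars (\<lambda>_. M) (\<lambda>i w. w i) UNIV"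
        by (subst Coins.indep_vars_iff_distr_eq_PiM') (auto simp: P_def)
      then have "Coins.indep_vars (\<lambda>_. borel) (\<lambda>i w. if w i then 1 else -1 :: real) UNIV"
        by (rule Coins.indep_vars_compose2) (auto simp: M_def)
      then show ?thesis
        unfolding \<epsilon>_def[abs_def] by (rule Coins.indep_vars_subset) auto
    qed
    show "\<epsilon> i w \<in> {-1, 1}" for i w by (simp add: \<epsilon>_def)
    fix i
    have coin: "measure P {w\<in>space P. w i = b} = 1 / 2" for b
    proof -
      have "measure P {w\<in>space P. w i = b} = measure (distr P M (\<lambda>w. w i)) {b}"
        using coord[of i] by (subst measure_distr) (auto simp: M_def vimage_def Int_def conj_commute)
      also have "distr P M (\<lambda>w. w i) = M" unfolding P_def by (rule PiM_component) simp
      also have "measure M {b} = 1 / 2" unfolding M_def by (cases b) (simp_all add: measure_pmf_single)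
      finally show ?thesis .
    qed
    have "{w\<in>space P. \<epsilon> i w = 1} = {w\<in>space P. w i = True}"
      "{w\<in>space P. \<epsilon> i w = -1} = {w\<in>space P. w i = False}"
      by (auto simp: \<epsilon>_def split: if_splits)
    then show "measure P {w\<in>space P. \<epsilon> i w = 1} = measure P {w\<in>space P. \<epsilon> i w = -1}"
      by (simp only: coin)
  qed
  with \<open>prob_space P\<close> show thesis using that by blast
qed

section \<open>Random sums in the Lorentz space\<close>

lemma measurable_lq_norm:
  assumes [measurable]: "\<And>k. (\<lambda>x. f x k) \<in> borel_measurable M"
  shows "(\<lambda>x. lq_norm s q (f x)) \<in> borel_measurable M"
  unfolding lq_norm_def by measurable

lemma measurable_chaos:
  assumes "\<And>i j. i \<in> I \<Longrightarrow> j \<in> J \<Longrightarrow> (\<lambda>x. c x i j) \<in> borel_measurable M"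
  shows "(\<lambda>x. chaos I J (c x) w) \<in> borel_measurable M"
  using assms unfolding chaos_def split_beta
  by (intro borel_measurable_sum borel_measurable_times) auto

lemma measurable_square_fun:
  assumes "\<And>i j. i \<in> I \<Longrightarrow> j \<in> J \<Longrightarrow> (\<lambda>x. c x i j) \<in> borel_measurable M"
  shows "(\<lambda>x. square_fun I J (c x)) \<in> borel_measurable M"
proof -
  have "(\<lambda>x. \<Sum>i\<in>I. \<Sum>j\<in>J. (norm (c x i j))\<^sup>2) \<in> borel_measurable M"
    using assms by (intro borel_measurable_sum borel_measurable_power borel_measurable_norm) auto
  then show ?thesis unfolding square_fun_def by measurable
qed

text \<open>Both random sums are compared with the square function of the coefficients without multipliers.\<close>

lemma lorentz_modulus_chaos_le:
  fixes q r \<theta> s :: real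
  assumes "0 < q" "0 < r" "0 < \<theta>"
  obtains K where "1 \<le> K"
    "\<And>(I :: 'i set) (J :: 'j set) (f :: 'i \<Rightarrow> 'j \<Rightarrow> real^'n \<Rightarrow> nat \<Rightarrow> complex) a.
      finite I \<Longrightarrow> finite J \<Longrightarrow>
      (\<And>i j v. i \<in> I \<Longrightarrow> j \<in> J \<Longrightarrow> (\<lambda>x. f i j x v) \<in> borel_measurable lborel) \<Longrightarrow>
      (\<And>i j. i \<in> I \<Longrightarrow> j \<in> J \<Longrightarrow> norm (a i j) \<le> 1) \<Longrightarrow>
      (\<Sum>w\<in>signs I J. lorentz_modulus r \<theta> (\<lambda>x. lq_norm s q (\<lambda>v. chaos I J (\<lambda>i j. a i j * f i j x v) w)))
        \<le> ennreal K * (\<Sum>w\<in>signs I J. lorentz_modulus r \<theta> (\<lambda>x. lq_norm s q (\<lambda>v. chaos I J (\<lambda>i j. f i j x v) w)))"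
proof -
  obtain \<delta> \<kappa> where \<delta>: "0 < \<delta>" and \<kappa>: "0 < \<kappa>" and large:
    "\<And>(I :: 'i set) (J :: 'j set) c \<alpha> s. finite I \<Longrightarrow> finite J \<Longrightarrow> 0 \<le> \<alpha> \<Longrightarrow>
       ennreal \<alpha> < lq_norm s q (\<lambda>v. of_real (square_fun I J (c v))) \<Longrightarrow>
       \<delta> * real (card (signs I J))
         \<le> real (card {w\<in>signs I J. ennreal (\<kappa> * \<alpha>) < lq_norm s q (\<lambda>v. chaos I J (c v) w)})"
    using lq_norm_chaos_large[OF \<open>0 < q\<close>] by blast
  \<comment> \<open>The tail exponent \<open>q k\<close> has to exceed two thresholds, one for \<open>\<theta> \<ge> 1\<close> and one for \<open>\<theta> \<le> 1\<close>.\<close>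
  obtain k :: nat where k: "(2 * r + 2) / q + (2 * r + 2) / (q * \<theta>) < real k"
    using reals_Archimedean2 by blast
  have k_pos: "0 < (2 * r + 2) / q" "0 < (2 * r + 2) / (q * \<theta>)"
    using assms by auto
  have k1: "1 \<le> k" using k k_pos by (cases k) auto
  have "(2 * r + 2) / q < real k" "(2 * r + 2) / (q * \<theta>) < real k"
    using k k_pos by linarith+
  then have m: "2 * r + 2 < q * real k" "2 * r + 2 < q * real k * \<theta>"
    using assms by (simp_all add: pos_divide_less_eq mult_ac)
  obtain K\<^sub>0 where "0 < K\<^sub>0" and tail:
    "\<And>(I :: 'i set) (J :: 'j set) (c :: nat \<Rightarrow> 'i \<Rightarrow> 'j \<Rightarrow> complex) (d :: nat \<Rightarrow> 'i \<Rightarrow> 'j \<Rightarrow> complex) \<alpha> \<tau> s.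
       finite I \<Longrightarrow> finite J \<Longrightarrow> 0 < \<alpha> \<Longrightarrow> 0 \<le> \<tau> \<Longrightarrow>
       (\<And>v i j. i \<in> I \<Longrightarrow> j \<in> J \<Longrightarrow> norm (d v i j) \<le> norm (c v i j)) \<Longrightarrow>
       lq_norm s q (\<lambda>v. of_real (square_fun I J (c v))) \<le> ennreal \<tau> \<Longrightarrow>
       real (card {w\<in>signs I J. ennreal \<alpha> < lq_norm s q (\<lambda>v. chaos I J (d v) w)})
         \<le> K\<^sub>0 * (\<tau> / \<alpha>) powr (q * real k) * real (card (signs I J))"
    using lq_norm_chaos_tail[OF \<open>0 < q\<close> k1] by blast
  have K1: "1 \<le> K\<^sub>0 + 1" using \<open>0 < K\<^sub>0\<close> by simp
  obtain C where "0 < C" and upper: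
    "\<And>(W :: ('i set \<times> 'j set) set) (g :: 'i set \<times> 'j set \<Rightarrow> real^'n \<Rightarrow> ennreal) (S :: real^'n \<Rightarrow> ennreal).
      finite W \<Longrightarrow> S \<in> borel_measurable lborel \<Longrightarrow> (\<And>w. w \<in> W \<Longrightarrow> g w \<in> borel_measurable lborel) \<Longrightarrow>
      (\<And>x \<alpha> \<tau>. 0 < \<alpha> \<Longrightarrow> 0 \<le> \<tau> \<Longrightarrow> S x \<le> ennreal \<tau> \<Longrightarrow>
        real (card {w\<in>W. ennreal \<alpha> < g w x}) \<le> (K\<^sub>0 + 1) * (\<tau> / \<alpha>) powr (q * real k) * real (card W)) \<Longrightarrow>
      (\<Sum>w\<in>W. lorentz_modulus r \<theta> (g w)) \<le> ennreal C * of_nat (card W) * lorentz_modulus r \<theta> S"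
    using lorentz_modulus_le_of_tail[OF assms(3,2) m K1] by blast
  define c where "c = \<delta> / 2 * (\<delta> / 2) powr \<theta>"
  have c: "0 < c" using \<delta> by (simp add: c_def)
  show thesis
  proof (rule that[of "1 + C * \<kappa> powr (- r) / c"])
    show "1 \<le> 1 + C * \<kappa> powr (- r) / c" using \<open>0 < C\<close> c by simp
    fix I :: "'i set" and J :: "'j set" and f :: "'i \<Rightarrow> 'j \<Rightarrow> real^'n \<Rightarrow> nat \<Rightarrow> complex" and a :: "'i \<Rightarrow> 'j \<Rightarrow> complex"
    assume fin: "finite I" "finite J"
      and meas: "\<And>i j v. i \<in> I \<Longrightarrow> j \<in> J \<Longrightarrow> (\<lambda>x. f i j x v) \<in> borel_measurable lborel"
      and a: "\<And>i j. i \<in> I \<Longrightarrow> j \<in> J \<Longrightarrow> norm (a i j) \<le> 1"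
    define S where "S x = lq_norm s q (\<lambda>v. of_real (square_fun I J (\<lambda>i j. f i j x v)))" for x
    define g where "g w x = lq_norm s q (\<lambda>v. chaos I J (\<lambda>i j. f i j x v) w)" for w x
    define h where "h w x = lq_norm s q (\<lambda>v. chaos I J (\<lambda>i j. a i j * f i j x v) w)" for w x
    have S [measurable]: "S \<in> borel_measurable lborel"
      unfolding S_def
    proof (rule measurable_lq_norm)
      fix v
      have "(\<lambda>x. square_fun I J (\<lambda>i j. f i j x v)) \<in> borel_measurable lborel"
        by (intro measurable_square_fun meas)
      then show "(\<lambda>x. complex_of_real (square_fun I J (\<lambda>i j. f i j x v))) \<in> borel_measurable lborel"
        by measurable
    qed
    have g [measurable]: "g w \<in> borel_measurable lborel" for w
      unfolding g_def by (intro measurable_lq_norm measurable_chaos meas)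
    have h [measurable]: "h w \<in> borel_measurable lborel" for w
      unfolding h_def by (intro measurable_lq_norm measurable_chaos borel_measurable_times borel_measurable_const meas)
    let ?n = "of_nat (card (signs I J)) :: ennreal"
    have "(\<Sum>w\<in>signs I J. lorentz_modulus r \<theta> (h w)) \<le> ennreal C * ?n * lorentz_modulus r \<theta> S"
    proof (rule upper)
      fix x and \<alpha> \<tau> :: real
      assume "0 < \<alpha>" "0 \<le> \<tau>" "S x \<le> ennreal \<tau>"
      then have "real (card {w\<in>signs I J. ennreal \<alpha> < h w x})
          \<le> K\<^sub>0 * (\<tau> / \<alpha>) powr (q * real k) * real (card (signs I J))"
        unfolding S_def h_def using fin a
        by (intro tail[where c = "\<lambda>v i j. f i j x v"]) (auto simp: norm_mult intro!: mult_left_le_one_le)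
      also have "\<dots> \<le> (K\<^sub>0 + 1) * (\<tau> / \<alpha>) powr (q * real k) * real (card (signs I J))"
        by (intro mult_right_mono) auto
      finally show "real (card {w\<in>signs I J. ennreal \<alpha> < h w x})
          \<le> (K\<^sub>0 + 1) * (\<tau> / \<alpha>) powr (q * real k) * real (card (signs I J))" .
    qed (use fin in auto)
    also have "\<dots> = ennreal (C / c) * (ennreal c * ?n * lorentz_modulus r \<theta> S)"
      using c \<open>0 < C\<close> by (simp add: mult.assoc[symmetric] ennreal_mult[symmetric])
    also have "\<dots> \<le> ennreal (C / c) * (ennreal (\<kappa> powr (- r)) * (\<Sum>w\<in>signs I J. lorentz_modulus r \<theta> (g w)))"
      unfolding c_def
    proof (intro mult_left_mono lorentz_modulus_le_of_large)
      fix x and \<alpha> :: real assume "0 < \<alpha>" "ennreal \<alpha> < S x"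
      then show "\<delta> * real (card (signs I J)) \<le> real (card {w\<in>signs I J. ennreal (\<kappa> * \<alpha>) < g w x})"
        unfolding S_def g_def using fin by (intro large) auto
    qed (use fin assms \<delta> \<kappa> in auto)
    also have "\<dots> = ennreal (C * \<kappa> powr (- r) / c) * (\<Sum>w\<in>signs I J. lorentz_modulus r \<theta> (g w))"
      using c \<open>0 < C\<close> by (simp add: mult.assoc[symmetric] ennreal_mult[symmetric])
    also have "\<dots> \<le> ennreal (1 + C * \<kappa> powr (- r) / c) * (\<Sum>w\<in>signs I J. lorentz_modulus r \<theta> (g w))"
      by (intro mult_right_mono ennreal_leI) auto
    finally show "(\<Sum>w\<in>signs I J. lorentz_modulus r \<theta> (\<lambda>x. lq_norm s q (\<lambda>v. chaos I J (\<lambda>i j. a i j * f i j x v) w)))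
        \<le> ennreal (1 + C * \<kappa> powr (- r) / c) * (\<Sum>w\<in>signs I J. lorentz_modulus r \<theta> (\<lambda>x. lq_norm s q (\<lambda>v. chaos I J (\<lambda>i j. f i j x v) w)))"
      unfolding g_def h_def .
  qed
qed

text \<open>A crude form of the triangle inequality. In each coordinate the sum is at most \<open>M\<close> times its largest
  term, whose \<open>q\<close>-th power is at most the sum of the \<open>q\<close>-th powers of all terms; if every one of the \<open>M\<close>
  sequences were small, so would be this sum.\<close>

lemma lq_norm_chaos_gt_imp:
  fixes I :: "'i set" and J :: "'j set"
  assumes fin: "finite I" "finite J" and ne: "I \<noteq> {}" "J \<noteq> {}" and "0 < q" "0 < \<alpha>"
    and gt: "ennreal \<alpha> < lq_norm s q (\<lambda>v. chaos I J (c v) w)"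
  defines "M \<equiv> real (card (I \<times> J))"
  shows "\<exists>(i, j)\<in>I \<times> J. ennreal (1 / (M * M powr (1 / q)) * \<alpha>) < lq_norm s q (\<lambda>v. c v i j)"
proof (rule ccontr)
  assume neg: "\<not> ?thesis"
  have M: "0 < M" using fin ne by (simp add: M_def card_gt_0_iff)
  define \<beta> where "\<beta> = 1 / (M * M powr (1 / q)) * \<alpha>"
  have "0 < \<beta>" using M \<open>0 < \<alpha>\<close> by (simp add: \<beta>_def)
  have small: "(\<Sum>k<n. (2 powr (real k * s) * norm (c k i j)) powr q) \<le> \<beta> powr q" if "i \<in> I" "j \<in> J" for n i j
  proof -
    have "\<not> ennreal \<beta> < lq_norm s q (\<lambda>v. c v i j)" using neg that by (auto simp: \<beta>_def)
    then show ?thesis using lq_norm_gt_iff[OF \<open>0 < q\<close>, of \<beta> s "\<lambda>v. c v i j"] \<open>0 < \<beta>\<close> by (auto simp: not_less)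
  qed
  obtain n where n: "\<alpha> powr q < (\<Sum>k<n. (2 powr (real k * s) * norm (chaos I J (c k) w)) powr q)"
    using gt \<open>0 < q\<close> \<open>0 < \<alpha>\<close> by (auto simp: lq_norm_gt_iff)
  have pointwise: "norm (chaos I J d w) powr q \<le> M powr q * (\<Sum>(i, j)\<in>I \<times> J. norm (d i j) powr q)" for d
  proof -
    define m where "m = Max ((\<lambda>(i, j). norm (d i j)) ` (I \<times> J))"
    have le_m: "norm (d i j) \<le> m" if "i \<in> I" "j \<in> J" for i j
      unfolding m_def using fin that by (intro Max_ge) (auto intro!: image_eqI[of _ _ "(i, j)"])
    have "m \<in> (\<lambda>(i, j). norm (d i j)) ` (I \<times> J)"
      unfolding m_def using fin ne by (intro Max_in) auto
    then obtain i j where ij: "i \<in> I" "j \<in> J" "m = norm (d i j)" by auto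
    obtain A B where w: "w = (A, B)" by (cases w)
    have "norm (chaos I J d w) \<le> (\<Sum>i\<in>I. \<Sum>j\<in>J. norm (d i j))"
      unfolding w chaos_def prod.case
      by (intro order_trans[OF norm_sum] sum_mono) (auto simp: norm_mult sign_in_def)
    also have "\<dots> \<le> (\<Sum>i\<in>I. \<Sum>j\<in>J. m)"
      using le_m by (intro sum_mono) auto
    also have "\<dots> = M * m" by (simp add: M_def card_cartesian_product)
    finally have "norm (chaos I J d w) powr q \<le> (M * m) powr q"
      using \<open>0 < q\<close> by (intro powr_mono2) auto
    also have "\<dots> = M powr q * norm (d i j) powr q"
      using M ij by (simp add: powr_mult)
    also have "\<dots> \<le> M powr q * (\<Sum>(i, j)\<in>I \<times> J. norm (d i j) powr q)"
      using fin ij member_le_sum[of "(i, j)" "I \<times> J" "\<lambda>(i, j). norm (d i j) powr q"]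
      by (intro mult_left_mono) auto
    finally show ?thesis .
  qed
  have "(\<Sum>k<n. (2 powr (real k * s) * norm (chaos I J (c k) w)) powr q)
      \<le> (\<Sum>k<n. M powr q * (\<Sum>(i, j)\<in>I \<times> J. (2 powr (real k * s) * norm (c k i j)) powr q))"
  proof (rule sum_mono)
    fix k
    have "(2 powr (real k * s)) powr q * norm (chaos I J (c k) w) powr q
        \<le> (2 powr (real k * s)) powr q * (M powr q * (\<Sum>(i, j)\<in>I \<times> J. norm (c k i j) powr q))"
      by (intro mult_left_mono pointwise) auto
    then show "(2 powr (real k * s) * norm (chaos I J (c k) w)) powr q
        \<le> M powr q * (\<Sum>(i, j)\<in>I \<times> J. (2 powr (real k * s) * norm (c k i j)) powr q)"
      by (simp add: powr_mult sum_distrib_left split_beta mult.left_commute)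
  qed
  also have "\<dots> = M powr q * (\<Sum>(i, j)\<in>I \<times> J. \<Sum>k<n. (2 powr (real k * s) * norm (c k i j)) powr q)"
    unfolding sum_distrib_left[symmetric] split_beta by (subst sum.swap) (rule refl)
  also have "\<dots> \<le> M powr q * (\<Sum>(i, j)\<in>I \<times> J. \<beta> powr q)"
    using small by (intro mult_left_mono sum_mono) auto
  also have "\<dots> = M powr q * (M * \<beta> powr q)"
    by (simp add: M_def split_beta)
  also have "\<dots> = \<alpha> powr q"
  proof -
    have "\<beta> powr q = \<alpha> powr q / (M powr q * (M powr (1 / q)) powr q)"
      using M \<open>0 < \<alpha>\<close> by (simp add: \<beta>_def powr_mult powr_divide)
    also have "(M powr (1 / q)) powr q = M" using M \<open>0 < q\<close> by (simp add: powr_powr)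
    finally show ?thesis using M by simp
  qed
  finally show False using n by simp
qed

text \<open>Needed since infinite Lorentz norms are sent to 0 by the real-valued norm. Finiteness follows from the
  comparison lemma, applied with the index pairs in place of the signs: at least one of the finitely many
  functions is large whenever the sum is.\<close>

lemma lorentz_modulus_chaos_finite:
  fixes f :: "'i \<Rightarrow> 'j \<Rightarrow> real^'n \<Rightarrow> nat \<Rightarrow> complex" and q r \<theta> s :: real
  assumes fin: "finite I" "finite J" and ne: "I \<noteq> {}" "J \<noteq> {}" and "0 < q" "0 < \<theta>"
    and meas: "\<And>i j v. i \<in> I \<Longrightarrow> j \<in> J \<Longrightarrow> (\<lambda>x. f i j x v) \<in> borel_measurable lborel"
    and finite: "\<And>i j. i \<in> I \<Longrightarrow> j \<in> J \<Longrightarrow> lorentz_modulus r \<theta> (\<lambda>x. lq_norm s q (f i j x)) < \<infinity>"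
  shows "lorentz_modulus r \<theta> (\<lambda>x. lq_norm s q (\<lambda>v. chaos I J (\<lambda>i j. f i j x v) w)) < \<infinity>"
proof -
  define M where "M = real (card (I \<times> J))"
  have M: "0 < M" using fin ne by (simp add: M_def card_gt_0_iff)
  define \<kappa> where "\<kappa> = 1 / (M * M powr (1 / q))"
  have \<kappa>: "0 < \<kappa>" using M by (simp add: \<kappa>_def)
  \<comment> \<open>At least one of \<open>M\<close> functions.\<close>
  define \<delta> where "\<delta> = 1 / M"
  have \<delta>: "0 < \<delta>" using M by (simp add: \<delta>_def)
  define h where "h x = lq_norm s q (\<lambda>v. chaos I J (\<lambda>i j. f i j x v) w)" for x
  define g where "g u x = lq_norm s q (f (fst u) (snd u) x)" for u x
  have g: "g u \<in> borel_measurable lborel" if "u \<in> I \<times> J" for u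
    unfolding g_def using that by (intro measurable_lq_norm meas) auto
  have h: "h \<in> borel_measurable lborel"
    unfolding h_def by (intro measurable_lq_norm measurable_chaos meas)
  define c where "c = \<delta> / 2 * (\<delta> / 2) powr \<theta>"
  have "0 < c" using \<delta> by (simp add: c_def)
  have "ennreal c * of_nat (card (I \<times> J)) * lorentz_modulus r \<theta> h
      \<le> ennreal (\<kappa> powr (- r)) * (\<Sum>u\<in>I \<times> J. lorentz_modulus r \<theta> (g u))"
    unfolding c_def
  proof (rule lorentz_modulus_le_of_large)
    fix x and \<alpha> :: real assume \<alpha>: "0 < \<alpha>" "ennreal \<alpha> < h x"
    have "\<exists>(i, j)\<in>I \<times> J. ennreal (\<kappa> * \<alpha>) < lq_norm s q (\<lambda>v. f i j x v)"
      unfolding \<kappa>_def M_def using \<alpha>(2)[unfolded h_def]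
      by (rule lq_norm_chaos_gt_imp[OF fin ne \<open>0 < q\<close> \<alpha>(1)])
    then obtain u where "u \<in> {u\<in>I \<times> J. ennreal (\<kappa> * \<alpha>) < g u x}" by (auto simp: g_def)
    then have "1 \<le> card {u\<in>I \<times> J. ennreal (\<kappa> * \<alpha>) < g u x}"
      using fin by (simp add: Suc_le_eq card_gt_0_iff) blast
    then show "\<delta> * real (card (I \<times> J)) \<le> real (card {u\<in>I \<times> J. ennreal (\<kappa> * \<alpha>) < g u x})"
      using M by (simp add: \<delta>_def M_def)
  qed (use fin \<open>0 < \<theta>\<close> \<delta> \<kappa> g h in auto)
  also have "\<dots> < \<infinity>"
  proof -
    have "lorentz_modulus r \<theta> (g u) < top" if "u \<in> I \<times> J" for u
      using finite[of "fst u" "snd u"] that by (auto simp: g_def[abs_def])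
    then have "(\<Sum>u\<in>I \<times> J. lorentz_modulus r \<theta> (g u)) < top"
      using fin by simp
    then show ?thesis by (simp add: ennreal_mult_less_top)
  qed
  finally have "ennreal c * of_nat (card (I \<times> J)) * lorentz_modulus r \<theta> h < \<infinity>" .
  then show ?thesis
    using \<open>0 < c\<close> M by (auto simp: h_def[abs_def] M_def ennreal_mult_less_top ennreal_mult_eq_top_iff less_top)
qed

section \<open>Property alpha\<close>

text \<open>The values of the random sums in the definition of property \<open>(\<alpha>)\<close>, as functions of the signs.\<close>

definition sign_sum ::
  "(complex \<Rightarrow> 'v \<Rightarrow> 'v::ab_group_add) \<Rightarrow> nat \<Rightarrow> (nat \<Rightarrow> nat \<Rightarrow> complex) \<Rightarrow> (nat \<Rightarrow> nat \<Rightarrow> 'v) \<Rightarrow> nat set \<times> nat set \<Rightarrow> 'v" where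
  "sign_sum scl N a x v = (\<Sum>i=1..N. \<Sum>j=1..N. scl (complex_of_real (sign_in (fst v) i * sign_in (snd v) j) * a i j) (x i j))"

lemma Lp_norm_rademacher:
  assumes "prob_space P" "prob_space P'" "rademacher_family P N \<epsilon>" "rademacher_family P' N \<epsilon>'"
  shows "Lp_norm (P \<Otimes>\<^sub>M P') r nrm
      (\<lambda>(w, w'). \<Sum>i=1..N. \<Sum>j=1..N. scl (complex_of_real (\<epsilon> i w * \<epsilon>' j w') * a i j) (x i j))
    = ((\<Sum>v\<in>signs {1..N} {1..N}. nrm (sign_sum scl N a x v) powr r) / 4 ^ N) powr (1 / r)"
proof -
  let ?H = "\<lambda>v. nrm (sign_sum scl N a x v) powr r"
  have "(LINT w|(P \<Otimes>\<^sub>M P'). nrm ((\<lambda>(w, w'). \<Sum>i=1..N. \<Sum>j=1..N. scl (complex_of_real (\<epsilon> i w * \<epsilon>' j w') * a i j) (x i j)) w) powr r)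
    = (LINT w|(P \<Otimes>\<^sub>M P'). ?H (positive_signs N \<epsilon> (fst w), positive_signs N \<epsilon>' (snd w)))"
  proof (rule Bochner_Integration.integral_cong[OF refl])
    fix w assume "w \<in> space (P \<Otimes>\<^sub>M P')"
    then have w: "fst w \<in> space P" "snd w \<in> space P'" by (auto simp: space_pair_measure)
    have "(\<Sum>i=1..N. \<Sum>j=1..N. scl (complex_of_real (\<epsilon> i (fst w) * \<epsilon>' j (snd w)) * a i j) (x i j))
      = sign_sum scl N a x (positive_signs N \<epsilon> (fst w), positive_signs N \<epsilon>' (snd w))"
      unfolding sign_sum_def
      by (intro sum.cong refl) (simp add: rademacher_eq_sign_in[OF assms(3) w(1)] rademacher_eq_sign_in[OF assms(4) w(2)])
    then show "nrm ((\<lambda>(w, w'). \<Sum>i=1..N. \<Sum>j=1..N. scl (complex_of_real (\<epsilon> i w * \<epsilon>' j w') * a i j) (x i j)) w) powr r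
      = ?H (positive_signs N \<epsilon> (fst w), positive_signs N \<epsilon>' (snd w))"
      by (simp add: split_beta)
  qed
  then show ?thesis
    unfolding Lp_norm_def integral_rademacher_pair[OF assms, of ?H] by (rule arg_cong)
qed

lemma property_alphaI:
  fixes scl :: "complex \<Rightarrow> 'v \<Rightarrow> 'v::ab_group_add"
  assumes "1 \<le> r" "0 < K"
    and bound: "\<And>N x a. (\<And>i j. i \<in> {1..N} \<Longrightarrow> j \<in> {1..N} \<Longrightarrow> x i j \<in> V) \<Longrightarrow>
      (\<And>i j. i \<in> {1..N} \<Longrightarrow> j \<in> {1..N} \<Longrightarrow> norm (a i j) \<le> 1) \<Longrightarrow>
      (\<Sum>v\<in>signs {1..N} {1..N}. nrm (sign_sum scl N a x v) powr r)
        \<le> K * (\<Sum>v\<in>signs {1..N} {1..N}. nrm (sign_sum scl N (\<lambda>_ _. 1) x v) powr r)"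
  shows "property_alpha scl V nrm"
proof -
  obtain P :: "(nat \<Rightarrow> bool) measure"
    where P: "prob_space P" "\<And>N. \<exists>\<epsilon>. rademacher_family P N \<epsilon>"
    by (rule ex_rademacher_families) blast
  have "0 < K powr (1 / r)" using \<open>0 < K\<close> by simp
  moreover have "Lp_norm (P \<Otimes>\<^sub>M P) r nrm
        (\<lambda>(w, w'). \<Sum>i=1..N. \<Sum>j=1..N. scl (complex_of_real (\<epsilon> i w * \<epsilon>' j w') * a i j) (x i j))
      \<le> K powr (1 / r) * Lp_norm (P \<Otimes>\<^sub>M P) r nrm
        (\<lambda>(w, w'). \<Sum>i=1..N. \<Sum>j=1..N. scl (complex_of_real (\<epsilon> i w * \<epsilon>' j w')) (x i j))"
    if x: "\<forall>i\<in>{1..N}. \<forall>j\<in>{1..N}. x i j \<in> V \<and> norm (a i j) \<le> 1"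
      and rad: "rademacher_family P N \<epsilon>" "rademacher_family P N \<epsilon>'" for N x a \<epsilon> \<epsilon>'
  proof -
    define F where "F a = (\<Sum>v\<in>signs {1..N} {1..N}. nrm (sign_sum scl N a x v) powr r)" for a
    have F: "0 \<le> F a" for a by (simp add: F_def sum_nonneg)
    have "F a \<le> K * F (\<lambda>_ _. 1)"
      unfolding F_def using x by (intro bound) auto
    then have "F a / 4 ^ N \<le> K * (F (\<lambda>_ _. 1) / 4 ^ N)"
      by (simp add: divide_right_mono)
    then have "(F a / 4 ^ N) powr (1 / r) \<le> (K * (F (\<lambda>_ _. 1) / 4 ^ N)) powr (1 / r)"
      using F \<open>1 \<le> r\<close> by (intro powr_mono2) auto
    also have "\<dots> = K powr (1 / r) * (F (\<lambda>_ _. 1) / 4 ^ N) powr (1 / r)"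
      by (rule powr_mult)
    finally show ?thesis
      using Lp_norm_rademacher[OF P(1) P(1) rad, of r nrm scl a x]
        Lp_norm_rademacher[OF P(1) P(1) rad, of r nrm scl "\<lambda>_ _. 1" x]
      by (simp add: F_def)
  qed
  ultimately show ?thesis
    unfolding property_alpha_def using \<open>1 \<le> r\<close> P by blast
qed

lemma sum_fun_apply: "(\<Sum>i\<in>I. f i) y = (\<Sum>i\<in>I. f i y)" for f :: "'i \<Rightarrow> 'a \<Rightarrow> 'b::comm_monoid_add"
  by (induction I rule: infinite_finite_induct) auto

lemma distr_conv_sign_sum:
  "distr_conv g (sign_sum fun_scale N a u w) y
    = chaos {1..N} {1..N} (\<lambda>i j. a i j * distr_conv g (u i j) y) w"
  by (simp add: distr_conv_def sign_sum_def chaos_def fun_scale_def sum_fun_apply split_beta mult.assoc)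

text \<open>Property \<open>(\<alpha>)\<close> for the quasi-norm, with exponent \<open>r\<close> and written as an inequality between finite sums.
  The constant is at least 1 in order to include the empty sum.\<close>

lemma tll_bound:
  fixes \<phi> :: "nat \<Rightarrow> real^'n \<Rightarrow> complex" and s p q r :: real
  assumes "0 < p" "0 < q" "0 < r"
  obtains K where "1 \<le> K"
    "\<And>N u a. (\<And>i j. i \<in> {1..N} \<Longrightarrow> j \<in> {1..N} \<Longrightarrow> u i j \<in> tll_space \<phi> s r p q) \<Longrightarrow>
      (\<And>i j. i \<in> {1..N} \<Longrightarrow> j \<in> {1..N} \<Longrightarrow> norm (a i j) \<le> 1) \<Longrightarrow>
      (\<Sum>w\<in>signs {1..N} {1..N}. tll_norm \<phi> s r p q (sign_sum fun_scale N a u w) powr r)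
        \<le> K * (\<Sum>w\<in>signs {1..N} {1..N}. tll_norm \<phi> s r p q (sign_sum fun_scale N (\<lambda>_ _. 1) u w) powr r)"
proof -
  define \<theta> where "\<theta> = r / p"
  have \<theta>: "0 < \<theta>" using assms by (simp add: \<theta>_def)
  show thesis
  proof (rule lorentz_modulus_chaos_le[OF \<open>0 < q\<close> \<open>0 < r\<close> \<theta>, where s = s])
    fix K assume "1 \<le> K" and K:
      "\<And>(I :: nat set) (J :: nat set) (f :: nat \<Rightarrow> nat \<Rightarrow> real^'n \<Rightarrow> nat \<Rightarrow> complex) a.
        finite I \<Longrightarrow> finite J \<Longrightarrow>
        (\<And>i j v. i \<in> I \<Longrightarrow> j \<in> J \<Longrightarrow> (\<lambda>x. f i j x v) \<in> borel_measurable lborel) \<Longrightarrow>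
        (\<And>i j. i \<in> I \<Longrightarrow> j \<in> J \<Longrightarrow> norm (a i j) \<le> 1) \<Longrightarrow>
        (\<Sum>w\<in>signs I J. lorentz_modulus r \<theta> (\<lambda>x. lq_norm s q (\<lambda>v. chaos I J (\<lambda>i j. a i j * f i j x v) w)))
          \<le> ennreal K * (\<Sum>w\<in>signs I J. lorentz_modulus r \<theta> (\<lambda>x. lq_norm s q (\<lambda>v. chaos I J (\<lambda>i j. f i j x v) w)))"
    show thesis
    proof (rule that[OF \<open>1 \<le> K\<close>])
      fix N :: nat and u :: "nat \<Rightarrow> nat \<Rightarrow> (real^'n \<Rightarrow> complex) \<Rightarrow> complex" and a :: "nat \<Rightarrow> nat \<Rightarrow> complex"
      assume u: "\<And>i j. i \<in> {1..N} \<Longrightarrow> j \<in> {1..N} \<Longrightarrow> u i j \<in> tll_space \<phi> s r p q"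
        and a: "\<And>i j. i \<in> {1..N} \<Longrightarrow> j \<in> {1..N} \<Longrightarrow> norm (a i j) \<le> 1"
      let ?W = "signs {1..N} {1..N}"
      define f where "f i j x v = distr_conv (\<phi> v) (u i j) x" for i j x v
      define L where "L b w = lorentz_modulus r \<theta> (\<lambda>x. lq_norm s q (\<lambda>v. chaos {1..N} {1..N} (\<lambda>i j. b i j * f i j x v) w))" for b w
      have f: "(\<lambda>x. f i j x v) \<in> borel_measurable lborel" if "i \<in> {1..N}" "j \<in> {1..N}" for i j v
        using u[OF that] by (simp add: tll_space_def lorentz_lq_def f_def)
      have norm_eq: "lorentz_norm (lq_norm s q) p r h = epowr (ennreal p * lorentz_modulus r \<theta> (\<lambda>x. lq_norm s q (h x))) (1 / r)"
        if "\<And>v. (\<lambda>x. h x v) \<in> borel_measurable lborel" for h :: "real^'n \<Rightarrow> nat \<Rightarrow> complex"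
        unfolding \<theta>_def using assms that by (intro lorentz_norm_eq_modulus measurable_lq_norm)
      have f_finite: "lorentz_modulus r \<theta> (\<lambda>x. lq_norm s q (f i j x)) < \<infinity>" if "i \<in> {1..N}" "j \<in> {1..N}" for i j
      proof -
        have "lorentz_norm (lq_norm s q) p r (f i j) < \<infinity>"
          using u[OF that] by (simp add: tll_space_def lorentz_lq_def f_def[abs_def])
        then have "ennreal p * lorentz_modulus r \<theta> (\<lambda>x. lq_norm s q (f i j x)) \<noteq> \<infinity>"
          using norm_eq[of "f i j"] f[OF that] by (auto simp: epowr_eq_top_iff)
        then show ?thesis
          using \<open>0 < p\<close> by (auto simp: ennreal_mult_eq_top_iff less_top)
      qed
      have L_eq: "tll_norm \<phi> s r p q (sign_sum fun_scale N b u w) powr r = p * enn2real (L b w)" for b w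
      proof -
        have "(\<lambda>x. chaos {1..N} {1..N} (\<lambda>i j. b i j * f i j x v) w) \<in> borel_measurable lborel" for v
          by (intro measurable_chaos borel_measurable_times borel_measurable_const f)
        then have "lorentz_norm (lq_norm s q) p r (\<lambda>x v. chaos {1..N} {1..N} (\<lambda>i j. b i j * f i j x v) w)
            = epowr (ennreal p * L b w) (1 / r)"
          unfolding L_def by (rule norm_eq)
        then have "tll_norm \<phi> s r p q (sign_sum fun_scale N b u w) = enn2real (epowr (ennreal p * L b w) (1 / r))"
          by (simp add: tll_norm_def distr_conv_sign_sum f_def)
        also have "\<dots> powr r = enn2real (ennreal p * L b w)"
          using \<open>0 < r\<close> by (cases "ennreal p * L b w") (auto simp: epowr_ennreal powr_powr)
        finally show ?thesis using \<open>0 < p\<close> by (simp add: enn2real_mult)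
      qed
      show "(\<Sum>w\<in>?W. tll_norm \<phi> s r p q (sign_sum fun_scale N a u w) powr r)
          \<le> K * (\<Sum>w\<in>?W. tll_norm \<phi> s r p q (sign_sum fun_scale N (\<lambda>_ _. 1) u w) powr r)"
      proof (cases "N = 0")
        case True
        then have "sign_sum fun_scale N a u w = sign_sum fun_scale N (\<lambda>_ _. 1) u w" for w
          by (simp add: sign_sum_def)
        moreover have "0 \<le> (\<Sum>w\<in>?W. tll_norm \<phi> s r p q (sign_sum fun_scale N (\<lambda>_ _. 1) u w) powr r)"
          by (intro sum_nonneg) auto
        ultimately show ?thesis
          using mult_right_mono[OF \<open>1 \<le> K\<close>] by simp
      next
        case False
        \<comment> \<open>All terms must be shown to be finite before the inequality can be transferred to real numbers.\<close>
      have le: "(\<Sum>w\<in>?W. L a w) \<le> ennreal K * (\<Sum>w\<in>?W. L (\<lambda>_ _. 1) w)"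
          unfolding L_def using K[of "{1..N}" "{1..N}" f a] f a by simp
        have one_finite: "L (\<lambda>_ _. 1) w < \<infinity>" for w
          unfolding L_def mult_1
          using False f f_finite assms \<theta> by (intro lorentz_modulus_chaos_finite) auto
        then have "ennreal K * (\<Sum>w\<in>?W. L (\<lambda>_ _. 1) w) < \<infinity>"
          by (simp add: ennreal_mult_less_top)
        with le have "(\<Sum>w\<in>?W. L a w) < \<infinity>" by (rule le_less_trans)
        then have a_finite: "L a w < \<infinity>" if "w \<in> ?W" for w
          using that by (cases w) auto
        have "(\<Sum>w\<in>?W. enn2real (L a w)) = enn2real (\<Sum>w\<in>?W. L a w)"
          using a_finite by (subst enn2real_sum) auto
        also have "\<dots> \<le> enn2real (ennreal K * (\<Sum>w\<in>?W. L (\<lambda>_ _. 1) w))"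
          using le \<open>ennreal K * (\<Sum>w\<in>?W. L (\<lambda>_ _. 1) w) < \<infinity>\<close> by (intro enn2real_mono) auto
        also have "\<dots> = K * (\<Sum>w\<in>?W. enn2real (L (\<lambda>_ _. 1) w))"
          using \<open>1 \<le> K\<close> one_finite by (simp add: enn2real_mult enn2real_sum)
        finally have "p * (\<Sum>w\<in>?W. enn2real (L a w)) \<le> p * (K * (\<Sum>w\<in>?W. enn2real (L (\<lambda>_ _. 1) w)))"
          using \<open>0 < p\<close> by (intro mult_left_mono) auto
        then show ?thesis
          unfolding L_eq sum_distrib_left[symmetric] by (simp add: mult.left_commute)
      qed
    qed
  qed
qed

theorem proposition3p9:
  fixes \<phi> :: "nat \<Rightarrow> real^'n \<Rightarrow> complex" and s p q r :: real
  assumes "lp_system \<phi>"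
    and "1 < p" and "1 < q" and "1 < r"
  shows "property_alpha fun_scale (tll_space \<phi> s r p q) (tll_norm \<phi> s r p q) \<and>
    (\<forall>nrm. complex_banach_on fun_scale (tll_space \<phi> s r p q) nrm \<and>
       equivalent_norms_on (tll_space \<phi> s r p q) (tll_norm \<phi> s r p q) nrm \<longrightarrow>
       property_alpha fun_scale (tll_space \<phi> s r p q) nrm)"
proof -
  have pos: "0 < p" "0 < q" "0 < r" using assms by simp_all
  let ?scl = "fun_scale :: complex \<Rightarrow> ((real^'n \<Rightarrow> complex) \<Rightarrow> complex) \<Rightarrow> (real^'n \<Rightarrow> complex) \<Rightarrow> complex"
  let ?V = "tll_space \<phi> s r p q" and ?nrm = "tll_norm \<phi> s r p q"
  show ?thesis
  proof (rule tll_bound[OF pos, where s = s and \<phi> = \<phi>])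
    fix K assume "1 \<le> K" and K:
      "\<And>N u a. (\<And>i j. i \<in> {1..N} \<Longrightarrow> j \<in> {1..N} \<Longrightarrow> u i j \<in> ?V) \<Longrightarrow>
        (\<And>i j. i \<in> {1..N} \<Longrightarrow> j \<in> {1..N} \<Longrightarrow> norm (a i j) \<le> 1) \<Longrightarrow>
        (\<Sum>w\<in>signs {1..N} {1..N}. ?nrm (sign_sum fun_scale N a u w) powr r)
          \<le> K * (\<Sum>w\<in>signs {1..N} {1..N}. ?nrm (sign_sum fun_scale N (\<lambda>_ _. 1) u w) powr r)"
    show ?thesis
    proof (intro conjI allI impI)
      show "property_alpha fun_scale ?V ?nrm"
        using \<open>1 < r\<close> \<open>1 \<le> K\<close> K by (intro property_alphaI[of r K]) auto
      fix nrm
      assume "complex_banach_on fun_scale ?V nrm \<and> equivalent_norms_on ?V ?nrm nrm"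
      then have vs: "vector_space ?scl" and sub: "module.subspace fun_scale ?V"
        and nonneg: "\<And>x. x \<in> ?V \<Longrightarrow> 0 \<le> nrm x" and "equivalent_norms_on ?V ?nrm nrm"
        by (auto simp: complex_banach_on_def)
      then obtain c C where "0 < c" "0 < C"
        and eq: "\<And>x. x \<in> ?V \<Longrightarrow> c * ?nrm x \<le> nrm x" "\<And>x. x \<in> ?V \<Longrightarrow> nrm x \<le> C * ?nrm x"
        unfolding equivalent_norms_on_def by blast
      have module: "module ?scl" using vs by (simp add: module_iff_vector_space)
      have in_V: "sign_sum fun_scale N a u w \<in> ?V"
        if "\<And>i j. i \<in> {1..N} \<Longrightarrow> j \<in> {1..N} \<Longrightarrow> u i j \<in> ?V" for N a u w
        unfolding sign_sum_def using that
        by (intro module.subspace_sum[OF module sub] module.subspace_scale[OF module sub])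
      have tll_nonneg: "0 \<le> ?nrm x" for x by (simp add: tll_norm_def)
      show "property_alpha fun_scale ?V nrm"
      proof (rule property_alphaI[of r "C powr r * K / c powr r"])
        show "1 \<le> r" using \<open>1 < r\<close> by simp
        show "0 < C powr r * K / c powr r" using \<open>0 < c\<close> \<open>0 < C\<close> \<open>1 \<le> K\<close> by simp
        fix N :: nat and u and a :: "nat \<Rightarrow> nat \<Rightarrow> complex"
        assume u: "\<And>i j. i \<in> {1..N} \<Longrightarrow> j \<in> {1..N} \<Longrightarrow> u i j \<in> ?V"
          and a: "\<And>i j. i \<in> {1..N} \<Longrightarrow> j \<in> {1..N} \<Longrightarrow> norm (a i j) \<le> 1"
        let ?W = "signs {1..N} {1..N}"
        have "nrm (sign_sum fun_scale N a u w) powr r \<le> C powr r * ?nrm (sign_sum fun_scale N a u w) powr r" for w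
        proof -
          have "nrm (sign_sum fun_scale N a u w) powr r \<le> (C * ?nrm (sign_sum fun_scale N a u w)) powr r"
            using eq(2)[OF in_V[OF u]] nonneg[OF in_V[OF u]] \<open>1 < r\<close> by (intro powr_mono2) auto
          then show ?thesis using \<open>0 < C\<close> tll_nonneg by (simp add: powr_mult)
        qed
        then have "(\<Sum>w\<in>?W. nrm (sign_sum fun_scale N a u w) powr r)
            \<le> C powr r * (\<Sum>w\<in>?W. ?nrm (sign_sum fun_scale N a u w) powr r)"
          unfolding sum_distrib_left by (rule sum_mono)
        also have "\<dots> \<le> C powr r * (K * (\<Sum>w\<in>?W. ?nrm (sign_sum fun_scale N (\<lambda>_ _. 1) u w) powr r))"
          by (intro mult_left_mono K u a) auto
        also have "(\<Sum>w\<in>?W. ?nrm (sign_sum fun_scale N (\<lambda>_ _. 1) u w) powr r)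
            \<le> (\<Sum>w\<in>?W. nrm (sign_sum fun_scale N (\<lambda>_ _. 1) u w) powr r) / c powr r"
          unfolding sum_divide_distrib
        proof (rule sum_mono)
          fix w
          have "(c * ?nrm (sign_sum fun_scale N (\<lambda>_ _. 1) u w)) powr r \<le> nrm (sign_sum fun_scale N (\<lambda>_ _. 1) u w) powr r"
            using eq(1)[OF in_V[OF u]] \<open>0 < c\<close> tll_nonneg \<open>1 < r\<close> by (intro powr_mono2) auto
          then show "?nrm (sign_sum fun_scale N (\<lambda>_ _. 1) u w) powr r
              \<le> nrm (sign_sum fun_scale N (\<lambda>_ _. 1) u w) powr r / c powr r"
            using \<open>0 < c\<close> tll_nonneg by (simp add: powr_mult pos_le_divide_eq mult.commute)
        qed
        finally show "(\<Sum>w\<in>?W. nrm (sign_sum fun_scale N a u w) powr r)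
            \<le> C powr r * K / c powr r * (\<Sum>w\<in>?W. nrm (sign_sum fun_scale N (\<lambda>_ _. 1) u w) powr r)"
          using \<open>1 \<le> K\<close> by (simp add: mult_left_mono)
      qed
    qed
  qed
qed

end
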